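(* Let $\mathscr{J}$ be a system of arities in a symmetric monoidal closed category $\mathscr{V}$ such that $\mathscr{V}_0$ has pullbacks, and let $\mathscr{C}$ be a $\mathscr{J}$-admissible $\mathscr{V}$-category. Given a generating class $\mathscr{G}$ for $\mathscr{C}$, the $\mathscr{V}$-functors $\mathscr{C}(X,-):\mathscr{C}\to\mathscr{V}$ $(X\in\mathscr{G})$ jointly reflect commuting algebra pairs. Hence, if $(\mathscr{T},A)$, $(\mathscr{U},B)$ is an algebra pair in $\mathscr{C}$, then $A$ commutes with $B$ if and only if $\mathscr{C}(X,A-)$ commutes with $\mathscr{C}(X,B-)$ for all $X\in\mathscr{G}$.
   Context: Base setting. $\mathscr{V}$ is a symmetric monoidal closed category with unit object $I$ and underlying ordinary category $\mathscr{V}_0$. By universe enlargement, $\mathscr{V}$ is a full subcategory of a symmetric monoidal closed category $\mathscr{V}'$ that is complete and cocomplete relative to a universe in which everything considered is small, with $\mathscr{V}\hookrightarrow\mathscr{V}'$ preserving all limits that exist in $\mathscr{V}$; $\mathscr{V}$-functor categories exist as $\mathscr{V}'$-categories. A system of arities is a fully faithful symmetric strong monoidal $\mathscr{V}$-functor $\mathscr{J}\to\mathscr{V}$, written as the inclusion of a full sub-$\mathscr{V}$-category containing $I$ and closed under $\otimes$ ($\mathscr{J}$ need not be small). A $\mathscr{J}$-cotensor in a $\mathscr{V}$-category is a cotensor $[J,C]$ with $J\in\mathrm{ob}\,\mathscr{J}$; $\mathscr{V}$-categories with $\mathscr{J}$-cotensors are equipped with designated ones, with $[I,C]=C$ (and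 identity counit). A $\mathscr{J}$-theory is a $\mathscr{V}$-category $\mathscr{T}$ equipped with an identity-on-objects $\mathscr{V}$-functor $\tau:\mathscr{J}^{\mathrm{op}}\to\mathscr{T}$ that preserves $\mathscr{J}$-cotensors; equivalently, $\mathrm{ob}\,\mathscr{T}=\mathrm{ob}\,\mathscr{J}$ and each object $J$ is equipped with a morphism $J\to\mathscr{T}(J,I)$ exhibiting $J$ as a cotensor $[J,I]$ in $\mathscr{T}$, which for $J=I$ is the identity on $I$. A morphism of $\mathscr{J}$-theories is a $\mathscr{V}$-functor commuting with the structure $\mathscr{V}$-functors $\tau$. For a $\mathscr{V}$-category $\mathscr{X}$ with $\mathscr{J}$-cotensors, a $\mathscr{T}$-algebra in $\mathscr{X}$ is a $\mathscr{V}$-functor $A:\mathscr{T}\to\mathscr{X}$ preserving $\mathscr{J}$-cotensors; its carrier is $|A|=A(I)$. $\mathscr{T}\text{-}\mathrm{Alg}(\mathscr{X})$ is the full sub-$\mathscr{V}'$-category of $[\mathscr{T},\mathscr{X}]$ on the $\mathscr{T}$-algebras; for a morphism $f$ in it, $|f|=f_I$. $\mathscr{C}$ is $\mathscr{J}$-admissible if it has $\mathscr{J}$-cotensors and for every $\mathscr{J}$-theory $\mathscr{T}$ the ends defining the hom-objects of $\mathscr{T}\text{-}\mathrm{Alg}(\mathscr{C})$ exist in $\mathscr{V}$ (so it is a $\mathscr{V}$-category). $\mathscr{J}$-cotensors in $\mathscr{T}\text{-}\mathrm{Alg}(\mathscr{X})$ are pointwise, with designated ones chosen so that evaluation at $I$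 sends them to the designated ones in $\mathscr{X}$. Commutation. Let $\mathscr{X}$ be a $\mathscr{V}$-category with $\mathscr{J}$-cotensors (such as $\mathscr{C}$ or $\mathscr{V}$). An algebra in $\mathscr{X}$ is a pair $(\mathscr{T},A)$ (also written $A$) with $\mathscr{T}$ a $\mathscr{J}$-theory and $A$ a $\mathscr{T}$-algebra in $\mathscr{X}$. The commutant of $(\mathscr{T},A)$ is $A^\perp=(\mathscr{T}^\perp_A,A^\perp)$, where $\mathscr{T}^\perp_A$ is the $\mathscr{J}$-theory (enriched in $\mathscr{V}'$ in general, in $\mathscr{V}$ if $\mathscr{X}$ is $\mathscr{J}$-admissible) with $\mathscr{T}^\perp_A(J,K)=\mathscr{T}\text{-}\mathrm{Alg}(\mathscr{X})([J,A],[K,A])$ ($J,K\in\mathrm{ob}\,\mathscr{J}$), with composition and identities as in $\mathscr{T}\text{-}\mathrm{Alg}(\mathscr{X})$ and structure morphisms $J\to\mathscr{T}\text{-}\mathrm{Alg}(\mathscr{X})([J,A],A)$ the cotensor counits, and $A^\perp:\mathscr{T}^\perp_A\to\mathscr{X}$ is the algebra on $|A|$ given by $J\mapsto[J,|A|]$ and on homs by evaluation at $I$. An algebra pair in $\mathscr{X}$ is a pair of algebras $(\mathscr{T},A),(\mathscr{U},B)$ in $\mathscr{X}$ with the same carrier; $A$ commutes with $B$ (the pair is commuting) if there is a morphism of $\mathscr{J}$-theories $M:\mathscr{U}\to\mathscr{T}^\perp_A$ (necessarily unique) and an isomorphism $f:B\to A^\perp M$ of $\mathscr{U}$-algebras with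 $|f|$ the identity on the carrier. Joint reflection. A family of $\mathscr{J}$-cotensor-preserving $\mathscr{V}$-functors $H_\lambda:\mathscr{X}\to\mathscr{Y}_\lambda$ ($\lambda\in\Lambda$, possibly large) jointly reflects commuting algebra pairs if for every algebra pair $(\mathscr{T},A)$, $(\mathscr{U},B)$ in $\mathscr{X}$, if $H_\lambda A$ commutes with $H_\lambda B$ for all $\lambda\in\Lambda$ then $A$ commutes with $B$. The family is jointly faithful if the induced $\mathscr{V}'$-functor $\mathscr{X}\to\prod_\lambda\mathscr{Y}_\lambda$ is faithful, i.e. monomorphic on hom-objects. A (possibly large) set $\mathscr{G}$ of objects of $\mathscr{C}$ is a generating class for $\mathscr{C}$ if the $\mathscr{V}$-functors $\mathscr{C}(X,-):\mathscr{C}\to\mathscr{V}$ ($X\in\mathscr{G}$) are jointly faithful. *)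

theory Defs
  imports "HOL-Library.FuncSet"
begin

section \<open>Ordinary categories, limits\<close>

record ('o, 'a) category =
  Ob :: "'o set"
  Ar :: "'a set"
  Dom :: "'a \<Rightarrow> 'o"
  Cod :: "'a \<Rightarrow> 'o"
  Ide :: "'o \<Rightarrow> 'a"
  Cmp :: "'a \<Rightarrow> 'a \<Rightarrow> 'a" (infixl "\<cdot>\<index>" 70)

definition ahom :: "('o, 'a, 'm) category_scheme \<Rightarrow> 'o \<Rightarrow> 'o \<Rightarrow> 'a set" where
  "ahom C x y = {f \<in> Ar C. Dom C f = x \<and> Cod C f = y}"

locale ordinary_category =
  fixes C :: "('o, 'a, 'm) category_scheme" (structure)
  assumes dom_cod: "f \<in> Ar C \<Longrightarrow> Dom C f \<in> Ob C \<and> Cod C f \<in> Ob C"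
    and ide_in: "x \<in> Ob C \<Longrightarrow> Ide C x \<in> ahom C x x"
    and cmp_in: "f \<in> ahom C x y \<Longrightarrow> g \<in> ahom C y z \<Longrightarrow> g \<cdot> f \<in> ahom C x z"
    and ide_right: "f \<in> ahom C x y \<Longrightarrow> f \<cdot> Ide C x = f"
    and ide_left: "f \<in> ahom C x y \<Longrightarrow> Ide C y \<cdot> f = f"
    and cmp_assoc: "f \<in> ahom C w x \<Longrightarrow> g \<in> ahom C x y \<Longrightarrow> h \<in> ahom C y z \<Longrightarrow>
                    (h \<cdot> g) \<cdot> f = h \<cdot> (g \<cdot> f)"

definition op_category :: "('o, 'a, 'm) category_scheme \<Rightarrow> ('o, 'a) category" where
  "op_category C = \<lparr>Ob = Ob C, Ar = Ar C, Dom = Cod C, Cod = Dom C, Ide = Ide C,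
                    Cmp = (\<lambda>g f. Cmp C f g)\<rparr>"

definition is_iso :: "('o, 'a, 'm) category_scheme \<Rightarrow> 'a \<Rightarrow> bool" where
  "is_iso C f \<longleftrightarrow> f \<in> Ar C \<and>
     (\<exists>g \<in> ahom C (Cod C f) (Dom C f).
        Cmp C g f = Ide C (Dom C f) \<and> Cmp C f g = Ide C (Cod C f))"

definition monic :: "('o, 'a, 'm) category_scheme \<Rightarrow> 'a \<Rightarrow> bool" where
  "monic C f \<longleftrightarrow> f \<in> Ar C \<and>
     (\<forall>w. \<forall>g \<in> ahom C w (Dom C f). \<forall>h \<in> ahom C w (Dom C f).
        Cmp C f g = Cmp C f h \<longrightarrow> g = h)"

definition has_pullbacks :: "('o, 'a, 'm) category_scheme \<Rightarrow> bool" where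
  "has_pullbacks C \<longleftrightarrow>
     (\<forall>f \<in> Ar C. \<forall>g \<in> Ar C. Cod C f = Cod C g \<longrightarrow>
        (\<exists>P \<in> Ob C. \<exists>p \<in> ahom C P (Dom C f). \<exists>q \<in> ahom C P (Dom C g).
           Cmp C f p = Cmp C g q \<and>
           (\<forall>Q \<in> Ob C. \<forall>r \<in> ahom C Q (Dom C f). \<forall>s \<in> ahom C Q (Dom C g).
              Cmp C f r = Cmp C g s \<longrightarrow>
              (\<exists>!h. h \<in> ahom C Q P \<and> Cmp C p h = r \<and> Cmp C q h = s))))"

definition is_diagram ::
  "('i, 'j, 'n) category_scheme \<Rightarrow> ('o, 'a, 'm) category_scheme \<Rightarrow> ('i \<Rightarrow> 'o) \<Rightarrow> ('j \<Rightarrow> 'a) \<Rightarrow> bool" where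
  "is_diagram S C D0 D1 \<longleftrightarrow>
     (\<forall>i \<in> Ob S. D0 i \<in> Ob C) \<and>
     (\<forall>f \<in> Ar S. D1 f \<in> ahom C (D0 (Dom S f)) (D0 (Cod S f))) \<and>
     (\<forall>i \<in> Ob S. D1 (Ide S i) = Ide C (D0 i)) \<and>
     (\<forall>f \<in> Ar S. \<forall>g \<in> Ar S. Cod S f = Dom S g \<longrightarrow> D1 (Cmp S g f) = Cmp C (D1 g) (D1 f))"

definition is_cone ::
  "('i, 'j, 'n) category_scheme \<Rightarrow> ('o, 'a, 'm) category_scheme \<Rightarrow> ('i \<Rightarrow> 'o) \<Rightarrow> ('j \<Rightarrow> 'a) \<Rightarrow>
   'o \<Rightarrow> ('i \<Rightarrow> 'a) \<Rightarrow> bool" where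
  "is_cone S C D0 D1 L p \<longleftrightarrow> L \<in> Ob C \<and> (\<forall>i \<in> Ob S. p i \<in> ahom C L (D0 i)) \<and>
     (\<forall>f \<in> Ar S. Cmp C (D1 f) (p (Dom S f)) = p (Cod S f))"

definition is_limit ::
  "('i, 'j, 'n) category_scheme \<Rightarrow> ('o, 'a, 'm) category_scheme \<Rightarrow> ('i \<Rightarrow> 'o) \<Rightarrow> ('j \<Rightarrow> 'a) \<Rightarrow>
   'o \<Rightarrow> ('i \<Rightarrow> 'a) \<Rightarrow> bool" where
  "is_limit S C D0 D1 L p \<longleftrightarrow> is_cone S C D0 D1 L p \<and>
     (\<forall>Q q. is_cone S C D0 D1 Q q \<longrightarrow>
        (\<exists>!h. h \<in> ahom C Q L \<and> (\<forall>i \<in> Ob S. Cmp C (p i) h = q i)))"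

text \<open>
  Size. A type \<open>'u\<close> bounds the size of the collections considered: a set is \<open>'u\<close>-small if it
  injects into \<open>'u\<close>, and a category is \<open>'u\<close>-complete if it has all limits indexed by categories
  with \<open>'u\<close>-small sets of objects and arrows (up to isomorphism, these are the categories
  carried by the type \<open>'u\<close> itself).
\<close>

definition small_in :: "'u itself \<Rightarrow> 'x set \<Rightarrow> bool" where
  "small_in U S \<longleftrightarrow> (\<exists>e :: 'x \<Rightarrow> 'u. inj_on e S)"

definition has_small_limits :: "'u itself \<Rightarrow> ('o, 'a, 'm) category_scheme \<Rightarrow> bool" where
  "has_small_limits U C \<longleftrightarrow>
     (\<forall>(S :: ('u, 'u) category) D0 D1. ordinary_category S \<and> is_diagram S C D0 D1 \<longrightarrow>
        (\<exists>L p. is_limit S C D0 D1 L p))"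

definition has_small_colimits :: "'u itself \<Rightarrow> ('o, 'a, 'm) category_scheme \<Rightarrow> bool" where
  "has_small_colimits U C \<longleftrightarrow> has_small_limits U (op_category C)"

text \<open>Here the first category is a subcategory of the second.\<close>
definition inclusion_preserves_small_limits ::
  "'u itself \<Rightarrow> ('o, 'a, 'm) category_scheme \<Rightarrow> ('o, 'a, 'n) category_scheme \<Rightarrow> bool" where
  "inclusion_preserves_small_limits U C C' \<longleftrightarrow>
     (\<forall>(S :: ('u, 'u) category) D0 D1 L p.
        ordinary_category S \<and> is_diagram S C D0 D1 \<and> is_limit S C D0 D1 L p \<longrightarrow>
        is_limit S C' D0 D1 L p)"

definition is_product ::
  "('o, 'a, 'm) category_scheme \<Rightarrow> 'i set \<Rightarrow> ('i \<Rightarrow> 'o) \<Rightarrow> 'o \<Rightarrow> ('i \<Rightarrow> 'a) \<Rightarrow> bool" where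
  "is_product C \<Lambda> D P p \<longleftrightarrow> P \<in> Ob C \<and> (\<forall>l \<in> \<Lambda>. p l \<in> ahom C P (D l)) \<and>
     (\<forall>Q \<in> Ob C. \<forall>q. (\<forall>l \<in> \<Lambda>. q l \<in> ahom C Q (D l)) \<longrightarrow>
        (\<exists>!h. h \<in> ahom C Q P \<and> (\<forall>l \<in> \<Lambda>. Cmp C (p l) h = q l)))"


section \<open>Symmetric monoidal closed categories\<close>

record ('o, 'a) smc = "('o, 'a) category" +
  tensor_ob :: "'o \<Rightarrow> 'o \<Rightarrow> 'o" (infixl "\<otimes>\<index>" 75)
  tensor_ar :: "'a \<Rightarrow> 'a \<Rightarrow> 'a" (infixl "\<odot>\<index>" 75)
  unit_ob :: "'o" ("\<one>\<index>")
  assoc_ar :: "'o \<Rightarrow> 'o \<Rightarrow> 'o \<Rightarrow> 'a"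
  lunit_ar :: "'o \<Rightarrow> 'a"
  runit_ar :: "'o \<Rightarrow> 'a"
  sym_ar :: "'o \<Rightarrow> 'o \<Rightarrow> 'a"
  ihom :: "'o \<Rightarrow> 'o \<Rightarrow> 'o"
  ev_ar :: "'o \<Rightarrow> 'o \<Rightarrow> 'a"

locale symmetric_monoidal_closed = ordinary_category V
  for V :: "('o, 'a) smc" (structure) +
  assumes tensor_ob_in: "x \<in> Ob V \<Longrightarrow> y \<in> Ob V \<Longrightarrow> x \<otimes> y \<in> Ob V"
    and tensor_ar_in: "f \<in> ahom V x x' \<Longrightarrow> g \<in> ahom V y y' \<Longrightarrow>
          f \<odot> g \<in> ahom V (x \<otimes> y) (x' \<otimes> y')"
    and tensor_ide: "x \<in> Ob V \<Longrightarrow> y \<in> Ob V \<Longrightarrow> Ide V x \<odot> Ide V y = Ide V (x \<otimes> y)"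
    and tensor_cmp: "f \<in> ahom V x x' \<Longrightarrow> f' \<in> ahom V x' x'' \<Longrightarrow>
          g \<in> ahom V y y' \<Longrightarrow> g' \<in> ahom V y' y'' \<Longrightarrow>
          (f' \<cdot> f) \<odot> (g' \<cdot> g) = (f' \<odot> g') \<cdot> (f \<odot> g)"
    and unit_in: "\<one> \<in> Ob V"
    and assoc_in: "x \<in> Ob V \<Longrightarrow> y \<in> Ob V \<Longrightarrow> z \<in> Ob V \<Longrightarrow>
          assoc_ar V x y z \<in> ahom V (x \<otimes> y \<otimes> z) (x \<otimes> (y \<otimes> z))"
    and assoc_iso: "x \<in> Ob V \<Longrightarrow> y \<in> Ob V \<Longrightarrow> z \<in> Ob V \<Longrightarrow> is_iso V (assoc_ar V x y z)"
    and assoc_nat: "f \<in> ahom V x x' \<Longrightarrow> g \<in> ahom V y y' \<Longrightarrow> h \<in> ahom V z z' \<Longrightarrow>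
          assoc_ar V x' y' z' \<cdot> (f \<odot> g \<odot> h) = (f \<odot> (g \<odot> h)) \<cdot> assoc_ar V x y z"
    and lunit_in: "x \<in> Ob V \<Longrightarrow> lunit_ar V x \<in> ahom V (\<one> \<otimes> x) x"
    and lunit_iso: "x \<in> Ob V \<Longrightarrow> is_iso V (lunit_ar V x)"
    and lunit_nat: "f \<in> ahom V x x' \<Longrightarrow> lunit_ar V x' \<cdot> (Ide V \<one> \<odot> f) = f \<cdot> lunit_ar V x"
    and runit_in: "x \<in> Ob V \<Longrightarrow> runit_ar V x \<in> ahom V (x \<otimes> \<one>) x"
    and runit_iso: "x \<in> Ob V \<Longrightarrow> is_iso V (runit_ar V x)"
    and runit_nat: "f \<in> ahom V x x' \<Longrightarrow> runit_ar V x' \<cdot> (f \<odot> Ide V \<one>) = f \<cdot> runit_ar V x"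
    and pentagon: "w \<in> Ob V \<Longrightarrow> x \<in> Ob V \<Longrightarrow> y \<in> Ob V \<Longrightarrow> z \<in> Ob V \<Longrightarrow>
          assoc_ar V w x (y \<otimes> z) \<cdot> assoc_ar V (w \<otimes> x) y z
          = (Ide V w \<odot> assoc_ar V x y z) \<cdot> assoc_ar V w (x \<otimes> y) z \<cdot> (assoc_ar V w x y \<odot> Ide V z)"
    and triangle: "x \<in> Ob V \<Longrightarrow> y \<in> Ob V \<Longrightarrow>
          (Ide V x \<odot> lunit_ar V y) \<cdot> assoc_ar V x \<one> y = runit_ar V x \<odot> Ide V y"
    and sym_in: "x \<in> Ob V \<Longrightarrow> y \<in> Ob V \<Longrightarrow> sym_ar V x y \<in> ahom V (x \<otimes> y) (y \<otimes> x)"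
    and sym_nat: "f \<in> ahom V x x' \<Longrightarrow> g \<in> ahom V y y' \<Longrightarrow>
          sym_ar V x' y' \<cdot> (f \<odot> g) = (g \<odot> f) \<cdot> sym_ar V x y"
    and sym_sym: "x \<in> Ob V \<Longrightarrow> y \<in> Ob V \<Longrightarrow> sym_ar V y x \<cdot> sym_ar V x y = Ide V (x \<otimes> y)"
    and hexagon: "x \<in> Ob V \<Longrightarrow> y \<in> Ob V \<Longrightarrow> z \<in> Ob V \<Longrightarrow>
          assoc_ar V y z x \<cdot> sym_ar V x (y \<otimes> z) \<cdot> assoc_ar V x y z
          = (Ide V y \<odot> sym_ar V x z) \<cdot> assoc_ar V y x z \<cdot> (sym_ar V x y \<odot> Ide V z)"
    and ihom_in: "x \<in> Ob V \<Longrightarrow> y \<in> Ob V \<Longrightarrow> ihom V x y \<in> Ob V"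
    and ev_in: "x \<in> Ob V \<Longrightarrow> y \<in> Ob V \<Longrightarrow> ev_ar V x y \<in> ahom V (ihom V x y \<otimes> x) y"
    and closed: "x \<in> Ob V \<Longrightarrow> y \<in> Ob V \<Longrightarrow> z \<in> Ob V \<Longrightarrow> f \<in> ahom V (z \<otimes> x) y \<Longrightarrow>
          \<exists>!g. g \<in> ahom V z (ihom V x y) \<and> ev_ar V x y \<cdot> (g \<odot> Ide V x) = f"

text \<open>\<open>cur V z x y f\<close> is the transpose \<open>z \<rightarrow> [x, y]\<close> of \<open>f : z \<otimes> x \<rightarrow> y\<close>.\<close>
definition cur :: "('o, 'a) smc \<Rightarrow> 'o \<Rightarrow> 'o \<Rightarrow> 'o \<Rightarrow> 'a \<Rightarrow> 'a" where
  "cur V z x y f = (THE g. g \<in> ahom V z (ihom V x y) \<and>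
                           Cmp V (ev_ar V x y) (tensor_ar V g (Ide V x)) = f)"

text \<open>\<open>V\<close> is a full subcategory of \<open>V'\<close>, with the restricted symmetric monoidal closed structure.\<close>
definition full_smc_subcategory :: "('o, 'a) smc \<Rightarrow> ('o, 'a) smc \<Rightarrow> bool" where
  "full_smc_subcategory V V' \<longleftrightarrow>
     Ob V \<subseteq> Ob V' \<and>
     Ar V = {f \<in> Ar V'. Dom V' f \<in> Ob V \<and> Cod V' f \<in> Ob V} \<and>
     (\<forall>f \<in> Ar V. Dom V f = Dom V' f \<and> Cod V f = Cod V' f) \<and>
     (\<forall>x \<in> Ob V. Ide V x = Ide V' x) \<and>
     (\<forall>f \<in> Ar V. \<forall>g \<in> Ar V. Cod V f = Dom V g \<longrightarrow> Cmp V g f = Cmp V' g f) \<and>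
     (\<forall>x \<in> Ob V. \<forall>y \<in> Ob V. tensor_ob V x y = tensor_ob V' x y) \<and>
     (\<forall>f \<in> Ar V. \<forall>g \<in> Ar V. tensor_ar V f g = tensor_ar V' f g) \<and>
     unit_ob V = unit_ob V' \<and>
     (\<forall>x \<in> Ob V. \<forall>y \<in> Ob V. \<forall>z \<in> Ob V. assoc_ar V x y z = assoc_ar V' x y z) \<and>
     (\<forall>x \<in> Ob V. lunit_ar V x = lunit_ar V' x \<and> runit_ar V x = runit_ar V' x) \<and>
     (\<forall>x \<in> Ob V. \<forall>y \<in> Ob V. sym_ar V x y = sym_ar V' x y) \<and>
     (\<forall>x \<in> Ob V. \<forall>y \<in> Ob V. ihom V x y = ihom V' x y \<and> ev_ar V x y = ev_ar V' x y)"

text \<open>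
  \<open>V'\<close> is an enlargement of \<open>V\<close> with respect to which \<open>V\<close> is small. If \<open>V'\<close> is complete and
  cocomplete relative to a Grothendieck universe, \<open>'u\<close> may be any infinite set of that universe
  that is large enough; so nothing more than usual is assumed here.
\<close>
definition universe_enlargement :: "'u itself \<Rightarrow> ('o, 'a) smc \<Rightarrow> ('o, 'a) smc \<Rightarrow> bool" where
  "universe_enlargement U V V' \<longleftrightarrow>
     infinite (UNIV :: 'u set) \<and> small_in U (Ob V) \<and> small_in U (Ar V) \<and>
     symmetric_monoidal_closed V' \<and> full_smc_subcategory V V' \<and>
     has_small_limits U V' \<and> has_small_colimits U V' \<and>
     inclusion_preserves_small_limits U V V'"


section \<open>Enriched categories\<close>

record ('c, 'o, 'a) vcat =
  vOb :: "'c set"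
  vHom :: "'c \<Rightarrow> 'c \<Rightarrow> 'o"
  vCmp :: "'c \<Rightarrow> 'c \<Rightarrow> 'c \<Rightarrow> 'a"
  vIde :: "'c \<Rightarrow> 'a"

record ('c, 'd, 'a) vfun =
  FO :: "'c \<Rightarrow> 'd"
  FH :: "'c \<Rightarrow> 'c \<Rightarrow> 'a"

locale enriched_category =
  fixes V :: "('o, 'a) smc" (structure) and X :: "('c, 'o, 'a, 'm) vcat_scheme"
  assumes vHom_in: "x \<in> vOb X \<Longrightarrow> y \<in> vOb X \<Longrightarrow> vHom X x y \<in> Ob V"
    and vIde_in: "x \<in> vOb X \<Longrightarrow> vIde X x \<in> ahom V \<one> (vHom X x x)"
    and vCmp_in: "x \<in> vOb X \<Longrightarrow> y \<in> vOb X \<Longrightarrow> z \<in> vOb X \<Longrightarrow>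
          vCmp X x y z \<in> ahom V (vHom X y z \<otimes> vHom X x y) (vHom X x z)"
    and vCmp_assoc: "w \<in> vOb X \<Longrightarrow> x \<in> vOb X \<Longrightarrow> y \<in> vOb X \<Longrightarrow> z \<in> vOb X \<Longrightarrow>
          vCmp X w x z \<cdot> (vCmp X x y z \<odot> Ide V (vHom X w x))
          = vCmp X w y z \<cdot> (Ide V (vHom X y z) \<odot> vCmp X w x y)
              \<cdot> assoc_ar V (vHom X y z) (vHom X x y) (vHom X w x)"
    and vIde_right: "x \<in> vOb X \<Longrightarrow> y \<in> vOb X \<Longrightarrow>
          vCmp X x x y \<cdot> (Ide V (vHom X x y) \<odot> vIde X x) = runit_ar V (vHom X x y)"
    and vIde_left: "x \<in> vOb X \<Longrightarrow> y \<in> vOb X \<Longrightarrow>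
          vCmp X x y y \<cdot> (vIde X y \<odot> Ide V (vHom X x y)) = lunit_ar V (vHom X x y)"

context
  fixes V :: "('o, 'a) smc" (structure)
begin

definition enriched_functor ::
  "('c, 'o, 'a, 'm) vcat_scheme \<Rightarrow> ('d, 'o, 'a, 'n) vcat_scheme \<Rightarrow> ('c, 'd, 'a) vfun \<Rightarrow> bool" where
  "enriched_functor X Y F \<longleftrightarrow>
     (\<forall>x \<in> vOb X. FO F x \<in> vOb Y) \<and>
     (\<forall>x \<in> vOb X. \<forall>y \<in> vOb X. FH F x y \<in> ahom V (vHom X x y) (vHom Y (FO F x) (FO F y))) \<and>
     (\<forall>x \<in> vOb X. FH F x x \<cdot> vIde X x = vIde Y (FO F x)) \<and>
     (\<forall>x \<in> vOb X. \<forall>y \<in> vOb X. \<forall>z \<in> vOb X.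
        FH F x z \<cdot> vCmp X x y z = vCmp Y (FO F x) (FO F y) (FO F z) \<cdot> (FH F y z \<odot> FH F x y))"

definition vfun_comp :: "('d, 'e, 'a) vfun \<Rightarrow> ('c, 'd, 'a) vfun \<Rightarrow> ('c, 'e, 'a) vfun" where
  "vfun_comp G F = \<lparr>FO = (\<lambda>x. FO G (FO F x)),
                    FH = (\<lambda>x y. FH G (FO F x) (FO F y) \<cdot> FH F x y)\<rparr>"

definition vop :: "('c, 'o, 'a, 'm) vcat_scheme \<Rightarrow> ('c, 'o, 'a) vcat" where
  "vop X = \<lparr>vOb = vOb X, vHom = (\<lambda>x y. vHom X y x),
            vCmp = (\<lambda>x y z. vCmp X z y x \<cdot> sym_ar V (vHom X z y) (vHom X y x)),
            vIde = vIde X\<rparr>"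

text \<open>\<open>V\<close> as a category enriched in itself.\<close>
definition self_enriched :: "('o, 'o, 'a) vcat" where
  "self_enriched = \<lparr>vOb = Ob V, vHom = ihom V,
     vCmp = (\<lambda>x y z. cur V (ihom V y z \<otimes> ihom V x y) x z
               (ev_ar V y z \<cdot> (Ide V (ihom V y z) \<odot> ev_ar V x y)
                  \<cdot> assoc_ar V (ihom V y z) (ihom V x y) x)),
     vIde = (\<lambda>x. cur V \<one> x x (lunit_ar V x))\<rparr>"

definition representable :: "('c, 'o, 'a, 'm) vcat_scheme \<Rightarrow> 'c \<Rightarrow> ('c, 'o, 'a) vfun" where
  "representable X x =
     \<lparr>FO = vHom X x,
      FH = (\<lambda>y z. cur V (vHom X y z) (vHom X x y) (vHom X x z) (vCmp X x y z))\<rparr>"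

definition faithful :: "('c, 'o, 'a, 'm) vcat_scheme \<Rightarrow> ('c, 'd, 'a) vfun \<Rightarrow> bool" where
  "faithful X F \<longleftrightarrow> (\<forall>x \<in> vOb X. \<forall>y \<in> vOb X. monic V (FH F x y))"

subsection \<open>Products of enriched categories\<close>

definition prod_cone :: "'l set \<Rightarrow> ('l \<Rightarrow> 'o) \<Rightarrow> 'o \<times> ('l \<Rightarrow> 'a)" where
  "prod_cone \<Lambda> D = (SOME (P, p). is_product V \<Lambda> D P p)"

definition prod_ob :: "'l set \<Rightarrow> ('l \<Rightarrow> 'o) \<Rightarrow> 'o" where
  "prod_ob \<Lambda> D = fst (prod_cone \<Lambda> D)"

definition prod_proj :: "'l set \<Rightarrow> ('l \<Rightarrow> 'o) \<Rightarrow> 'l \<Rightarrow> 'a" where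
  "prod_proj \<Lambda> D = snd (prod_cone \<Lambda> D)"

definition prod_tuple :: "'l set \<Rightarrow> ('l \<Rightarrow> 'o) \<Rightarrow> 'o \<Rightarrow> ('l \<Rightarrow> 'a) \<Rightarrow> 'a" where
  "prod_tuple \<Lambda> D Q q =
     (THE h. h \<in> ahom V Q (prod_ob \<Lambda> D) \<and> (\<forall>l \<in> \<Lambda>. prod_proj \<Lambda> D l \<cdot> h = q l))"

definition vprod :: "'l set \<Rightarrow> ('l \<Rightarrow> ('d, 'o, 'a, 'n) vcat_scheme) \<Rightarrow> ('l \<Rightarrow> 'd, 'o, 'a) vcat" where
  "vprod \<Lambda> Y =
     (let H = (\<lambda>x y l. vHom (Y l) (x l) (y l)) in
      \<lparr>vOb = (\<Pi>\<^sub>E l \<in> \<Lambda>. vOb (Y l)),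
       vHom = (\<lambda>x y. prod_ob \<Lambda> (H x y)),
       vCmp = (\<lambda>x y z. prod_tuple \<Lambda> (H x z) (prod_ob \<Lambda> (H y z) \<otimes> prod_ob \<Lambda> (H x y))
                 (\<lambda>l. vCmp (Y l) (x l) (y l) (z l)
                        \<cdot> (prod_proj \<Lambda> (H y z) l \<odot> prod_proj \<Lambda> (H x y) l))),
       vIde = (\<lambda>x. prod_tuple \<Lambda> (H x x) \<one> (\<lambda>l. vIde (Y l) (x l)))\<rparr>)"

text \<open>The functor \<open>X \<rightarrow> (\<Prod>l. Y l)\<close> induced by functors \<open>H l : X \<rightarrow> Y l\<close>.\<close>
definition vprod_induced ::
  "('c, 'o, 'a, 'm) vcat_scheme \<Rightarrow> 'l set \<Rightarrow> ('l \<Rightarrow> ('d, 'o, 'a, 'n) vcat_scheme) \<Rightarrow>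
   ('l \<Rightarrow> ('c, 'd, 'a) vfun) \<Rightarrow> ('c, 'l \<Rightarrow> 'd, 'a) vfun" where
  "vprod_induced X \<Lambda> Y H =
     \<lparr>FO = (\<lambda>x. \<lambda>l \<in> \<Lambda>. FO (H l) x),
      FH = (\<lambda>x y. prod_tuple \<Lambda> (\<lambda>l. vHom (Y l) (FO (H l) x) (FO (H l) y)) (vHom X x y)
                    (\<lambda>l. FH (H l) x y))\<rparr>"

subsection \<open>Cotensors\<close>

text \<open>\<open>k : W \<rightarrow> X(P, x)\<close> exhibits \<open>P\<close> as a cotensor \<open>[W, x]\<close>: the induced morphisms
  \<open>X(y, P) \<rightarrow> [W, X(y, x)]\<close> are invertible.\<close>
definition is_cotensor ::
  "('c, 'o, 'a, 'm) vcat_scheme \<Rightarrow> 'o \<Rightarrow> 'c \<Rightarrow> 'c \<Rightarrow> 'a \<Rightarrow> bool" where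
  "is_cotensor X W x P k \<longleftrightarrow>
     W \<in> Ob V \<and> x \<in> vOb X \<and> P \<in> vOb X \<and> k \<in> ahom V W (vHom X P x) \<and>
     (\<forall>y \<in> vOb X. is_iso V
        (cur V (vHom X y P) W (vHom X y x)
           (vCmp X y P x \<cdot> (k \<odot> Ide V (vHom X y P)) \<cdot> sym_ar V (vHom X y P) W)))"

definition preserves_cotensors ::
  "'o set \<Rightarrow> ('c, 'o, 'a, 'm) vcat_scheme \<Rightarrow> ('d, 'o, 'a, 'n) vcat_scheme \<Rightarrow>
   ('c, 'd, 'a) vfun \<Rightarrow> bool" where
  "preserves_cotensors \<J> X Y F \<longleftrightarrow>
     (\<forall>J \<in> \<J>. \<forall>x P k. is_cotensor X J x P k \<longrightarrow>
        is_cotensor Y J (FO F x) (FO F P) (FH F P x \<cdot> k))"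

end

text \<open>Categories with designated cotensors \<open>cotn X J x = [J, x]\<close> with counits \<open>coun X J x\<close>.\<close>
record ('c, 'o, 'a) cvcat = "('c, 'o, 'a) vcat" +
  cotn :: "'o \<Rightarrow> 'c \<Rightarrow> 'c"
  coun :: "'o \<Rightarrow> 'c \<Rightarrow> 'a"


section \<open>Systems of arities, theories, algebras\<close>

record ('o, 'a) theory_rec = "('o, 'o, 'a) vcat" +
  str :: "('o, 'o, 'a) vfun"

context
  fixes V :: "('o, 'a) smc" (structure)
begin

text \<open>The full sub-\<open>V\<close>-category on \<open>\<J>\<close>; its embedding is then fully faithful, symmetric and
  strong monoidal.\<close>
definition system_of_arities :: "'o set \<Rightarrow> bool" where
  "system_of_arities \<J> \<longleftrightarrow> \<J> \<subseteq> Ob V \<and> \<one> \<in> \<J> \<and> (\<forall>J \<in> \<J>. \<forall>K \<in> \<J>. J \<otimes> K \<in> \<J>)"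

definition arities_op :: "'o set \<Rightarrow> ('o, 'o, 'a) vcat" where
  "arities_op \<J> = vop V ((self_enriched V)\<lparr>vOb := \<J>\<rparr>)"

definition designated_cotensors :: "'o set \<Rightarrow> ('c, 'o, 'a) cvcat \<Rightarrow> bool" where
  "designated_cotensors \<J> X \<longleftrightarrow>
     (\<forall>J \<in> \<J>. \<forall>x \<in> vOb X. is_cotensor V X J x (cotn X J x) (coun X J x)) \<and>
     (\<forall>x \<in> vOb X. cotn X \<one> x = x \<and> coun X \<one> x = vIde X x)"

definition is_theory :: "'o set \<Rightarrow> ('o, 'a) theory_rec \<Rightarrow> bool" where
  "is_theory \<J> T \<longleftrightarrow>
     enriched_category V T \<and> vOb T = \<J> \<and>
     enriched_functor V (arities_op \<J>) T (str T) \<and> (\<forall>J \<in> \<J>. FO (str T) J = J) \<and>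
     preserves_cotensors V \<J> (arities_op \<J>) T (str T)"

definition theory_morphism ::
  "'o set \<Rightarrow> ('o, 'a) theory_rec \<Rightarrow> ('o, 'a) theory_rec \<Rightarrow> ('o, 'o, 'a) vfun \<Rightarrow> bool" where
  "theory_morphism \<J> T U M \<longleftrightarrow>
     enriched_functor V T U M \<and>
     (\<forall>J \<in> \<J>. FO (vfun_comp V M (str T)) J = FO (str U) J) \<and>
     (\<forall>J \<in> \<J>. \<forall>K \<in> \<J>. FH (vfun_comp V M (str T)) J K = FH (str U) J K)"

definition is_algebra ::
  "'o set \<Rightarrow> ('o, 'a) theory_rec \<Rightarrow> ('c, 'o, 'a, 'm) vcat_scheme \<Rightarrow> ('o, 'c, 'a) vfun \<Rightarrow> bool" where
  "is_algebra \<J> T X A \<longleftrightarrow> enriched_functor V T X A \<and> preserves_cotensors V \<J> T X A"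

definition algebra_pair ::
  "'o set \<Rightarrow> ('c, 'o, 'a, 'm) vcat_scheme \<Rightarrow> ('o, 'a) theory_rec \<Rightarrow> ('o, 'c, 'a) vfun \<Rightarrow>
   ('o, 'a) theory_rec \<Rightarrow> ('o, 'c, 'a) vfun \<Rightarrow> bool" where
  "algebra_pair \<J> X T A U B \<longleftrightarrow>
     is_theory \<J> T \<and> is_algebra \<J> T X A \<and> is_theory \<J> U \<and> is_algebra \<J> U X B \<and>
     FO A \<one> = FO B \<one>"

subsection \<open>Ends and natural transformations\<close>

text \<open>A \<open>V\<close>-natural family \<open>E \<rightarrow> X(A K, B K)\<close>. Naturality, i.e. equality of the two composites
  \<open>E \<rightarrow> [T(K, L), X(A K, B L)]\<close>, is stated for their transposes.\<close>
definition natural_family ::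
  "('t, 'o, 'a, 'n) vcat_scheme \<Rightarrow> ('c, 'o, 'a, 'm) vcat_scheme \<Rightarrow>
   ('t, 'c, 'a) vfun \<Rightarrow> ('t, 'c, 'a) vfun \<Rightarrow> 'o \<Rightarrow> ('t \<Rightarrow> 'a) \<Rightarrow> bool" where
  "natural_family T X A B E p \<longleftrightarrow>
     E \<in> Ob V \<and>
     (\<forall>K \<in> vOb T. p K \<in> ahom V E (vHom X (FO A K) (FO B K))) \<and>
     (\<forall>K \<in> vOb T. \<forall>L \<in> vOb T.
        vCmp X (FO A K) (FO A L) (FO B L) \<cdot> (p L \<odot> FH A K L)
        = vCmp X (FO A K) (FO B K) (FO B L) \<cdot> (FH B K L \<odot> p K) \<cdot> sym_ar V E (vHom T K L))"

text \<open>\<open>E\<close> is the end of \<open>X(A -, B -)\<close> with projections \<open>p\<close>.\<close>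
definition is_hom_end ::
  "('t, 'o, 'a, 'n) vcat_scheme \<Rightarrow> ('c, 'o, 'a, 'm) vcat_scheme \<Rightarrow>
   ('t, 'c, 'a) vfun \<Rightarrow> ('t, 'c, 'a) vfun \<Rightarrow> 'o \<Rightarrow> ('t \<Rightarrow> 'a) \<Rightarrow> bool" where
  "is_hom_end T X A B E p \<longleftrightarrow> natural_family T X A B E p \<and>
     (\<forall>Q q. natural_family T X A B Q q \<longrightarrow>
        (\<exists>!h. h \<in> ahom V Q E \<and> (\<forall>K \<in> vOb T. p K \<cdot> h = q K)))"

definition admissible :: "'o set \<Rightarrow> ('c, 'o, 'a) cvcat \<Rightarrow> bool" where
  "admissible \<J> X \<longleftrightarrow> designated_cotensors \<J> X \<and>
     (\<forall>T A B. is_theory \<J> T \<and> is_algebra \<J> T X A \<and> is_algebra \<J> T X B \<longrightarrow>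
        (\<exists>E p. is_hom_end T X A B E p))"

text \<open>\<open>V\<close>-natural transformations are the natural families indexed by the unit object.\<close>
definition natural_transformation ::
  "('t, 'o, 'a, 'n) vcat_scheme \<Rightarrow> ('c, 'o, 'a, 'm) vcat_scheme \<Rightarrow>
   ('t, 'c, 'a) vfun \<Rightarrow> ('t, 'c, 'a) vfun \<Rightarrow> ('t \<Rightarrow> 'a) \<Rightarrow> bool" where
  "natural_transformation T X A B f \<longleftrightarrow> natural_family T X A B \<one> f"

text \<open>In the last two lines \<open>lunit_ar V \<one> : \<one> \<otimes> \<one> \<rightarrow> \<one>\<close> is moved to the right-hand side.\<close>
definition natural_iso ::
  "('t, 'o, 'a, 'n) vcat_scheme \<Rightarrow> ('c, 'o, 'a, 'm) vcat_scheme \<Rightarrow>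
   ('t, 'c, 'a) vfun \<Rightarrow> ('t, 'c, 'a) vfun \<Rightarrow> ('t \<Rightarrow> 'a) \<Rightarrow> bool" where
  "natural_iso T X A B f \<longleftrightarrow> natural_transformation T X A B f \<and>
     (\<exists>g. natural_transformation T X B A g \<and>
        (\<forall>K \<in> vOb T.
           vCmp X (FO A K) (FO B K) (FO A K) \<cdot> (g K \<odot> f K) = vIde X (FO A K) \<cdot> lunit_ar V \<one> \<and>
           vCmp X (FO B K) (FO A K) (FO B K) \<cdot> (f K \<odot> g K) = vIde X (FO B K) \<cdot> lunit_ar V \<one>))"

end


section \<open>Categories of algebras and commutants\<close>

context
  fixes V0 :: "('o, 'a) smc" and V :: "('o, 'a) smc" (structure)
begin

text \<open>In this section \<open>V\<close> is an enlargement of \<open>V0\<close>. Ends are taken in \<open>V\<close>, and chosen in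
  \<open>V0\<close> if possible, so that categories of algebras in an admissible category are \<open>V0\<close>-categories.\<close>
definition hom_end ::
  "('t, 'o, 'a, 'n) vcat_scheme \<Rightarrow> ('c, 'o, 'a, 'm) vcat_scheme \<Rightarrow>
   ('t, 'c, 'a) vfun \<Rightarrow> ('t, 'c, 'a) vfun \<Rightarrow> 'o \<times> ('t \<Rightarrow> 'a)" where
  "hom_end T X A B =
     (SOME (E, p). is_hom_end V T X A B E p \<and>
        ((\<exists>E' \<in> Ob V0. \<exists>p'. is_hom_end V T X A B E' p') \<longrightarrow> E \<in> Ob V0))"

definition end_ob ::
  "('t, 'o, 'a, 'n) vcat_scheme \<Rightarrow> ('c, 'o, 'a, 'm) vcat_scheme \<Rightarrow>
   ('t, 'c, 'a) vfun \<Rightarrow> ('t, 'c, 'a) vfun \<Rightarrow> 'o" where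
  "end_ob T X A B = fst (hom_end T X A B)"

definition end_proj ::
  "('t, 'o, 'a, 'n) vcat_scheme \<Rightarrow> ('c, 'o, 'a, 'm) vcat_scheme \<Rightarrow>
   ('t, 'c, 'a) vfun \<Rightarrow> ('t, 'c, 'a) vfun \<Rightarrow> 't \<Rightarrow> 'a" where
  "end_proj T X A B = snd (hom_end T X A B)"

definition end_tuple ::
  "('t, 'o, 'a, 'n) vcat_scheme \<Rightarrow> ('c, 'o, 'a, 'm) vcat_scheme \<Rightarrow>
   ('t, 'c, 'a) vfun \<Rightarrow> ('t, 'c, 'a) vfun \<Rightarrow> 'o \<Rightarrow> ('t \<Rightarrow> 'a) \<Rightarrow> 'a" where
  "end_tuple T X A B Q q =
     (THE h. h \<in> ahom V Q (end_ob T X A B) \<and> (\<forall>K \<in> vOb T. end_proj T X A B K \<cdot> h = q K))"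

definition Alg ::
  "'o set \<Rightarrow> ('o, 'a) theory_rec \<Rightarrow> ('c, 'o, 'a, 'm) vcat_scheme \<Rightarrow> (('o, 'c, 'a) vfun, 'o, 'a) vcat" where
  "Alg \<J> T X =
     \<lparr>vOb = {A. is_algebra V \<J> T X A},
      vHom = end_ob T X,
      vCmp = (\<lambda>A B D. end_tuple T X A D (end_ob T X B D \<otimes> end_ob T X A B)
                (\<lambda>K. vCmp X (FO A K) (FO B K) (FO D K)
                       \<cdot> (end_proj T X B D K \<odot> end_proj T X A B K))),
      vIde = (\<lambda>A. end_tuple T X A A \<one> (\<lambda>K. vIde X (FO A K)))\<rparr>"

text \<open>The action \<open>X(x, y) \<rightarrow> X([J, x], [J, y])\<close> of \<open>[J, -]\<close> on homs.\<close>
definition cotn_map :: "('c, 'o, 'a) cvcat \<Rightarrow> 'o \<Rightarrow> 'c \<Rightarrow> 'c \<Rightarrow> 'a" where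
  "cotn_map X J x y =
     (THE t. t \<in> ahom V (vHom X x y) (vHom X (cotn X J x) (cotn X J y)) \<and>
        vCmp X (cotn X J x) (cotn X J y) y \<cdot> (coun X J y \<odot> t)
        = vCmp X (cotn X J x) x y \<cdot> (Ide V (vHom X x y) \<odot> coun X J x) \<cdot> sym_ar V J (vHom X x y))"

text \<open>The designated (pointwise) cotensor \<open>[J, A]\<close> of an algebra. The case distinction
  makes \<open>[\<one>, A]\<close> equal to \<open>A\<close> also as a record, off the objects of the theory.\<close>
definition alg_cotn :: "('c, 'o, 'a) cvcat \<Rightarrow> 'o \<Rightarrow> ('o, 'c, 'a) vfun \<Rightarrow> ('o, 'c, 'a) vfun" where
  "alg_cotn X J A =
     (if J = \<one> then A
      else \<lparr>FO = (\<lambda>K. cotn X J (FO A K)),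
            FH = (\<lambda>K L. cotn_map X J (FO A K) (FO A L) \<cdot> FH A K L)\<rparr>)"

definition alg_coun ::
  "('o, 'a) theory_rec \<Rightarrow> ('c, 'o, 'a) cvcat \<Rightarrow> 'o \<Rightarrow> ('o, 'c, 'a) vfun \<Rightarrow> 'a" where
  "alg_coun T X J A = end_tuple T X (alg_cotn X J A) A J (\<lambda>K. coun X J (FO A K))"

text \<open>The commutant. Its structure functor is the one corresponding to the structure morphisms
  \<open>alg_coun T X J A : J \<rightarrow> Alg([J, A], A)\<close>: its component \<open>[K, J] \<rightarrow> Alg([J, A], [K, A])\<close> is the
  one that, through the cotensor \<open>[K, A]\<close>, corresponds to evaluation \<open>K \<otimes> [K, J] \<rightarrow> J\<close> followed
  by the structure morphism for \<open>J\<close>.\<close>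
definition commutant ::
  "'o set \<Rightarrow> ('o, 'a) theory_rec \<Rightarrow> ('c, 'o, 'a) cvcat \<Rightarrow> ('o, 'c, 'a) vfun \<Rightarrow> ('o, 'a) theory_rec" where
  "commutant \<J> T X A =
     (let \<A> = Alg \<J> T X; P = (\<lambda>J. alg_cotn X J A) in
      \<lparr>vOb = \<J>,
       vHom = (\<lambda>J K. vHom \<A> (P J) (P K)),
       vCmp = (\<lambda>J K L. vCmp \<A> (P J) (P K) (P L)),
       vIde = (\<lambda>J. vIde \<A> (P J)),
       str = \<lparr>FO = (\<lambda>J. J),
              FH = (\<lambda>J K. THE t. t \<in> ahom V (ihom V K J) (vHom \<A> (P J) (P K)) \<and>
                      vCmp \<A> (P J) (P K) A \<cdot> (alg_coun T X K A \<odot> t)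
                      = alg_coun T X J A \<cdot> ev_ar V K J \<cdot> sym_ar V K (ihom V K J))\<rparr>\<rparr>)"

definition commutant_algebra ::
  "('o, 'a) theory_rec \<Rightarrow> ('c, 'o, 'a) cvcat \<Rightarrow> ('o, 'c, 'a) vfun \<Rightarrow> ('o, 'c, 'a) vfun" where
  "commutant_algebra T X A =
     \<lparr>FO = (\<lambda>J. cotn X J (FO A \<one>)),
      FH = (\<lambda>J K. end_proj T X (alg_cotn X J A) (alg_cotn X K A) \<one>)\<rparr>"

definition commutes ::
  "'o set \<Rightarrow> ('c, 'o, 'a) cvcat \<Rightarrow> ('o, 'a) theory_rec \<Rightarrow> ('o, 'c, 'a) vfun \<Rightarrow>
   ('o, 'a) theory_rec \<Rightarrow> ('o, 'c, 'a) vfun \<Rightarrow> bool" where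
  "commutes \<J> X T A U B \<longleftrightarrow>
     (\<exists>M f. theory_morphism V \<J> U (commutant \<J> T X A) M \<and>
        natural_iso V U X B (vfun_comp V (commutant_algebra T X A) M) f \<and>
        f \<one> = vIde X (FO B \<one>))"

definition jointly_reflects_commuting ::
  "'o set \<Rightarrow> ('c, 'o, 'a) cvcat \<Rightarrow> 'l set \<Rightarrow> ('l \<Rightarrow> ('d, 'o, 'a) cvcat) \<Rightarrow>
   ('l \<Rightarrow> ('c, 'd, 'a) vfun) \<Rightarrow> bool" where
  "jointly_reflects_commuting \<J> X \<Lambda> Y H \<longleftrightarrow>
     (\<forall>l \<in> \<Lambda>. enriched_functor V0 X (Y l) (H l) \<and> preserves_cotensors V0 \<J> X (Y l) (H l)) \<and>
     (\<forall>T A U B. algebra_pair V0 \<J> X T A U B \<longrightarrow>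
        (\<forall>l \<in> \<Lambda>. commutes \<J> (Y l) T (vfun_comp V0 (H l) A) U (vfun_comp V0 (H l) B)) \<longrightarrow>
        commutes \<J> X T A U B)"

definition jointly_faithful ::
  "('c, 'o, 'a, 'm) vcat_scheme \<Rightarrow> 'l set \<Rightarrow> ('l \<Rightarrow> ('d, 'o, 'a, 'n) vcat_scheme) \<Rightarrow>
   ('l \<Rightarrow> ('c, 'd, 'a) vfun) \<Rightarrow> bool" where
  "jointly_faithful X \<Lambda> Y H \<longleftrightarrow> faithful V X (vprod_induced V X \<Lambda> Y H)"

definition generating_class :: "('c, 'o, 'a, 'm) vcat_scheme \<Rightarrow> 'c set \<Rightarrow> bool" where
  "generating_class X \<G> \<longleftrightarrow> \<G> \<subseteq> vOb X \<and>
     jointly_faithful X \<G> (\<lambda>_. self_enriched V0) (representable V0 X)"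

end

end

theory Submission
  imports Defs
begin

text \<open>
  A family of operations \<open>U(J, \<one>) \<rightarrow> X(A \<one>\<^sup>J, A \<one>)\<close> consists of homomorphisms of \<open>T\<close>-algebras if it
  extends to a \<open>V'\<close>-natural family \<open>U(J, \<one>) \<rightarrow> X([J, A L], A L)\<close>. Commutation of \<open>A\<close> with \<open>B\<close> amounts
  to such an extension for every arity \<open>J\<close>: the extensions are the components of the morphism
  \<open>U(J, \<one>) \<rightarrow> Alg([J, A], A)\<close>, from which \<open>U(J, K) \<rightarrow> Alg([J, A], [K, A])\<close> is obtained through the
  cotensor \<open>[K, A]\<close>, and functoriality may be tested after evaluation at the unit, which is monic
  because \<open>A L\<close> is a cotensor \<open>[L, A \<one>]\<close>. In the same way the component of an extension at \<open>L\<close> is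
  determined by the component at the unit, and it can be constructed from it in \<open>\<C>\<close>; only its
  naturality has to be checked. That is an equation between morphisms into a hom-object of \<open>\<C>\<close>. The
  functors \<open>\<C>(X, -)\<close> preserve all the data, so they preserve extensions, and the equation holds
  in \<open>\<C>\<close> if it holds after applying each \<open>\<C>(X, -)\<close>, since these are jointly faithful. All ends and
  products needed exist in \<open>V'\<close>.
\<close>

section \<open>Coherence in symmetric monoidal closed categories\<close>

text \<open>The functor \<C>(X, -) sends the designated cotensor [J, A] to some cotensor of \<C>(X,
  A -), in general not to the designated one in \<V>. This is why \<open>operations_extend\<close>
  takes the cotensor \<open>D\<close> and its counit \<open>k\<close> as parameters, why its
  independence of that choice has to be proved, and why \<open>B J\<close> is tied to the cotensor
  \<open>D \<one>\<close> of the carrier only by an existentially quantified comparison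
  \<open>m\<close>. The universal property of a cotensor is used as a bijection between generalized
  morphisms E \<rightarrow> X(y, P) and W \<otimes> E \<rightarrow> X(y, x). The price is
  bookkeeping with associators and symmetries, hence the coherence results below. Commutants in \<V>
  are built from ends that are only known to exist in V', so commutation is analysed over V'. The
  representables, however, are functors into V enriched in itself, and their preservation of
  cotensors is proved over V. The passage between the bases is not formal: the bijection quantifies
  over more objects E in V' than in V. It goes up because invertibility of the comparison X(y, P)
  \<rightarrow> [W, X(y, x)] does, and down because the inclusion is full.\<close>

lemma ahom_iff: "f \<in> ahom C x y \<longleftrightarrow> f \<in> Ar C \<and> Dom C f = x \<and> Cod C f = y"
  by (auto simp: ahom_def)

definition inv_ar :: "('o, 'a, 'm) category_scheme \<Rightarrow> 'a \<Rightarrow> 'a" where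
  "inv_ar C f = (SOME g. g \<in> ahom C (Cod C f) (Dom C f) \<and>
     Cmp C g f = Ide C (Dom C f) \<and> Cmp C f g = Ide C (Cod C f))"

section \<open>Elementary calculus in a category: composition, inverses, cancellation\<close>

context ordinary_category
begin

lemma Dom_Ob [simp]: "f \<in> Ar C \<Longrightarrow> Dom C f \<in> Ob C"
  and Cod_Ob [simp]: "f \<in> Ar C \<Longrightarrow> Cod C f \<in> Ob C"
  using dom_cod by auto

lemma Ide_simps [simp]:
  assumes "x \<in> Ob C"
  shows "Ide C x \<in> Ar C" "Dom C (Ide C x) = x" "Cod C (Ide C x) = x"
  using ide_in[OF assms] by (auto simp: ahom_iff)

lemma Cmp_simps [simp]:
  assumes "f \<in> Ar C" "g \<in> Ar C" "Dom C g = Cod C f"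
  shows "g \<cdot> f \<in> Ar C" "Dom C (g \<cdot> f) = Dom C f" "Cod C (g \<cdot> f) = Cod C g"
  using cmp_in[of f "Dom C f" "Cod C f" g "Cod C g"] assms by (auto simp: ahom_iff)

lemma Cmp_Ide [simp]: "f \<in> Ar C \<Longrightarrow> Dom C f = x \<Longrightarrow> f \<cdot> Ide C x = f"
  and Ide_Cmp [simp]: "f \<in> Ar C \<Longrightarrow> Cod C f = x \<Longrightarrow> Ide C x \<cdot> f = f"
  using ide_right ide_left by (auto simp: ahom_iff)

lemma Cmp_assoc [simp]:
  assumes "f \<in> Ar C" "g \<in> Ar C" "h \<in> Ar C" "Dom C g = Cod C f" "Dom C h = Cod C g"
  shows "(h \<cdot> g) \<cdot> f = h \<cdot> (g \<cdot> f)"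
  using cmp_assoc assms by (auto simp: ahom_iff)

lemma inv_ar:
  assumes "is_iso C f"
  shows "inv_ar C f \<in> ahom C (Cod C f) (Dom C f)"
    "inv_ar C f \<cdot> f = Ide C (Dom C f)" "f \<cdot> inv_ar C f = Ide C (Cod C f)"
proof -
  from assms have "\<exists>g. g \<in> ahom C (Cod C f) (Dom C f) \<and>
     g \<cdot> f = Ide C (Dom C f) \<and> f \<cdot> g = Ide C (Cod C f)"
    unfolding is_iso_def by auto
  from someI_ex[OF this] show "inv_ar C f \<in> ahom C (Cod C f) (Dom C f)"
    "inv_ar C f \<cdot> f = Ide C (Dom C f)" "f \<cdot> inv_ar C f = Ide C (Cod C f)"
    unfolding inv_ar_def by auto
qed

lemma inv_ar_simps [simp]:
  assumes "is_iso C f"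
  shows "inv_ar C f \<in> Ar C" "Dom C (inv_ar C f) = Cod C f" "Cod C (inv_ar C f) = Dom C f"
    "inv_ar C f \<cdot> f = Ide C (Dom C f)" "f \<cdot> inv_ar C f = Ide C (Cod C f)"
  using inv_ar[OF assms] by (auto simp: ahom_iff)

lemma is_iso_Ar: "is_iso C f \<Longrightarrow> f \<in> Ar C"
  by (simp add: is_iso_def)

lemma inv_ar_cancel [simp]:
  assumes "is_iso C f" "g \<in> Ar C"
  shows "Cod C g = Dom C f \<Longrightarrow> inv_ar C f \<cdot> (f \<cdot> g) = g"
    and "Cod C g = Cod C f \<Longrightarrow> f \<cdot> (inv_ar C f \<cdot> g) = g"
proof -
  note [simp] = is_iso_Ar[OF assms(1)]
  show "inv_ar C f \<cdot> (f \<cdot> g) = g" if "Cod C g = Dom C f"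
    using Cmp_assoc[of g f "inv_ar C f"] assms that by simp
  show "f \<cdot> (inv_ar C f \<cdot> g) = g" if "Cod C g = Cod C f"
    using Cmp_assoc[of g "inv_ar C f" f] assms that by simp
qed

lemma iso_epi:
  assumes "is_iso C e" "g \<cdot> e = h \<cdot> e" "g \<in> Ar C" "h \<in> Ar C" "Dom C g = Cod C e" "Dom C h = Cod C e"
  shows "g = h"
proof -
  have "g = (g \<cdot> e) \<cdot> inv_ar C e"
    using Cmp_assoc[of "inv_ar C e" e g] assms by (simp add: is_iso_Ar)
  also have "\<dots> = h"
    using Cmp_assoc[of "inv_ar C e" e h] assms by (simp add: is_iso_Ar)
  finally show ?thesis .
qed

lemma iso_mono:
  assumes "is_iso C e" "e \<cdot> g = e \<cdot> h" "g \<in> Ar C" "h \<in> Ar C" "Dom C e = Cod C g" "Dom C e = Cod C h"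
  shows "g = h"
proof -
  have "g = inv_ar C e \<cdot> (e \<cdot> g)" using assms(1,3,5) by simp
  also have "\<dots> = h" unfolding assms(2) using assms(1,4,6) by simp
  finally show ?thesis .
qed

lemma is_isoI:
  assumes "f \<in> Ar C" "g \<in> Ar C" "Dom C g = Cod C f" "Cod C g = Dom C f"
    "g \<cdot> f = Ide C (Dom C f)" "f \<cdot> g = Ide C (Cod C f)"
  shows "is_iso C f"
  using assms unfolding is_iso_def by (auto simp: ahom_iff)

lemma is_iso_Cmp:
  assumes "is_iso C f" "is_iso C g" "Dom C g = Cod C f"
  shows "is_iso C (g \<cdot> f)"
proof -
  note [simp] = is_iso_Ar[OF assms(1)] is_iso_Ar[OF assms(2)]
  show ?thesis using assms by (intro is_isoI[of _ "inv_ar C f \<cdot> inv_ar C g"]) auto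
qed

text \<open>The Yoneda argument: the preimage \<open>g\<close> of the identity is a right inverse,
  and it is also a left inverse because \<open>g \<cdot> f\<close> and the identity are both
  preimages of \<open>f\<close>.\<close>

lemma is_iso_if_bijective:
  assumes f: "f \<in> Ar C"
    and bij: "\<And>E s. E \<in> Ob C \<Longrightarrow> s \<in> ahom C E (Cod C f) \<Longrightarrow> \<exists>!t. t \<in> ahom C E (Dom C f) \<and> f \<cdot> t = s"
  shows "is_iso C f"
proof -
  obtain g where g: "g \<in> ahom C (Cod C f) (Dom C f)" "f \<cdot> g = Ide C (Cod C f)"
    using bij[of "Cod C f" "Ide C (Cod C f)"] f by (auto simp: ahom_iff)
  have "\<exists>!t. t \<in> ahom C (Dom C f) (Dom C f) \<and> f \<cdot> t = f"
    using bij[of "Dom C f" f] f by (auto simp: ahom_iff)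
  moreover have "f \<cdot> (g \<cdot> f) = f"
    using Cmp_assoc[of f g f] f g by (simp add: ahom_iff)
  moreover have "g \<cdot> f \<in> ahom C (Dom C f) (Dom C f)" "Ide C (Dom C f) \<in> ahom C (Dom C f) (Dom C f)"
      "f \<cdot> Ide C (Dom C f) = f"
    using f g by (simp_all add: ahom_iff)
  ultimately have "g \<cdot> f = Ide C (Dom C f)" by blast
  with f g show ?thesis by (intro is_isoI[of _ g]) (auto simp: ahom_iff)
qed

end

section \<open>Typing and naturality of the tensor and its constraints\<close>

context symmetric_monoidal_closed
begin

declare tensor_ob_in [simp] unit_in [simp] ihom_in [simp]

lemma tensor_simps [simp]:
  assumes "f \<in> Ar V" "g \<in> Ar V"
  shows "f \<odot> g \<in> Ar V" "Dom V (f \<odot> g) = Dom V f \<otimes> Dom V g" "Cod V (f \<odot> g) = Cod V f \<otimes> Cod V g"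
  using tensor_ar_in[of f "Dom V f" "Cod V f" g "Dom V g" "Cod V g"] assms by (auto simp: ahom_iff)

lemma assoc_simps [simp]:
  assumes "x \<in> Ob V" "y \<in> Ob V" "z \<in> Ob V"
  shows "assoc_ar V x y z \<in> Ar V" "Dom V (assoc_ar V x y z) = x \<otimes> y \<otimes> z"
    "Cod V (assoc_ar V x y z) = x \<otimes> (y \<otimes> z)" "is_iso V (assoc_ar V x y z)"
  using assoc_in[OF assms] assoc_iso[OF assms] by (auto simp: ahom_iff)

lemma lunit_simps [simp]:
  assumes "x \<in> Ob V"
  shows "lunit_ar V x \<in> Ar V" "Dom V (lunit_ar V x) = \<one> \<otimes> x"
    "Cod V (lunit_ar V x) = x" "is_iso V (lunit_ar V x)"
  using lunit_in[OF assms] lunit_iso[OF assms] by (auto simp: ahom_iff)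

lemma runit_simps [simp]:
  assumes "x \<in> Ob V"
  shows "runit_ar V x \<in> Ar V" "Dom V (runit_ar V x) = x \<otimes> \<one>"
    "Cod V (runit_ar V x) = x" "is_iso V (runit_ar V x)"
  using runit_in[OF assms] runit_iso[OF assms] by (auto simp: ahom_iff)

lemma sym_simps [simp]:
  assumes "x \<in> Ob V" "y \<in> Ob V"
  shows "sym_ar V x y \<in> Ar V" "Dom V (sym_ar V x y) = x \<otimes> y"
    "Cod V (sym_ar V x y) = y \<otimes> x" "sym_ar V y x \<cdot> sym_ar V x y = Ide V (x \<otimes> y)"
  using sym_in[OF assms] sym_sym[OF assms] by (auto simp: ahom_iff)

lemma sym_iso [simp]: "x \<in> Ob V \<Longrightarrow> y \<in> Ob V \<Longrightarrow> is_iso V (sym_ar V x y)"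
  by (rule is_isoI[of _ "sym_ar V y x"]) auto

lemma sym_cancel [simp]:
  assumes "x \<in> Ob V" "y \<in> Ob V" "f \<in> Ar V" "Cod V f = x \<otimes> y"
  shows "sym_ar V y x \<cdot> (sym_ar V x y \<cdot> f) = f"
  using Cmp_assoc[of f "sym_ar V x y" "sym_ar V y x"] assms by simp

lemma ev_simps [simp]:
  assumes "x \<in> Ob V" "y \<in> Ob V"
  shows "ev_ar V x y \<in> Ar V" "Dom V (ev_ar V x y) = ihom V x y \<otimes> x" "Cod V (ev_ar V x y) = y"
  using ev_in[OF assms] by (auto simp: ahom_iff)

lemma tensor_Ide [simp]: "x \<in> Ob V \<Longrightarrow> y \<in> Ob V \<Longrightarrow> Ide V x \<odot> Ide V y = Ide V (x \<otimes> y)"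
  by (rule tensor_ide)

lemma interchange:
  assumes "f \<in> Ar V" "f' \<in> Ar V" "g \<in> Ar V" "g' \<in> Ar V" "Dom V f' = Cod V f" "Dom V g' = Cod V g"
  shows "(f' \<odot> g') \<cdot> (f \<odot> g) = (f' \<cdot> f) \<odot> (g' \<cdot> g)"
  using tensor_cmp[of f "Dom V f" "Cod V f" f' "Cod V f'" g "Dom V g" "Cod V g" g' "Cod V g'"] assms
  by (auto simp: ahom_iff)

lemma interchange_assoc:
  assumes "f \<in> Ar V" "f' \<in> Ar V" "g \<in> Ar V" "g' \<in> Ar V" "Dom V f' = Cod V f" "Dom V g' = Cod V g"
    "h \<in> Ar V" "Cod V h = Dom V f \<otimes> Dom V g"
  shows "(f' \<odot> g') \<cdot> ((f \<odot> g) \<cdot> h) = ((f' \<cdot> f) \<odot> (g' \<cdot> g)) \<cdot> h"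
  using assms interchange[of f f' g g', symmetric] by simp

lemma Ide_tensor_Cmp:
  assumes "f \<in> Ar V" "g \<in> Ar V" "Dom V g = Cod V f" "x \<in> Ob V"
  shows "Ide V x \<odot> (g \<cdot> f) = (Ide V x \<odot> g) \<cdot> (Ide V x \<odot> f)"
  using assms by (simp add: interchange)

lemma Cmp_tensor_Ide:
  assumes "f \<in> Ar V" "g \<in> Ar V" "Dom V g = Cod V f" "x \<in> Ob V"
  shows "(g \<cdot> f) \<odot> Ide V x = (g \<odot> Ide V x) \<cdot> (f \<odot> Ide V x)"
  using assms by (simp add: interchange)

lemma is_iso_tensor:
  assumes "is_iso V f" "is_iso V g"
  shows "is_iso V (f \<odot> g)"
proof -
  note [simp] = is_iso_Ar[OF assms(1)] is_iso_Ar[OF assms(2)]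
  show ?thesis using assms by (intro is_isoI[of _ "inv_ar V f \<odot> inv_ar V g"]) (auto simp: interchange)
qed

lemma is_iso_Ide [simp]: "x \<in> Ob V \<Longrightarrow> is_iso V (Ide V x)"
  by (rule is_isoI[of _ "Ide V x"]) auto

lemma assoc_natural:
  assumes "f \<in> Ar V" "g \<in> Ar V" "h \<in> Ar V" "Cod V f = x'" "Cod V g = y'" "Cod V h = z'"
  shows "assoc_ar V x' y' z' \<cdot> (f \<odot> g \<odot> h)
    = (f \<odot> (g \<odot> h)) \<cdot> assoc_ar V (Dom V f) (Dom V g) (Dom V h)"
  using assoc_nat[of f "Dom V f" "Cod V f" g "Dom V g" "Cod V g" h "Dom V h" "Cod V h"] assms
  by (auto simp: ahom_iff)

lemma assoc_natural_assoc:
  assumes "f \<in> Ar V" "g \<in> Ar V" "h \<in> Ar V" "Cod V f = x'" "Cod V g = y'" "Cod V h = z'"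
    "k \<in> Ar V" "Cod V k = Dom V f \<otimes> Dom V g \<otimes> Dom V h"
  shows "assoc_ar V x' y' z' \<cdot> ((f \<odot> g \<odot> h) \<cdot> k)
    = (f \<odot> (g \<odot> h)) \<cdot> (assoc_ar V (Dom V f) (Dom V g) (Dom V h) \<cdot> k)"
proof -
  have "assoc_ar V x' y' z' \<cdot> ((f \<odot> g \<odot> h) \<cdot> k) = (assoc_ar V x' y' z' \<cdot> (f \<odot> g \<odot> h)) \<cdot> k"
    using assms by (intro Cmp_assoc[symmetric]) auto
  with assms show ?thesis by (subst (asm) assoc_natural) auto
qed

lemma lunit_natural:
  assumes "f \<in> Ar V" "Cod V f = y"
  shows "lunit_ar V y \<cdot> (Ide V \<one> \<odot> f) = f \<cdot> lunit_ar V (Dom V f)"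
  using lunit_nat[of f "Dom V f" "Cod V f"] assms by (auto simp: ahom_iff)

lemma runit_natural:
  assumes "f \<in> Ar V" "Cod V f = y"
  shows "runit_ar V y \<cdot> (f \<odot> Ide V \<one>) = f \<cdot> runit_ar V (Dom V f)"
  using runit_nat[of f "Dom V f" "Cod V f"] assms by (auto simp: ahom_iff)

lemma sym_natural:
  assumes "f \<in> Ar V" "g \<in> Ar V" "Cod V f = x'" "Cod V g = y'"
  shows "sym_ar V x' y' \<cdot> (f \<odot> g) = (g \<odot> f) \<cdot> sym_ar V (Dom V f) (Dom V g)"
  using sym_nat[of f "Dom V f" "Cod V f" g "Dom V g" "Cod V g"] assms by (auto simp: ahom_iff)

lemma sym_natural_assoc:
  assumes "f \<in> Ar V" "g \<in> Ar V" "Cod V f = x'" "Cod V g = y'" "k \<in> Ar V" "Cod V k = Dom V f \<otimes> Dom V g"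
  shows "sym_ar V x' y' \<cdot> ((f \<odot> g) \<cdot> k) = (g \<odot> f) \<cdot> (sym_ar V (Dom V f) (Dom V g) \<cdot> k)"
proof -
  have "sym_ar V x' y' \<cdot> ((f \<odot> g) \<cdot> k) = (sym_ar V x' y' \<cdot> (f \<odot> g)) \<cdot> k"
    using assms by (intro Cmp_assoc[symmetric]) auto
  with assms show ?thesis by (subst (asm) sym_natural) auto
qed

text \<open>By naturality of the left unitor, tensoring with the unit is isomorphic to the identity
  functor. Coherence identities may thus be proved after tensoring with the unit, where the pentagon
  and the triangle apply.\<close>

lemma unit_tensor_faithful:
  assumes "Ide V \<one> \<odot> f = Ide V \<one> \<odot> g" "f \<in> Ar V" "g \<in> Ar V" "Dom V f = Dom V g" "Cod V f = Cod V g"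
  shows "f = g"
proof (rule iso_epi[of "lunit_ar V (Dom V f)"])
  show "f \<cdot> lunit_ar V (Dom V f) = g \<cdot> lunit_ar V (Dom V f)"
    using assms lunit_natural[of f "Cod V f"] lunit_natural[of g "Cod V f"] by simp
qed (use assms in auto)

lemma tensor_unit_faithful:
  assumes "f \<odot> Ide V \<one> = g \<odot> Ide V \<one>" "f \<in> Ar V" "g \<in> Ar V" "Dom V f = Dom V g" "Cod V f = Cod V g"
  shows "f = g"
proof (rule iso_epi[of "runit_ar V (Dom V f)"])
  show "f \<cdot> runit_ar V (Dom V f) = g \<cdot> runit_ar V (Dom V f)"
    using assms runit_natural[of f "Cod V f"] runit_natural[of g "Cod V f"] by simp
qed (use assms in auto)

text \<open>Kelly's derivation of a further unit identity: \<open>?e\<close> is part of the pentagon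
  for \<one>, \<one>, x, y, and each unitor that arises is traded by the triangle for another, until
  both sides become equal after \<open>?e\<close>.\<close>

lemma lunit_tensor:
  assumes [simp]: "x \<in> Ob V" "y \<in> Ob V"
  shows "lunit_ar V (x \<otimes> y) \<cdot> assoc_ar V \<one> x y = lunit_ar V x \<odot> Ide V y"
proof (rule unit_tensor_faithful)
  let ?e = "assoc_ar V \<one> (\<one> \<otimes> x) y \<cdot> (assoc_ar V \<one> \<one> x \<odot> Ide V y)"
  show "Ide V \<one> \<odot> (lunit_ar V (x \<otimes> y) \<cdot> assoc_ar V \<one> x y) = Ide V \<one> \<odot> (lunit_ar V x \<odot> Ide V y)"
  proof (rule iso_epi[of ?e])
    show "is_iso V ?e" by (intro is_iso_Cmp is_iso_tensor) auto
    have "(Ide V \<one> \<odot> (lunit_ar V (x \<otimes> y) \<cdot> assoc_ar V \<one> x y)) \<cdot> ?e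
      = (Ide V \<one> \<odot> lunit_ar V (x \<otimes> y)) \<cdot>
        ((Ide V \<one> \<odot> assoc_ar V \<one> x y) \<cdot> assoc_ar V \<one> (\<one> \<otimes> x) y \<cdot> (assoc_ar V \<one> \<one> x \<odot> Ide V y))"
      by (simp add: Ide_tensor_Cmp)
    also have "\<dots> = (Ide V \<one> \<odot> lunit_ar V (x \<otimes> y)) \<cdot> (assoc_ar V \<one> \<one> (x \<otimes> y) \<cdot> assoc_ar V (\<one> \<otimes> \<one>) x y)"
      using pentagon[of \<one> \<one> x y] by simp
    also have "\<dots> = ((Ide V \<one> \<odot> lunit_ar V (x \<otimes> y)) \<cdot> assoc_ar V \<one> \<one> (x \<otimes> y)) \<cdot> assoc_ar V (\<one> \<otimes> \<one>) x y"
      by simp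
    also have "\<dots> = (runit_ar V \<one> \<odot> (Ide V x \<odot> Ide V y)) \<cdot> assoc_ar V (\<one> \<otimes> \<one>) x y"
      by (subst triangle) auto
    also have "\<dots> = assoc_ar V \<one> x y \<cdot> (runit_ar V \<one> \<odot> Ide V x \<odot> Ide V y)"
      by (subst assoc_natural) (auto simp del: tensor_Ide)
    also have "runit_ar V \<one> \<odot> Ide V x = (Ide V \<one> \<odot> lunit_ar V x) \<cdot> assoc_ar V \<one> \<one> x"
      by (subst triangle) auto
    also have "assoc_ar V \<one> x y \<cdot> (((Ide V \<one> \<odot> lunit_ar V x) \<cdot> assoc_ar V \<one> \<one> x) \<odot> Ide V y)
      = assoc_ar V \<one> x y \<cdot> ((Ide V \<one> \<odot> lunit_ar V x \<odot> Ide V y) \<cdot> (assoc_ar V \<one> \<one> x \<odot> Ide V y))"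
      by (subst Cmp_tensor_Ide) auto
    also have "\<dots> = (Ide V \<one> \<odot> (lunit_ar V x \<odot> Ide V y)) \<cdot> ?e"
      by (subst assoc_natural_assoc) (auto simp del: tensor_Ide)
    finally show "(Ide V \<one> \<odot> (lunit_ar V (x \<otimes> y) \<cdot> assoc_ar V \<one> x y)) \<cdot> ?e
      = (Ide V \<one> \<odot> (lunit_ar V x \<odot> Ide V y)) \<cdot> ?e" .
  qed auto
qed auto

text \<open>Mirror image of \<open>lunit_tensor\<close>, with the pentagon for x, y, \<one>, \<one>
  and an extra unit on the right.\<close>

lemma runit_tensor:
  assumes [simp]: "x \<in> Ob V" "y \<in> Ob V"
  shows "(Ide V x \<odot> runit_ar V y) \<cdot> assoc_ar V x y \<one> = runit_ar V (x \<otimes> y)"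
proof (rule tensor_unit_faithful)
  show "((Ide V x \<odot> runit_ar V y) \<cdot> assoc_ar V x y \<one>) \<odot> Ide V \<one> = runit_ar V (x \<otimes> y) \<odot> Ide V \<one>"
  proof (rule iso_mono[of "assoc_ar V x y \<one>"])
    have "assoc_ar V x y \<one> \<cdot> (((Ide V x \<odot> runit_ar V y) \<cdot> assoc_ar V x y \<one>) \<odot> Ide V \<one>)
       = assoc_ar V x y \<one> \<cdot> ((Ide V x \<odot> runit_ar V y \<odot> Ide V \<one>) \<cdot> (assoc_ar V x y \<one> \<odot> Ide V \<one>))"
      by (subst Cmp_tensor_Ide) auto
    also have "\<dots> = (Ide V x \<odot> (runit_ar V y \<odot> Ide V \<one>)) \<cdot> (assoc_ar V x (y \<otimes> \<one>) \<one> \<cdot> (assoc_ar V x y \<one> \<odot> Ide V \<one>))"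
      by (subst assoc_natural_assoc) (auto simp del: tensor_Ide)
    also have "runit_ar V y \<odot> Ide V \<one> = (Ide V y \<odot> lunit_ar V \<one>) \<cdot> assoc_ar V y \<one> \<one>"
      by (subst triangle) auto
    also have "(Ide V x \<odot> ((Ide V y \<odot> lunit_ar V \<one>) \<cdot> assoc_ar V y \<one> \<one>)) \<cdot> (assoc_ar V x (y \<otimes> \<one>) \<one> \<cdot> (assoc_ar V x y \<one> \<odot> Ide V \<one>))
       = (Ide V x \<odot> (Ide V y \<odot> lunit_ar V \<one>)) \<cdot> ((Ide V x \<odot> assoc_ar V y \<one> \<one>) \<cdot> assoc_ar V x (y \<otimes> \<one>) \<one> \<cdot> (assoc_ar V x y \<one> \<odot> Ide V \<one>))"
      by (simp add: Ide_tensor_Cmp)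
    also have "\<dots> = (Ide V x \<odot> (Ide V y \<odot> lunit_ar V \<one>)) \<cdot> (assoc_ar V x y (\<one> \<otimes> \<one>) \<cdot> assoc_ar V (x \<otimes> y) \<one> \<one>)"
      using pentagon[of x y \<one> \<one>] by simp
    also have "\<dots> = ((Ide V x \<odot> (Ide V y \<odot> lunit_ar V \<one>)) \<cdot> assoc_ar V x y (\<one> \<otimes> \<one>)) \<cdot> assoc_ar V (x \<otimes> y) \<one> \<one>"
      by simp
    also have "(Ide V x \<odot> (Ide V y \<odot> lunit_ar V \<one>)) \<cdot> assoc_ar V x y (\<one> \<otimes> \<one>)
      = assoc_ar V x y \<one> \<cdot> (Ide V x \<odot> Ide V y \<odot> lunit_ar V \<one>)"
      by (subst assoc_natural) (auto simp del: tensor_Ide)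
    also have "(assoc_ar V x y \<one> \<cdot> (Ide V x \<odot> Ide V y \<odot> lunit_ar V \<one>)) \<cdot> assoc_ar V (x \<otimes> y) \<one> \<one>
      = assoc_ar V x y \<one> \<cdot> ((Ide V (x \<otimes> y) \<odot> lunit_ar V \<one>) \<cdot> assoc_ar V (x \<otimes> y) \<one> \<one>)"
      by simp
    also have "\<dots> = assoc_ar V x y \<one> \<cdot> (runit_ar V (x \<otimes> y) \<odot> Ide V \<one>)"
      by (subst triangle) auto
    finally show "assoc_ar V x y \<one> \<cdot> (((Ide V x \<odot> runit_ar V y) \<cdot> assoc_ar V x y \<one>) \<odot> Ide V \<one>)
       = assoc_ar V x y \<one> \<cdot> (runit_ar V (x \<otimes> y) \<odot> Ide V \<one>)" .
  qed auto
qed auto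

text \<open>Naturality of the left unitor at itself identifies
  \<open>Ide V \<one> \<odot> lunit_ar V \<one>\<close> with the unitor of \<one> \<otimes> \<one>;
  the triangle and \<open>lunit_tensor\<close> then have equal left-hand sides.\<close>

lemma lunit_eq_runit: "lunit_ar V \<one> = runit_ar V \<one>"
proof (rule tensor_unit_faithful)
  have "lunit_ar V \<one> \<cdot> (Ide V \<one> \<odot> lunit_ar V \<one>) = lunit_ar V \<one> \<cdot> lunit_ar V (\<one> \<otimes> \<one>)"
    by (subst lunit_natural) auto
  then have "Ide V \<one> \<odot> lunit_ar V \<one> = lunit_ar V (\<one> \<otimes> \<one>)"
    by (rule iso_mono[rotated]) auto
  then show "lunit_ar V \<one> \<odot> Ide V \<one> = runit_ar V \<one> \<odot> Ide V \<one>"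
    using lunit_tensor[of \<one> \<one>] triangle[of \<one> \<one>] by simp
qed auto

text \<open>The hexagon for x, \<one>, \<one> contains the symmetry of x and \<one> on both sides;
  composing with unitors leaves the claim tensored with the unit and preceded by that invertible
  symmetry.\<close>

lemma lunit_sym:
  assumes [simp]: "x \<in> Ob V"
  shows "lunit_ar V x \<cdot> sym_ar V x \<one> = runit_ar V x"
proof (rule tensor_unit_faithful)
  let ?s = "sym_ar V x \<one>"
  show "(lunit_ar V x \<cdot> ?s) \<odot> Ide V \<one> = runit_ar V x \<odot> Ide V \<one>"
  proof (rule iso_mono[of ?s])
    have "?s \<cdot> (runit_ar V x \<odot> Ide V \<one>) = ?s \<cdot> ((Ide V x \<odot> lunit_ar V \<one>) \<cdot> assoc_ar V x \<one> \<one>)"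
      by (subst triangle) auto
    also have "\<dots> = (lunit_ar V \<one> \<odot> Ide V x) \<cdot> (sym_ar V x (\<one> \<otimes> \<one>) \<cdot> assoc_ar V x \<one> \<one>)"
      by (subst sym_natural_assoc) auto
    also have "\<dots> = (lunit_ar V (\<one> \<otimes> x) \<cdot> assoc_ar V \<one> \<one> x) \<cdot> (sym_ar V x (\<one> \<otimes> \<one>) \<cdot> assoc_ar V x \<one> \<one>)"
      by (subst lunit_tensor) auto
    also have "\<dots> = lunit_ar V (\<one> \<otimes> x) \<cdot> (assoc_ar V \<one> \<one> x \<cdot> sym_ar V x (\<one> \<otimes> \<one>) \<cdot> assoc_ar V x \<one> \<one>)"
      by simp
    also have "\<dots> = lunit_ar V (\<one> \<otimes> x) \<cdot> ((Ide V \<one> \<odot> ?s) \<cdot> assoc_ar V \<one> x \<one> \<cdot> (?s \<odot> Ide V \<one>))"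
      by (subst hexagon) auto
    also have "\<dots> = (lunit_ar V (\<one> \<otimes> x) \<cdot> (Ide V \<one> \<odot> ?s)) \<cdot> (assoc_ar V \<one> x \<one> \<cdot> (?s \<odot> Ide V \<one>))"
      by simp
    also have "\<dots> = ?s \<cdot> ((lunit_ar V (x \<otimes> \<one>) \<cdot> assoc_ar V \<one> x \<one>) \<cdot> (?s \<odot> Ide V \<one>))"
      by (subst lunit_natural) auto
    also have "\<dots> = ?s \<cdot> ((lunit_ar V x \<cdot> ?s) \<odot> Ide V \<one>)"
      by (subst lunit_tensor) (auto simp: interchange)
    finally show "?s \<cdot> ((lunit_ar V x \<cdot> ?s) \<odot> Ide V \<one>) = ?s \<cdot> (runit_ar V x \<odot> Ide V \<one>)" ..
  qed auto
qed auto

lemma runit_sym: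
  assumes [simp]: "x \<in> Ob V"
  shows "runit_ar V x \<cdot> sym_ar V \<one> x = lunit_ar V x"
  using lunit_sym[OF assms, symmetric] by simp

text \<open>The second hexagon, which moves z leftwards past y and then past x. It follows from the
  first one for z, x, y because the symmetry is its own inverse. Naturality of composed and lifted
  families is checked with it.\<close>

lemma hexagon_inv:
  assumes [simp]: "x \<in> Ob V" "y \<in> Ob V" "z \<in> Ob V"
  shows "assoc_ar V z x y \<cdot> ((sym_ar V x z \<odot> Ide V y) \<cdot>
    (inv_ar V (assoc_ar V x z y) \<cdot> ((Ide V x \<odot> sym_ar V y z) \<cdot> assoc_ar V x y z)))
    = sym_ar V (x \<otimes> y) z"
proof (rule iso_mono[of "assoc_ar V x y z \<cdot> sym_ar V z (x \<otimes> y)"])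
  have "assoc_ar V x y z \<cdot> sym_ar V z (x \<otimes> y) \<cdot> (assoc_ar V z x y \<cdot> ((sym_ar V x z \<odot> Ide V y) \<cdot>
    (inv_ar V (assoc_ar V x z y) \<cdot> ((Ide V x \<odot> sym_ar V y z) \<cdot> assoc_ar V x y z))))
    = (assoc_ar V x y z \<cdot> sym_ar V z (x \<otimes> y) \<cdot> assoc_ar V z x y) \<cdot> ((sym_ar V x z \<odot> Ide V y) \<cdot>
    (inv_ar V (assoc_ar V x z y) \<cdot> ((Ide V x \<odot> sym_ar V y z) \<cdot> assoc_ar V x y z)))"
    by simp
  also have "\<dots> = assoc_ar V x y z \<cdot> sym_ar V z (x \<otimes> y) \<cdot> sym_ar V (x \<otimes> y) z"
    by (subst hexagon) (auto simp: interchange interchange_assoc)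
  finally show "assoc_ar V x y z \<cdot> sym_ar V z (x \<otimes> y) \<cdot> (assoc_ar V z x y \<cdot> ((sym_ar V x z \<odot> Ide V y) \<cdot>
    (inv_ar V (assoc_ar V x z y) \<cdot> ((Ide V x \<odot> sym_ar V y z) \<cdot> assoc_ar V x y z))))
    = assoc_ar V x y z \<cdot> sym_ar V z (x \<otimes> y) \<cdot> sym_ar V (x \<otimes> y) z" .
qed (auto intro: is_iso_Cmp)

end

section \<open>Composition of generalized elements\<close>

context symmetric_monoidal_closed
begin

section \<open>Currying and evaluation\<close>

lemma cur:
  assumes "f \<in> Ar V" "Dom V f = z \<otimes> x" "Cod V f = y" "x \<in> Ob V" "z \<in> Ob V"
  shows "cur V z x y f \<in> ahom V z (ihom V x y)" "ev_ar V x y \<cdot> (cur V z x y f \<odot> Ide V x) = f"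
proof -
  have "\<exists>!g. g \<in> ahom V z (ihom V x y) \<and> ev_ar V x y \<cdot> (g \<odot> Ide V x) = f"
    using assms by (intro closed) (auto simp: ahom_iff)
  from theI'[OF this] show "cur V z x y f \<in> ahom V z (ihom V x y)"
    "ev_ar V x y \<cdot> (cur V z x y f \<odot> Ide V x) = f" unfolding cur_def by auto
qed

lemma cur_simps [simp]:
  assumes "f \<in> Ar V" "Dom V f = z \<otimes> x" "Cod V f = y" "x \<in> Ob V" "z \<in> Ob V"
  shows "cur V z x y f \<in> Ar V" "Dom V (cur V z x y f) = z" "Cod V (cur V z x y f) = ihom V x y"
    "ev_ar V x y \<cdot> (cur V z x y f \<odot> Ide V x) = f"
  using cur[OF assms] by (auto simp: ahom_iff)

lemma uncur_inject:
  assumes "ev_ar V x y \<cdot> (g \<odot> Ide V x) = ev_ar V x y \<cdot> (h \<odot> Ide V x)"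
    "g \<in> Ar V" "h \<in> Ar V" "Dom V g = Dom V h" "Cod V g = ihom V x y" "Cod V h = ihom V x y"
    "x \<in> Ob V" "y \<in> Ob V"
  shows "g = h"
proof -
  let ?f = "ev_ar V x y \<cdot> (h \<odot> Ide V x)"
  have "\<exists>!g. g \<in> ahom V (Dom V h) (ihom V x y) \<and> ev_ar V x y \<cdot> (g \<odot> Ide V x) = ?f"
    using assms by (intro closed) (auto simp: ahom_iff)
  with assms show ?thesis by (auto simp: ahom_iff)
qed

lemma ev_cur [simp]:
  assumes "f \<in> Ar V" "Dom V f = z \<otimes> x" "Cod V f = y" "x \<in> Ob V" "z \<in> Ob V" "g \<in> Ar V" "Cod V g = x"
  shows "ev_ar V x y \<cdot> (cur V z x y f \<odot> g) = f \<cdot> (Ide V z \<odot> g)"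
proof -
  have "ev_ar V x y \<cdot> (cur V z x y f \<odot> g) = (ev_ar V x y \<cdot> (cur V z x y f \<odot> Ide V x)) \<cdot> (Ide V z \<odot> g)"
    using assms by (auto simp: interchange simp del: cur_simps(4))
  also have "\<dots> = f \<cdot> (Ide V z \<odot> g)"
    using assms by simp
  finally show ?thesis .
qed

lemma ev_cur' [simp]:
  assumes "f \<in> Ar V" "Dom V f = z \<otimes> x" "Cod V f = y" "x \<in> Ob V" "z \<in> Ob V" "g \<in> Ar V" "Cod V g = x"
    "k \<in> Ar V" "Cod V k = z \<otimes> Dom V g"
  shows "ev_ar V x y \<cdot> ((cur V z x y f \<odot> g) \<cdot> k) = f \<cdot> ((Ide V z \<odot> g) \<cdot> k)"
proof -
  have "ev_ar V x y \<cdot> ((cur V z x y f \<odot> g) \<cdot> k) = (ev_ar V x y \<cdot> (cur V z x y f \<odot> g)) \<cdot> k"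
    using assms by (subst Cmp_assoc) (auto simp del: ev_cur)
  also have "\<dots> = f \<cdot> ((Ide V z \<odot> g) \<cdot> k)"
    using assms by simp
  finally show ?thesis .
qed

lemma cur_eqI:
  assumes "ev_ar V x y \<cdot> (g \<odot> Ide V x) = f" "g \<in> Ar V" "Dom V g = z" "Cod V g = ihom V x y"
    "x \<in> Ob V" "y \<in> Ob V"
  shows "cur V z x y f = g"
  using assms by - (rule uncur_inject[of x y], auto)

lemma cur_Cmp:
  assumes "f \<in> Ar V" "Dom V f = z \<otimes> x" "Cod V f = y" "x \<in> Ob V" "z \<in> Ob V" "h \<in> Ar V" "Cod V h = z"
  shows "cur V z x y f \<cdot> h = cur V (Dom V h) x y (f \<cdot> (h \<odot> Ide V x))"
proof -
  have "ev_ar V x y \<cdot> ((cur V z x y f \<cdot> h) \<odot> Ide V x) = ev_ar V x y \<cdot> ((cur V z x y f \<odot> Ide V x) \<cdot> (h \<odot> Ide V x))"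
    using assms by (auto simp: interchange simp del: ev_cur')
  also have "\<dots> = f \<cdot> (h \<odot> Ide V x)" using assms by simp
  finally show ?thesis using assms Cod_Ob[of f] by - (rule uncur_inject[of x y], simp_all)
qed

end

text \<open>An arrow \<open>p : E \<rightarrow> X(y, z)\<close> is treated as a generalized morphism \<open>y \<rightarrow> z\<close>: \<open>vc\<close> composes
  these, \<open>pre\<close> and \<open>post\<close> compose with an ordinary morphism \<open>m : \<one> \<rightarrow> X(x, y)\<close> without changing
  the domain.\<close>
definition (in symmetric_monoidal_closed)
  vc :: "('c, 'o, 'a, 'm) vcat_scheme \<Rightarrow> 'c \<Rightarrow> 'c \<Rightarrow> 'c \<Rightarrow> 'a \<Rightarrow> 'a \<Rightarrow> 'a" where
  "vc X x y z p q = vCmp X x y z \<cdot> (p \<odot> q)"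

definition (in symmetric_monoidal_closed)
  pre :: "('c, 'o, 'a, 'm) vcat_scheme \<Rightarrow> 'c \<Rightarrow> 'c \<Rightarrow> 'c \<Rightarrow> 'a \<Rightarrow> 'a \<Rightarrow> 'a" where
  "pre X x y z m p = vc X x y z p m \<cdot> inv_ar V (runit_ar V (Dom V p))"

definition (in symmetric_monoidal_closed)
  post :: "('c, 'o, 'a, 'm) vcat_scheme \<Rightarrow> 'c \<Rightarrow> 'c \<Rightarrow> 'c \<Rightarrow> 'a \<Rightarrow> 'a \<Rightarrow> 'a" where
  "post X x y z m p = vc X x y z m p \<cdot> inv_ar V (lunit_ar V (Dom V p))"

locale vcategory = symmetric_monoidal_closed V + enriched_category V X
  for V :: "('o, 'a) smc" (structure) and X :: "('c, 'o, 'a, 'm) vcat_scheme"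
begin

section \<open>Calculus of generalized morphisms in an enriched category\<close>

lemma vHom_simp [simp]: "x \<in> vOb X \<Longrightarrow> y \<in> vOb X \<Longrightarrow> vHom X x y \<in> Ob V"
  by (rule vHom_in)

lemma vIde_simps [simp]:
  assumes "x \<in> vOb X"
  shows "vIde X x \<in> Ar V" "Dom V (vIde X x) = \<one>" "Cod V (vIde X x) = vHom X x x"
  using vIde_in[OF assms] by (auto simp: ahom_iff)

lemma vCmp_simps [simp]:
  assumes "x \<in> vOb X" "y \<in> vOb X" "z \<in> vOb X"
  shows "vCmp X x y z \<in> Ar V" "Dom V (vCmp X x y z) = vHom X y z \<otimes> vHom X x y"
    "Cod V (vCmp X x y z) = vHom X x z"
  using vCmp_in[OF assms] by (auto simp: ahom_iff)

lemma vc_simps [simp]: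
  assumes "x \<in> vOb X" "y \<in> vOb X" "z \<in> vOb X" "p \<in> Ar V" "q \<in> Ar V"
    "Cod V p = vHom X y z" "Cod V q = vHom X x y"
  shows "vc X x y z p q \<in> Ar V" "Dom V (vc X x y z p q) = Dom V p \<otimes> Dom V q"
    "Cod V (vc X x y z p q) = vHom X x z"
  using assms by (auto simp: vc_def)

lemma vc_Cmp_left:
  assumes "x \<in> vOb X" "y \<in> vOb X" "z \<in> vOb X" "p \<in> Ar V" "q \<in> Ar V"
    "Cod V p = vHom X y z" "Cod V q = vHom X x y" "h \<in> Ar V" "Cod V h = Dom V p"
  shows "vc X x y z (p \<cdot> h) q = vc X x y z p q \<cdot> (h \<odot> Ide V (Dom V q))"
  using assms by (auto simp: vc_def interchange)

lemma vc_Cmp_right: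
  assumes "x \<in> vOb X" "y \<in> vOb X" "z \<in> vOb X" "p \<in> Ar V" "q \<in> Ar V"
    "Cod V p = vHom X y z" "Cod V q = vHom X x y" "k \<in> Ar V" "Cod V k = Dom V q"
  shows "vc X x y z p (q \<cdot> k) = vc X x y z p q \<cdot> (Ide V (Dom V p) \<odot> k)"
  using assms by (auto simp: vc_def interchange)

lemma vc_assoc:
  assumes [simp]: "w \<in> vOb X" "x \<in> vOb X" "y \<in> vOb X" "z \<in> vOb X" "p \<in> Ar V" "q \<in> Ar V" "r \<in> Ar V"
    "Cod V p = vHom X y z" "Cod V q = vHom X x y" "Cod V r = vHom X w x"
  shows "vc X w x z (vc X x y z p q) r
    = vc X w y z p (vc X w x y q r) \<cdot> assoc_ar V (Dom V p) (Dom V q) (Dom V r)"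
proof -
  have "vc X w x z (vc X x y z p q) r = (vCmp X w x z \<cdot> (vCmp X x y z \<odot> Ide V (vHom X w x))) \<cdot> (p \<odot> q \<odot> r)"
    by (auto simp: vc_def interchange)
  also have "\<dots> = vCmp X w y z \<cdot> ((Ide V (vHom X y z) \<odot> vCmp X w x y)
       \<cdot> (assoc_ar V (vHom X y z) (vHom X x y) (vHom X w x) \<cdot> (p \<odot> q \<odot> r)))"
    by (subst vCmp_assoc) auto
  also have "\<dots> = vc X w y z p (vc X w x y q r) \<cdot> assoc_ar V (Dom V p) (Dom V q) (Dom V r)"
    by (subst assoc_natural) (auto simp: vc_def interchange interchange_assoc)
  finally show ?thesis .
qed

lemma vc_assoc_inv:
  assumes "w \<in> vOb X" "x \<in> vOb X" "y \<in> vOb X" "z \<in> vOb X" "p \<in> Ar V" "q \<in> Ar V" "r \<in> Ar V"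
    "Cod V p = vHom X y z" "Cod V q = vHom X x y" "Cod V r = vHom X w x"
  shows "vc X w y z p (vc X w x y q r)
    = vc X w x z (vc X x y z p q) r \<cdot> inv_ar V (assoc_ar V (Dom V p) (Dom V q) (Dom V r))"
  using assms by (simp add: vc_assoc)

lemma vc_vIde_left:
  assumes "x \<in> vOb X" "y \<in> vOb X" "p \<in> Ar V" "Cod V p = vHom X x y"
  shows "vc X x y y (vIde X y) p = p \<cdot> lunit_ar V (Dom V p)"
proof -
  have "vc X x y y (vIde X y) p = (vCmp X x y y \<cdot> (vIde X y \<odot> Ide V (vHom X x y))) \<cdot> (Ide V \<one> \<odot> p)"
    using assms by (auto simp: vc_def interchange)
  also have "\<dots> = p \<cdot> lunit_ar V (Dom V p)"
    using assms by (subst vIde_left) (auto simp: lunit_natural)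
  finally show ?thesis .
qed

lemma vc_vIde_right:
  assumes "x \<in> vOb X" "y \<in> vOb X" "p \<in> Ar V" "Cod V p = vHom X x y"
  shows "vc X x x y p (vIde X x) = p \<cdot> runit_ar V (Dom V p)"
proof -
  have "vc X x x y p (vIde X x) = (vCmp X x x y \<cdot> (Ide V (vHom X x y) \<odot> vIde X x)) \<cdot> (p \<odot> Ide V \<one>)"
    using assms by (auto simp: vc_def interchange)
  also have "\<dots> = p \<cdot> runit_ar V (Dom V p)"
    using assms by (subst vIde_right) (auto simp: runit_natural)
  finally show ?thesis .
qed

lemma pre_simps [simp]:
  assumes "x \<in> vOb X" "y \<in> vOb X" "z \<in> vOb X" "p \<in> Ar V" "m \<in> Ar V"
    "Cod V p = vHom X y z" "Cod V m = vHom X x y" "Dom V m = \<one>"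
  shows "pre X x y z m p \<in> Ar V" "Dom V (pre X x y z m p) = Dom V p"
    "Cod V (pre X x y z m p) = vHom X x z"
  using assms by (auto simp: pre_def)

lemma post_simps [simp]:
  assumes "x \<in> vOb X" "y \<in> vOb X" "z \<in> vOb X" "p \<in> Ar V" "m \<in> Ar V"
    "Cod V m = vHom X y z" "Cod V p = vHom X x y" "Dom V m = \<one>"
  shows "post X x y z m p \<in> Ar V" "Dom V (post X x y z m p) = Dom V p"
    "Cod V (post X x y z m p) = vHom X x z"
  using assms by (auto simp: post_def)

lemma vc_eq_pre:
  assumes "x \<in> vOb X" "y \<in> vOb X" "z \<in> vOb X" "p \<in> Ar V" "m \<in> Ar V"
    "Cod V p = vHom X y z" "Cod V m = vHom X x y" "Dom V m = \<one>"
  shows "vc X x y z p m = pre X x y z m p \<cdot> runit_ar V (Dom V p)"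
  using assms by (simp add: pre_def)

lemma vc_eq_post:
  assumes "x \<in> vOb X" "y \<in> vOb X" "z \<in> vOb X" "p \<in> Ar V" "m \<in> Ar V"
    "Cod V m = vHom X y z" "Cod V p = vHom X x y" "Dom V m = \<one>"
  shows "vc X x y z m p = post X x y z m p \<cdot> lunit_ar V (Dom V p)"
  using assms by (simp add: post_def)

lemma pre_Cmp:
  assumes "x \<in> vOb X" "y \<in> vOb X" "z \<in> vOb X" "p \<in> Ar V" "m \<in> Ar V"
    "Cod V p = vHom X y z" "Cod V m = vHom X x y" "Dom V m = \<one>" "h \<in> Ar V" "Cod V h = Dom V p"
  shows "pre X x y z m (p \<cdot> h) = pre X x y z m p \<cdot> h"
proof (rule iso_epi[of "runit_ar V (Dom V h)"])
  show "pre X x y z m (p \<cdot> h) \<cdot> runit_ar V (Dom V h) = (pre X x y z m p \<cdot> h) \<cdot> runit_ar V (Dom V h)"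
    using assms vc_eq_pre[of x y z "p \<cdot> h" m] vc_eq_pre[of x y z p m] runit_natural[of h "Dom V p"]
    by (simp add: vc_Cmp_left)
qed (use assms in auto)

lemma post_Cmp:
  assumes "x \<in> vOb X" "y \<in> vOb X" "z \<in> vOb X" "p \<in> Ar V" "m \<in> Ar V"
    "Cod V m = vHom X y z" "Cod V p = vHom X x y" "Dom V m = \<one>" "h \<in> Ar V" "Cod V h = Dom V p"
  shows "post X x y z m (p \<cdot> h) = post X x y z m p \<cdot> h"
proof (rule iso_epi[of "lunit_ar V (Dom V h)"])
  show "post X x y z m (p \<cdot> h) \<cdot> lunit_ar V (Dom V h) = (post X x y z m p \<cdot> h) \<cdot> lunit_ar V (Dom V h)"
    using assms vc_eq_post[of x y z "p \<cdot> h" m] vc_eq_post[of x y z p m] lunit_natural[of h "Dom V p"]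
    by (simp add: vc_Cmp_right)
qed (use assms in auto)

text \<open>Associativity of \<open>vc\<close> with an ordinary morphism in the last place; the
  leftover unit is absorbed by \<open>runit_tensor\<close>. With the ordinary morphism in the first
  or the middle place, as in \<open>post_vc\<close> and \<open>vc_pre_post\<close>, the same role
  falls to \<open>lunit_tensor\<close> and \<open>triangle\<close>.\<close>

lemma vc_pre:
  assumes "w \<in> vOb X" "x \<in> vOb X" "y \<in> vOb X" "z \<in> vOb X" "p \<in> Ar V" "q \<in> Ar V" "m \<in> Ar V"
    "Cod V p = vHom X y z" "Cod V q = vHom X x y" "Cod V m = vHom X w x" "Dom V m = \<one>"
  shows "vc X w y z p (pre X w x y m q) = pre X w x z m (vc X x y z p q)"
proof (rule iso_epi[of "runit_ar V (Dom V p \<otimes> Dom V q)"])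
  have "pre X w x z m (vc X x y z p q) \<cdot> runit_ar V (Dom V p \<otimes> Dom V q) = vc X w x z (vc X x y z p q) m"
    using assms vc_eq_pre[of w x z "vc X x y z p q" m] by simp
  also have "\<dots> = vc X w y z p (pre X w x y m q \<cdot> runit_ar V (Dom V q)) \<cdot> assoc_ar V (Dom V p) (Dom V q) \<one>"
    using assms vc_eq_pre[of w x y q m] by (simp add: vc_assoc)
  also have "\<dots> = vc X w y z p (pre X w x y m q) \<cdot> ((Ide V (Dom V p) \<odot> runit_ar V (Dom V q)) \<cdot> assoc_ar V (Dom V p) (Dom V q) \<one>)"
    using assms by (simp add: vc_Cmp_right)
  finally show "vc X w y z p (pre X w x y m q) \<cdot> runit_ar V (Dom V p \<otimes> Dom V q)
     = pre X w x z m (vc X x y z p q) \<cdot> runit_ar V (Dom V p \<otimes> Dom V q)"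
    using assms by (simp add: runit_tensor)
qed (use assms in auto)

lemma post_vc:
  assumes "w \<in> vOb X" "x \<in> vOb X" "y \<in> vOb X" "z \<in> vOb X" "p \<in> Ar V" "q \<in> Ar V" "m \<in> Ar V"
    "Cod V m = vHom X y z" "Cod V p = vHom X x y" "Cod V q = vHom X w x" "Dom V m = \<one>"
  shows "vc X w x z (post X x y z m p) q = post X w y z m (vc X w x y p q)"
proof (rule iso_epi[of "lunit_ar V (Dom V p \<otimes> Dom V q) \<cdot> assoc_ar V \<one> (Dom V p) (Dom V q)"])
  have "(post X w y z m (vc X w x y p q) \<cdot> lunit_ar V (Dom V p \<otimes> Dom V q)) \<cdot> assoc_ar V \<one> (Dom V p) (Dom V q)
     = vc X w x z (vc X x y z m p) q"
    using assms vc_eq_post[of w y z "vc X w x y p q" m] by (simp add: vc_assoc)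
  also have "\<dots> = vc X w x z (post X x y z m p) q \<cdot> (lunit_ar V (Dom V p) \<odot> Ide V (Dom V q))"
    using assms by (simp add: vc_eq_post vc_Cmp_left)
  also have "\<dots> = vc X w x z (post X x y z m p) q \<cdot> (lunit_ar V (Dom V p \<otimes> Dom V q) \<cdot> assoc_ar V \<one> (Dom V p) (Dom V q))"
    using assms by (simp add: lunit_tensor)
  finally show "vc X w x z (post X x y z m p) q \<cdot> (lunit_ar V (Dom V p \<otimes> Dom V q) \<cdot> assoc_ar V \<one> (Dom V p) (Dom V q))
     = post X w y z m (vc X w x y p q) \<cdot> (lunit_ar V (Dom V p \<otimes> Dom V q) \<cdot> assoc_ar V \<one> (Dom V p) (Dom V q))"
    using assms by simp
qed (use assms in \<open>auto intro!: is_iso_Cmp\<close>)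

lemma vc_pre_post:
  assumes "w \<in> vOb X" "x \<in> vOb X" "y \<in> vOb X" "z \<in> vOb X" "p \<in> Ar V" "q \<in> Ar V" "m \<in> Ar V"
    "Cod V p = vHom X y z" "Cod V m = vHom X x y" "Cod V q = vHom X w x" "Dom V m = \<one>"
  shows "vc X w x z (pre X x y z m p) q = vc X w y z p (post X w x y m q)"
proof (rule iso_epi[of "runit_ar V (Dom V p) \<odot> Ide V (Dom V q)"])
  have "vc X w x z (pre X x y z m p) q \<cdot> (runit_ar V (Dom V p) \<odot> Ide V (Dom V q))
     = vc X w x z (vc X x y z p m) q"
    using assms by (simp add: vc_eq_pre vc_Cmp_left)
  also have "\<dots> = vc X w y z p (post X w x y m q) \<cdot> ((Ide V (Dom V p) \<odot> lunit_ar V (Dom V q)) \<cdot> assoc_ar V (Dom V p) \<one> (Dom V q))"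
    using assms by (simp add: vc_assoc vc_eq_post[of w x y] vc_Cmp_right)
  finally show "vc X w x z (pre X x y z m p) q \<cdot> (runit_ar V (Dom V p) \<odot> Ide V (Dom V q))
    = vc X w y z p (post X w x y m q) \<cdot> (runit_ar V (Dom V p) \<odot> Ide V (Dom V q))"
    using assms by (simp add: triangle)
qed (use assms in \<open>auto intro!: is_iso_tensor\<close>)

lemma pre_vIde:
  assumes "x \<in> vOb X" "y \<in> vOb X" "p \<in> Ar V" "Cod V p = vHom X x y"
  shows "pre X x x y (vIde X x) p = p"
  using assms by (simp add: pre_def vc_vIde_right)

lemma post_vIde:
  assumes "x \<in> vOb X" "y \<in> vOb X" "p \<in> Ar V" "Cod V p = vHom X x y"
  shows "post X x y y (vIde X y) p = p"
  using assms by (simp add: post_def vc_vIde_left)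

text \<open>For two ordinary morphisms both sides are the composite of \<open>n\<close> after
  \<open>m\<close>; they are normalized with different unitors of \<one>, which agree.\<close>

lemma pre_eq_post:
  assumes "Dom V m = \<one>" "Dom V n = \<one>"
  shows "pre X x y z m n = post X x y z n m"
  using assms by (simp add: pre_def post_def lunit_eq_runit)

lemma pre_pre:
  assumes "w \<in> vOb X" "x \<in> vOb X" "y \<in> vOb X" "z \<in> vOb X" "p \<in> Ar V" "m \<in> Ar V" "n \<in> Ar V"
    "Cod V p = vHom X y z" "Cod V n = vHom X x y" "Cod V m = vHom X w x" "Dom V m = \<one>" "Dom V n = \<one>"
  shows "pre X w x z m (pre X x y z n p) = pre X w y z (pre X w x y m n) p"
  using assms by (simp add: pre_def[of X x y z n] pre_Cmp vc_pre[symmetric]) (simp add: pre_def)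

lemma post_post:
  assumes "w \<in> vOb X" "x \<in> vOb X" "y \<in> vOb X" "z \<in> vOb X" "p \<in> Ar V" "m \<in> Ar V" "n \<in> Ar V"
    "Cod V m = vHom X y z" "Cod V n = vHom X x y" "Cod V p = vHom X w x" "Dom V m = \<one>" "Dom V n = \<one>"
  shows "post X w y z m (post X w x y n p) = post X w x z (post X x y z m n) p"
  using assms by (simp add: post_def[of X w x y n] post_Cmp post_vc[symmetric]) (simp add: post_def)

lemma pre_post:
  assumes "w \<in> vOb X" "x \<in> vOb X" "y \<in> vOb X" "z \<in> vOb X" "p \<in> Ar V" "m \<in> Ar V" "n \<in> Ar V"
    "Cod V n = vHom X y z" "Cod V p = vHom X x y" "Cod V m = vHom X w x" "Dom V m = \<one>" "Dom V n = \<one>"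
  shows "pre X w x z m (post X x y z n p) = post X w y z n (pre X w x y m p)"
  using assms by (simp add: post_def pre_Cmp vc_pre)

end

section \<open>Representable functors and cotensors\<close>

context symmetric_monoidal_closed
begin

section \<open>The base category enriched in itself\<close>

lemma self_enriched_simps [simp]:
  "vOb (self_enriched V) = Ob V" "vHom (self_enriched V) = ihom V"
  by (simp_all add: self_enriched_def)

lemma self_vCmp_simps [simp]:
  assumes "x \<in> Ob V" "y \<in> Ob V" "z \<in> Ob V"
  shows "vCmp (self_enriched V) x y z \<in> Ar V"
    "Dom V (vCmp (self_enriched V) x y z) = ihom V y z \<otimes> ihom V x y"
    "Cod V (vCmp (self_enriched V) x y z) = ihom V x z"
  using assms by (simp_all add: self_enriched_def)

lemma self_vc_simps [simp]:
  assumes "x \<in> Ob V" "y \<in> Ob V" "z \<in> Ob V" "p \<in> Ar V" "q \<in> Ar V"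
    "Cod V p = ihom V y z" "Cod V q = ihom V x y"
  shows "vc (self_enriched V) x y z p q \<in> Ar V"
    "Dom V (vc (self_enriched V) x y z p q) = Dom V p \<otimes> Dom V q"
    "Cod V (vc (self_enriched V) x y z p q) = ihom V x z"
  using assms by (simp_all add: vc_def)

text \<open>Composition of internal homs is the transpose of evaluating twice; this undoes the
  transposition. An arbitrary \<open>g\<close> is allowed because \<open>interchange\<close> merges
  evaluation points into neighbouring tensors.\<close>

lemma ev_vCmp:
  assumes "x \<in> Ob V" "y \<in> Ob V" "z \<in> Ob V" "g \<in> Ar V" "Cod V g = x"
  shows "ev_ar V x z \<cdot> (vCmp (self_enriched V) x y z \<odot> g)
    = ev_ar V y z \<cdot> ((Ide V (ihom V y z) \<odot> (ev_ar V x y \<cdot> (Ide V (ihom V x y) \<odot> g)))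
       \<cdot> assoc_ar V (ihom V y z) (ihom V x y) (Dom V g))"
proof -
  have "ev_ar V x z \<cdot> (vCmp (self_enriched V) x y z \<odot> g)
    = ev_ar V y z \<cdot> ((Ide V (ihom V y z) \<odot> ev_ar V x y)
       \<cdot> (assoc_ar V (ihom V y z) (ihom V x y) x \<cdot> (Ide V (ihom V y z) \<odot> Ide V (ihom V x y) \<odot> g)))"
    using assms by (simp add: self_enriched_def)
  also have "\<dots> = ev_ar V y z \<cdot> ((Ide V (ihom V y z) \<odot> ev_ar V x y)
       \<cdot> ((Ide V (ihom V y z) \<odot> (Ide V (ihom V x y) \<odot> g)) \<cdot> assoc_ar V (ihom V y z) (ihom V x y) (Dom V g)))"
    using assms by (subst assoc_natural) (auto simp del: tensor_Ide)
  finally show ?thesis using assms by (simp add: interchange_assoc)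
qed

lemma ev_vc:
  assumes [simp]: "x \<in> Ob V" "y \<in> Ob V" "z \<in> Ob V" "g \<in> Ar V" "Cod V g = x" "p \<in> Ar V" "q \<in> Ar V"
    "Cod V p = ihom V y z" "Cod V q = ihom V x y"
  shows "ev_ar V x z \<cdot> (vc (self_enriched V) x y z p q \<odot> g)
    = ev_ar V y z \<cdot> ((p \<odot> (ev_ar V x y \<cdot> (q \<odot> g))) \<cdot> assoc_ar V (Dom V p) (Dom V q) (Dom V g))"
proof -
  have "ev_ar V x z \<cdot> (vc (self_enriched V) x y z p q \<odot> g)
    = (ev_ar V x z \<cdot> (vCmp (self_enriched V) x y z \<odot> Ide V x)) \<cdot> (p \<odot> q \<odot> g)"
    by (simp add: vc_def interchange)
  also have "\<dots> = ev_ar V y z \<cdot> ((Ide V (ihom V y z) \<odot> ev_ar V x y)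
       \<cdot> (assoc_ar V (ihom V y z) (ihom V x y) x \<cdot> (p \<odot> q \<odot> g)))"
    by (subst ev_vCmp) auto
  also have "\<dots> = ev_ar V y z \<cdot> ((p \<odot> (ev_ar V x y \<cdot> (q \<odot> g))) \<cdot> assoc_ar V (Dom V p) (Dom V q) (Dom V g))"
    by (subst assoc_natural) (auto simp: interchange_assoc)
  finally show ?thesis .
qed

text \<open>Every law is checked after evaluation. The unit laws become the triangle and
  \<open>lunit_tensor\<close>, and associativity becomes the pentagon.\<close>

lemma self_enriched_category: "enriched_category V (self_enriched V)"
proof
  fix x y assume [simp]: "x \<in> vOb (self_enriched V)" "y \<in> vOb (self_enriched V)"
  then have [simp]: "x \<in> Ob V" "y \<in> Ob V" by auto
  let ?S = "self_enriched V"
  have [simp]: "vIde ?S x \<in> Ar V" "Dom V (vIde ?S x) = \<one>" "Cod V (vIde ?S x) = ihom V x x" if "x \<in> Ob V" for x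
    using that by (simp_all add: self_enriched_def)
  have ev_vIde: "ev_ar V x x \<cdot> (vIde ?S x \<odot> g) = g \<cdot> lunit_ar V (Dom V g)"
    if "x \<in> Ob V" "g \<in> Ar V" "Cod V g = x" for x g
    using that by (simp add: self_enriched_def lunit_natural)
  show "vIde ?S x \<in> ahom V \<one> (vHom ?S x x)"
    by (simp add: ahom_iff)
  show "vCmp ?S x x y \<cdot> (Ide V (vHom ?S x y) \<odot> vIde ?S x) = runit_ar V (vHom ?S x y)"
  proof (rule uncur_inject[of x y])
    have "ev_ar V x y \<cdot> ((vCmp ?S x x y \<cdot> (Ide V (vHom ?S x y) \<odot> vIde ?S x)) \<odot> Ide V x)
      = ev_ar V x y \<cdot> (vc ?S x x y (Ide V (ihom V x y)) (vIde ?S x) \<odot> Ide V x)"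
      by (simp add: vc_def)
    also have "\<dots> = ev_ar V x y \<cdot> (runit_ar V (ihom V x y) \<odot> Ide V x)"
      using triangle[of "ihom V x y" x] by (subst ev_vc) (auto simp: ev_vIde)
    finally show "ev_ar V x y \<cdot> ((vCmp ?S x x y \<cdot> (Ide V (vHom ?S x y) \<odot> vIde ?S x)) \<odot> Ide V x)
      = ev_ar V x y \<cdot> (runit_ar V (vHom ?S x y) \<odot> Ide V x)" by simp
  qed auto
  show "vCmp ?S x y y \<cdot> (vIde ?S y \<odot> Ide V (vHom ?S x y)) = lunit_ar V (vHom ?S x y)"
  proof (rule uncur_inject[of x y])
    have "ev_ar V x y \<cdot> ((vCmp ?S x y y \<cdot> (vIde ?S y \<odot> Ide V (vHom ?S x y))) \<odot> Ide V x)
      = ev_ar V x y \<cdot> (vc ?S x y y (vIde ?S y) (Ide V (ihom V x y)) \<odot> Ide V x)"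
      by (simp add: vc_def)
    also have "\<dots> = ev_ar V y y \<cdot> ((vIde ?S y \<odot> ev_ar V x y) \<cdot> assoc_ar V \<one> (ihom V x y) x)"
      by (subst ev_vc) auto
    also have "\<dots> = (ev_ar V y y \<cdot> (vIde ?S y \<odot> ev_ar V x y)) \<cdot> assoc_ar V \<one> (ihom V x y) x"
      by simp
    also have "\<dots> = ev_ar V x y \<cdot> (lunit_ar V (ihom V x y) \<odot> Ide V x)"
      using lunit_tensor[of "ihom V x y" x] by (simp add: ev_vIde)
    finally show "ev_ar V x y \<cdot> ((vCmp ?S x y y \<cdot> (vIde ?S y \<odot> Ide V (vHom ?S x y))) \<odot> Ide V x)
      = ev_ar V x y \<cdot> (lunit_ar V (vHom ?S x y) \<odot> Ide V x)" by simp
  qed auto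
next
  let ?S = "self_enriched V"
  fix w x y z assume "w \<in> vOb ?S" "x \<in> vOb ?S" "y \<in> vOb ?S" "z \<in> vOb ?S"
  then have [simp]: "w \<in> Ob V" "x \<in> Ob V" "y \<in> Ob V" "z \<in> Ob V" by auto
  let ?f = "ihom V y z" and ?g = "ihom V x y" and ?h = "ihom V w x"
  show "vCmp ?S w x z \<cdot> (vCmp ?S x y z \<odot> Ide V (vHom ?S w x))
    = vCmp ?S w y z \<cdot> (Ide V (vHom ?S y z) \<odot> vCmp ?S w x y)
        \<cdot> assoc_ar V (vHom ?S y z) (vHom ?S x y) (vHom ?S w x)"
  proof (rule uncur_inject[of w z])
    have "ev_ar V w z \<cdot> ((vCmp ?S w x z \<cdot> (vCmp ?S x y z \<odot> Ide V ?h)) \<odot> Ide V w)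
      = ev_ar V w z \<cdot> (vc ?S w x z (vCmp ?S x y z) (Ide V ?h) \<odot> Ide V w)"
      by (simp add: vc_def)
    also have "\<dots> = ev_ar V x z \<cdot> ((vCmp ?S x y z \<odot> ev_ar V w x) \<cdot> assoc_ar V (?f \<otimes> ?g) ?h w)"
      by (subst ev_vc) auto
    also have "\<dots> = (ev_ar V x z \<cdot> (vCmp ?S x y z \<odot> ev_ar V w x)) \<cdot> assoc_ar V (?f \<otimes> ?g) ?h w"
      by simp
    also have "\<dots> = ev_ar V y z \<cdot> ((Ide V ?f \<odot> (ev_ar V x y \<cdot> (Ide V ?g \<odot> ev_ar V w x)))
        \<cdot> (assoc_ar V ?f ?g (?h \<otimes> w) \<cdot> assoc_ar V (?f \<otimes> ?g) ?h w))"
      by (subst ev_vCmp) auto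
    also have "\<dots> = ev_ar V y z \<cdot> ((Ide V ?f \<odot> (ev_ar V x y \<cdot> (Ide V ?g \<odot> ev_ar V w x)))
        \<cdot> ((Ide V ?f \<odot> assoc_ar V ?g ?h w) \<cdot> (assoc_ar V ?f (?g \<otimes> ?h) w \<cdot> (assoc_ar V ?f ?g ?h \<odot> Ide V w))))"
      using pentagon[of ?f ?g ?h w] by simp
    also have "\<dots> = ev_ar V y z \<cdot> ((Ide V ?f \<odot> (ev_ar V x y \<cdot> ((Ide V ?g \<odot> ev_ar V w x) \<cdot> assoc_ar V ?g ?h w)))
        \<cdot> (assoc_ar V ?f (?g \<otimes> ?h) w \<cdot> (assoc_ar V ?f ?g ?h \<odot> Ide V w)))"
      by (simp add: interchange_assoc)
    also have "\<dots> = ev_ar V y z \<cdot> ((Ide V ?f \<odot> (ev_ar V w y \<cdot> (vCmp ?S w x y \<odot> Ide V w)))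
        \<cdot> (assoc_ar V ?f (?g \<otimes> ?h) w \<cdot> (assoc_ar V ?f ?g ?h \<odot> Ide V w)))"
      by (subst ev_vCmp) auto
    also have "\<dots> = (ev_ar V w z \<cdot> (vc ?S w y z (Ide V ?f) (vCmp ?S w x y) \<odot> Ide V w)) \<cdot> (assoc_ar V ?f ?g ?h \<odot> Ide V w)"
      by (subst ev_vc) auto
    also have "\<dots> = ev_ar V w z \<cdot> ((vCmp ?S w y z \<cdot> ((Ide V ?f \<odot> vCmp ?S w x y)
        \<cdot> assoc_ar V ?f ?g ?h)) \<odot> Ide V w)"
      by (simp add: vc_def interchange)
    finally show "ev_ar V w z \<cdot> ((vCmp ?S w x z \<cdot> (vCmp ?S x y z \<odot> Ide V (vHom ?S w x))) \<odot> Ide V w)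
      = ev_ar V w z \<cdot> ((vCmp ?S w y z \<cdot> (Ide V (vHom ?S y z) \<odot> vCmp ?S w x y)
        \<cdot> assoc_ar V (vHom ?S y z) (vHom ?S x y) (vHom ?S w x)) \<odot> Ide V w)"
      by simp
  qed auto
qed (simp_all add: ahom_iff)

text \<open>The Yoneda form of \<open>is_cotensor\<close>: instead of invertibility of a morphism
  into an internal hom it speaks of unique factorization of generalized morphisms, which is what
  lifting arguments use.\<close>

definition universal_counit ::
  "('c, 'o, 'a, 'm) vcat_scheme \<Rightarrow> 'o \<Rightarrow> 'c \<Rightarrow> 'c \<Rightarrow> 'a \<Rightarrow> bool" where
  "universal_counit X W x P k \<longleftrightarrow>
     W \<in> Ob V \<and> x \<in> vOb X \<and> P \<in> vOb X \<and> k \<in> ahom V W (vHom X P x) \<and>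
     (\<forall>y \<in> vOb X. \<forall>E \<in> Ob V. \<forall>s \<in> ahom V (W \<otimes> E) (vHom X y x).
        \<exists>!t. t \<in> ahom V E (vHom X y P) \<and> vc X y P x k t = s)"

text \<open>Stated for typed hom-objects and composition rather than for an enriched category, so
  that it also applies to \<open>arities_op\<close>, of which only the typing is at hand.\<close>

lemma is_cotensor_iff:
  fixes X :: "('c, 'o, 'a, 'm) vcat_scheme"
  assumes hom: "\<And>x y. x \<in> vOb X \<Longrightarrow> y \<in> vOb X \<Longrightarrow> vHom X x y \<in> Ob V"
    and cmp: "\<And>x y z. x \<in> vOb X \<Longrightarrow> y \<in> vOb X \<Longrightarrow> z \<in> vOb X \<Longrightarrow>
      vCmp X x y z \<in> ahom V (vHom X y z \<otimes> vHom X x y) (vHom X x z)"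
  shows "is_cotensor V X W x P k \<longleftrightarrow> universal_counit X W x P k"
proof (cases "W \<in> Ob V \<and> x \<in> vOb X \<and> P \<in> vOb X \<and> k \<in> ahom V W (vHom X P x)")
  case True
  then have [simp]: "W \<in> Ob V" "x \<in> vOb X" "P \<in> vOb X" "k \<in> Ar V" "Dom V k = W" "Cod V k = vHom X P x"
    by (auto simp: ahom_iff)
  have [simp]: "vHom X x y \<in> Ob V" if "x \<in> vOb X" "y \<in> vOb X" for x y
    using hom that .
  have [simp]: "vCmp X x y z \<in> Ar V" "Dom V (vCmp X x y z) = vHom X y z \<otimes> vHom X x y"
    "Cod V (vCmp X x y z) = vHom X x z" if "x \<in> vOb X" "y \<in> vOb X" "z \<in> vOb X" for x y z
    using cmp[OF that] by (auto simp: ahom_iff)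
  let ?c = "\<lambda>y. cur V (vHom X y P) W (vHom X y x)
       (vCmp X y P x \<cdot> (k \<odot> Ide V (vHom X y P)) \<cdot> sym_ar V (vHom X y P) W)"
  \<comment> \<open>Composition with the comparison morphism and composition with the counit differ
    by transposition and a symmetry. So the first is bijective on generalized elements exactly if
    the second is.\<close>
  have eq: "?c y \<cdot> t = r \<longleftrightarrow> vc X y P x k t = ev_ar V W (vHom X y x) \<cdot> ((r \<odot> Ide V W) \<cdot> sym_ar V W E)"
    if [simp]: "y \<in> vOb X" "E \<in> Ob V" "t \<in> Ar V" "Dom V t = E" "Cod V t = vHom X y P"
      "r \<in> Ar V" "Dom V r = E" "Cod V r = ihom V W (vHom X y x)" for y E t r
  proof -
    have ct: "?c y \<cdot> t = cur V E W (vHom X y x) (vc X y P x k t \<cdot> sym_ar V E W)"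
      by (subst cur_Cmp) (auto simp: sym_natural vc_def interchange interchange_assoc)
    have [simp]: "vc X y P x k t \<in> Ar V" "Dom V (vc X y P x k t) = W \<otimes> E" "Cod V (vc X y P x k t) = vHom X y x"
      by (auto simp: vc_def)
    show ?thesis
    proof
      assume "?c y \<cdot> t = r"
      then have "r = cur V E W (vHom X y x) (vc X y P x k t \<cdot> sym_ar V E W)" using ct by simp
      then have "ev_ar V W (vHom X y x) \<cdot> (r \<odot> Ide V W) = vc X y P x k t \<cdot> sym_ar V E W" by simp
      then have "(ev_ar V W (vHom X y x) \<cdot> (r \<odot> Ide V W)) \<cdot> sym_ar V W E = (vc X y P x k t \<cdot> sym_ar V E W) \<cdot> sym_ar V W E" by simp
      then show "vc X y P x k t = ev_ar V W (vHom X y x) \<cdot> ((r \<odot> Ide V W) \<cdot> sym_ar V W E)" by simp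
    next
      assume *: "vc X y P x k t = ev_ar V W (vHom X y x) \<cdot> ((r \<odot> Ide V W) \<cdot> sym_ar V W E)"
      show "?c y \<cdot> t = r" unfolding ct by (rule cur_eqI) (auto simp: *)
    qed
  qed
  have "is_iso V (?c y) \<longleftrightarrow> (\<forall>E \<in> Ob V. \<forall>s \<in> ahom V (W \<otimes> E) (vHom X y x).
        \<exists>!t. t \<in> ahom V E (vHom X y P) \<and> vc X y P x k t = s)" if [simp]: "y \<in> vOb X" for y
  proof (intro iffI ballI)
    fix E s assume iso: "is_iso V (?c y)" and [simp]: "E \<in> Ob V" and "s \<in> ahom V (W \<otimes> E) (vHom X y x)"
    then have [simp]: "s \<in> Ar V" "Dom V s = W \<otimes> E" "Cod V s = vHom X y x" by (auto simp: ahom_iff)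
    let ?r = "cur V E W (vHom X y x) (s \<cdot> sym_ar V E W)"
    have r: "?r \<in> Ar V" "Dom V ?r = E" "Cod V ?r = ihom V W (vHom X y x)"
      "ev_ar V W (vHom X y x) \<cdot> ((?r \<odot> Ide V W) \<cdot> sym_ar V W E) = s"
      by auto
    have c: "?c y \<in> Ar V" "Dom V (?c y) = vHom X y P" "Cod V (?c y) = ihom V W (vHom X y x)"
      by auto
    show "\<exists>!t. t \<in> ahom V E (vHom X y P) \<and> vc X y P x k t = s"
    proof (rule ex1I[of _ "inv_ar V (?c y) \<cdot> ?r"])
      have t: "inv_ar V (?c y) \<cdot> ?r \<in> ahom V E (vHom X y P)" 
        using iso r c by (simp only: ahom_iff inv_ar_simps Cmp_simps simp_thms)
      have "?c y \<cdot> (inv_ar V (?c y) \<cdot> ?r) = ?r"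
        by (rule inv_ar_cancel(2)[OF iso r(1)]) (simp only: r c)
      with t eq[of y E "inv_ar V (?c y) \<cdot> ?r" ?r] show "inv_ar V (?c y) \<cdot> ?r \<in> ahom V E (vHom X y P) \<and> vc X y P x k (inv_ar V (?c y) \<cdot> ?r) = s"
        using r by (simp only: ahom_iff) simp
    next
      fix t assume t: "t \<in> ahom V E (vHom X y P) \<and> vc X y P x k t = s"
      then have "?c y \<cdot> t = ?r" using eq[of y E t ?r] r by (simp only: ahom_iff) simp
      then have "inv_ar V (?c y) \<cdot> ?r = inv_ar V (?c y) \<cdot> (?c y \<cdot> t)" by (simp only:)
      also have "\<dots> = t"
        by (rule inv_ar_cancel(1)[OF iso]) (use t in \<open>auto simp: ahom_iff\<close>)
      finally show "t = inv_ar V (?c y) \<cdot> ?r" ..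
    qed
  next
    assume *: "\<forall>E \<in> Ob V. \<forall>s \<in> ahom V (W \<otimes> E) (vHom X y x).
        \<exists>!t. t \<in> ahom V E (vHom X y P) \<and> vc X y P x k t = s"
    show "is_iso V (?c y)"
    proof (rule is_iso_if_bijective)
      show "?c y \<in> Ar V" by simp
      fix E r assume E: "E \<in> Ob V" and "r \<in> ahom V E (Cod V (?c y))"
      then have r: "r \<in> Ar V" "Dom V r = E" "Cod V r = ihom V W (vHom X y x)" by (auto simp: ahom_iff)
      have "\<exists>!t. t \<in> ahom V E (vHom X y P) \<and>
          vc X y P x k t = ev_ar V W (vHom X y x) \<cdot> ((r \<odot> Ide V W) \<cdot> sym_ar V W E)"
        using * E r by (auto simp: ahom_iff)
      moreover have "t \<in> ahom V E (vHom X y P) \<and>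
          vc X y P x k t = ev_ar V W (vHom X y x) \<cdot> ((r \<odot> Ide V W) \<cdot> sym_ar V W E)
          \<longleftrightarrow> t \<in> ahom V E (Dom V (?c y)) \<and> ?c y \<cdot> t = r" for t
        using eq[of y E t r] E r by (auto simp: ahom_iff)
      ultimately show "\<exists>!t. t \<in> ahom V E (Dom V (?c y)) \<and> ?c y \<cdot> t = r" by simp
    qed
  qed
  with True show ?thesis unfolding is_cotensor_def universal_counit_def by simp
qed (auto simp: is_cotensor_def universal_counit_def)

end

context vcategory
begin

lemma is_cotensor_iff_universal_counit: "is_cotensor V X W x P k \<longleftrightarrow> universal_counit X W x P k"
  by (rule is_cotensor_iff) (auto intro: vHom_in vCmp_in)

lemma rep_simps [simp]:
  assumes "x \<in> vOb X"
  shows "FO (representable V X x) y = vHom X x y"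
    "y \<in> vOb X \<Longrightarrow> z \<in> vOb X \<Longrightarrow> FH (representable V X x) y z \<in> Ar V"
    "y \<in> vOb X \<Longrightarrow> z \<in> vOb X \<Longrightarrow> Dom V (FH (representable V X x) y z) = vHom X y z"
    "y \<in> vOb X \<Longrightarrow> z \<in> vOb X \<Longrightarrow> Cod V (FH (representable V X x) y z) = ihom V (vHom X x y) (vHom X x z)"
  using assms by (auto simp: representable_def)

lemma ev_rep:
  assumes "x \<in> vOb X" "y \<in> vOb X" "z \<in> vOb X" "p \<in> Ar V" "g \<in> Ar V" "Cod V p = vHom X y z"
    "Cod V g = vHom X x y"
  shows "ev_ar V (vHom X x y) (vHom X x z) \<cdot> ((FH (representable V X x) y z \<cdot> p) \<odot> g) = vc X x y z p g"
proof -
  have "ev_ar V (vHom X x y) (vHom X x z) \<cdot> ((FH (representable V X x) y z \<cdot> p) \<odot> g)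
    = ev_ar V (vHom X x y) (vHom X x z) \<cdot> ((FH (representable V X x) y z \<odot> Ide V (vHom X x y)) \<cdot> (p \<odot> g))"
    using assms by (simp add: interchange)
  also have "\<dots> = vc X x y z p g"
    using assms by (simp add: representable_def vc_def)
  finally show ?thesis .
qed

lemma representable_functor:
  assumes [simp]: "x \<in> vOb X"
  shows "enriched_functor V X (self_enriched V) (representable V X x)"
  unfolding enriched_functor_def
proof (intro conjI ballI)
  let ?R = "representable V X x" and ?S = "self_enriched V"
  interpret S: vcategory V ?S 
    using self_enriched_category symmetric_monoidal_closed_axioms by (simp add: vcategory_def)
  fix a assume [simp]: "a \<in> vOb X"
  show "FO ?R a \<in> vOb ?S" by simp
  have "FH ?R a a \<cdot> vIde X a = cur V \<one> (vHom X x a) (vHom X x a) (lunit_ar V (vHom X x a))"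
    using vc_vIde_left[of x a "Ide V (vHom X x a)"]
    by (intro cur_eqI[symmetric]) (simp_all add: ev_rep)
  then show "FH ?R a a \<cdot> vIde X a = vIde ?S (FO ?R a)" by (simp add: self_enriched_def)
  fix b assume [simp]: "b \<in> vOb X"
  show "FH ?R a b \<in> ahom V (vHom X a b) (vHom ?S (FO ?R a) (FO ?R b))"
    by (simp add: ahom_iff)
  fix c assume [simp]: "c \<in> vOb X"
  \<comment> \<open>After evaluation this is associativity of composition in \<open>X\<close>, since
    evaluating the action of a representable is composing.\<close>
  have "FH ?R a c \<cdot> vCmp X a b c = vc ?S (FO ?R a) (FO ?R b) (FO ?R c) (FH ?R b c) (FH ?R a b)"
  proof (rule uncur_inject[of "vHom X x a" "vHom X x c"])
    have "ev_ar V (vHom X x a) (vHom X x c) \<cdot> ((FH ?R a c \<cdot> vCmp X a b c) \<odot> Ide V (vHom X x a))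
      = vc X x a c (vc X a b c (Ide V (vHom X b c)) (Ide V (vHom X a b))) (Ide V (vHom X x a))"
      by (subst ev_rep) (auto simp: vc_def)
    also have "\<dots> = vc X x b c (Ide V (vHom X b c)) (vc X x a b (Ide V (vHom X a b)) (Ide V (vHom X x a)))
       \<cdot> assoc_ar V (vHom X b c) (vHom X a b) (vHom X x a)"
      by (simp add: vc_assoc)
    also have "\<dots> = ev_ar V (vHom X x b) (vHom X x c) \<cdot> ((FH ?R b c \<cdot> Ide V (vHom X b c))
         \<odot> (ev_ar V (vHom X x a) (vHom X x b) \<cdot> ((FH ?R a b \<cdot> Ide V (vHom X a b)) \<odot> Ide V (vHom X x a))))
       \<cdot> assoc_ar V (vHom X b c) (vHom X a b) (vHom X x a)"
      using ev_rep[of x a b "Ide V (vHom X a b)" "Ide V (vHom X x a)"]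
        ev_rep[of x b c "Ide V (vHom X b c)" "vc X x a b (Ide V (vHom X a b)) (Ide V (vHom X x a))"]
      by simp
    also have "\<dots> = ev_ar V (vHom X x a) (vHom X x c) \<cdot>
       (vc ?S (FO ?R a) (FO ?R b) (FO ?R c) (FH ?R b c) (FH ?R a b) \<odot> Ide V (vHom X x a))"
      by (simp add: ev_vc)
    finally show "ev_ar V (vHom X x a) (vHom X x c) \<cdot> ((FH ?R a c \<cdot> vCmp X a b c) \<odot> Ide V (vHom X x a)) 
      = ev_ar V (vHom X x a) (vHom X x c) \<cdot>
       (vc ?S (FO ?R a) (FO ?R b) (FO ?R c) (FH ?R b c) (FH ?R a b) \<odot> Ide V (vHom X x a))" .
  qed auto
  then show "FH ?R a c \<cdot> vCmp X a b c = vCmp ?S (FO ?R a) (FO ?R b) (FO ?R c) \<cdot> (FH ?R b c \<odot> FH ?R a b)"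
    by (simp add: vc_def)
qed

text \<open>A morphism E \<rightarrow> [y, X(x, P)] is a morphism E \<otimes> y \<rightarrow> X(x,
  P), so lifting it along the image of the counit is lifting its transpose along the counit itself,
  with E \<otimes> y as the new domain.\<close>

lemma representable_universal_counit:
  assumes [simp]: "x \<in> vOb X" and k: "universal_counit X W z P k"
  shows "universal_counit (self_enriched V) W (vHom X x z) (vHom X x P) (FH (representable V X x) P z \<cdot> k)"
proof -
  let ?R = "representable V X x" and ?S = "self_enriched V"
  from k have [simp]: "W \<in> Ob V" "z \<in> vOb X" "P \<in> vOb X" "k \<in> Ar V" "Dom V k = W" "Cod V k = vHom X P z"
    by (auto simp: universal_counit_def ahom_iff)
  have "\<exists>!t. t \<in> ahom V E (ihom V y (vHom X x P)) \<and>
      vc ?S y (vHom X x P) (vHom X x z) (FH ?R P z \<cdot> k) t = s"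
    if [simp]: "y \<in> Ob V" "E \<in> Ob V" and "s \<in> ahom V (W \<otimes> E) (ihom V y (vHom X x z))" for y E s
  proof -
    from that have [simp]: "s \<in> Ar V" "Dom V s = W \<otimes> E" "Cod V s = ihom V y (vHom X x z)" by (auto simp: ahom_iff)
    \<comment> \<open>The transpose of \<open>s\<close>, reassociated so that W is split off from E
      \<otimes> y.\<close>
    let ?s = "ev_ar V y (vHom X x z) \<cdot> ((s \<odot> Ide V y) \<cdot> inv_ar V (assoc_ar V W E y))"
    have eq: "vc ?S y (vHom X x P) (vHom X x z) (FH ?R P z \<cdot> k) t = s \<longleftrightarrow>
        vc X x P z k (ev_ar V y (vHom X x P) \<cdot> (t \<odot> Ide V y)) = ?s"
      if [simp]: "t \<in> Ar V" "Dom V t = E" "Cod V t = ihom V y (vHom X x P)" for t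
    proof -
      let ?v = "vc ?S y (vHom X x P) (vHom X x z) (FH ?R P z \<cdot> k) t"
      have [simp]: "?v \<in> Ar V" "Dom V ?v = W \<otimes> E" "Cod V ?v = ihom V y (vHom X x z)" by auto
      have *: "ev_ar V y (vHom X x z) \<cdot> (?v \<odot> Ide V y)
         = vc X x P z k (ev_ar V y (vHom X x P) \<cdot> (t \<odot> Ide V y)) \<cdot> assoc_ar V W E y"
        by (simp add: ev_vc ev_rep flip: Cmp_assoc)
      show ?thesis
      proof
        assume "?v = s"
        then have "ev_ar V y (vHom X x z) \<cdot> (s \<odot> Ide V y)
         = vc X x P z k (ev_ar V y (vHom X x P) \<cdot> (t \<odot> Ide V y)) \<cdot> assoc_ar V W E y" using * by simp
        then have "?s = (vc X x P z k (ev_ar V y (vHom X x P) \<cdot> (t \<odot> Ide V y)) \<cdot> assoc_ar V W E y) \<cdot> inv_ar V (assoc_ar V W E y)"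
          by (simp flip: Cmp_assoc)
        then show "vc X x P z k (ev_ar V y (vHom X x P) \<cdot> (t \<odot> Ide V y)) = ?s" by simp
      next
        assume "vc X x P z k (ev_ar V y (vHom X x P) \<cdot> (t \<odot> Ide V y)) = ?s"
        with * have "ev_ar V y (vHom X x z) \<cdot> (?v \<odot> Ide V y) = ?s \<cdot> assoc_ar V W E y" by (simp only:)
        then have "ev_ar V y (vHom X x z) \<cdot> (?v \<odot> Ide V y) = ev_ar V y (vHom X x z) \<cdot> (s \<odot> Ide V y)" by simp
        then show "?v = s" by (rule uncur_inject) auto
      qed
    qed
    obtain u where u: "u \<in> ahom V (E \<otimes> y) (vHom X x P)" "vc X x P z k u = ?s"
      and uu: "\<And>u'. u' \<in> ahom V (E \<otimes> y) (vHom X x P) \<Longrightarrow> vc X x P z k u' = ?s \<Longrightarrow> u' = u"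
    proof -
      have "?s \<in> ahom V (W \<otimes> (E \<otimes> y)) (vHom X x z)" by (auto simp: ahom_iff)
      with k have "\<exists>!u. u \<in> ahom V (E \<otimes> y) (vHom X x P) \<and> vc X x P z k u = ?s"
        unfolding universal_counit_def by auto
      then show thesis using that by blast
    qed
    have [simp]: "u \<in> Ar V" "Dom V u = E \<otimes> y" "Cod V u = vHom X x P" using u(1) by (auto simp: ahom_iff)
    show ?thesis
    proof (rule ex1I[of _ "cur V E y (vHom X x P) u"])
      show "cur V E y (vHom X x P) u \<in> ahom V E (ihom V y (vHom X x P)) \<and>
        vc ?S y (vHom X x P) (vHom X x z) (FH ?R P z \<cdot> k) (cur V E y (vHom X x P) u) = s"
        using u(2) by (simp add: ahom_iff eq)
    next
      fix t assume t: "t \<in> ahom V E (ihom V y (vHom X x P)) \<and>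
        vc ?S y (vHom X x P) (vHom X x z) (FH ?R P z \<cdot> k) t = s"
      then have [simp]: "t \<in> Ar V" "Dom V t = E" "Cod V t = ihom V y (vHom X x P)" by (auto simp: ahom_iff)
      from t have "ev_ar V y (vHom X x P) \<cdot> (t \<odot> Ide V y) = u"
        using eq[of t] by (intro uu) (auto simp: ahom_iff)
      then show "t = cur V E y (vHom X x P) u" by (intro cur_eqI[symmetric]) auto
    qed
  qed
  then show ?thesis by (auto simp: universal_counit_def ahom_iff)
qed

end

section \<open>Extending operations to natural families\<close>

text \<open>Naturality and hom-ends refer to the action on objects and on homs alone. With this
  notion the cotensors [J, A] can be used as soon as their actions are typed.\<close>

definition (in symmetric_monoidal_closed)
  prefunctor :: "('t, 'o, 'a, 'n) vcat_scheme \<Rightarrow> ('c, 'o, 'a, 'm) vcat_scheme \<Rightarrow> ('t, 'c, 'a) vfun \<Rightarrow> bool" where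
  "prefunctor T X D \<longleftrightarrow> (\<forall>K \<in> vOb T. FO D K \<in> vOb X) \<and>
     (\<forall>K \<in> vOb T. \<forall>L \<in> vOb T. FH D K L \<in> ahom V (vHom T K L) (vHom X (FO D K) (FO D L)))"

definition (in symmetric_monoidal_closed)
  pointwise_cotensor :: "('t, 'o, 'a, 'n) vcat_scheme \<Rightarrow> ('c, 'o, 'a, 'm) vcat_scheme \<Rightarrow> 'o \<Rightarrow>
    ('t, 'c, 'a) vfun \<Rightarrow> ('t, 'c, 'a) vfun \<Rightarrow> ('t \<Rightarrow> 'a) \<Rightarrow> bool" where
  "pointwise_cotensor T X J A D k \<longleftrightarrow> prefunctor T X D \<and> natural_family V T X D A J k \<and>
     (\<forall>L \<in> vOb T. universal_counit X J (FO A L) (FO D L) (k L))"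

text \<open>Here \<open>D\<close> is a cotensor \<open>[J, A]\<close> with counit \<open>k\<close>, \<open>g : J \<rightarrow> U(J, \<one>)\<close> is the generic operation, and
  \<open>m\<close> is the comparison of \<open>[J, A] \<one>\<close> with the cotensor \<open>B J\<close> of the common carrier.\<close>
definition (in symmetric_monoidal_closed)
  operations_extend :: "('o, 'o, 'a, 'n) vcat_scheme \<Rightarrow> ('c, 'o, 'a, 'm) vcat_scheme \<Rightarrow>
    ('o, 'c, 'a) vfun \<Rightarrow> ('o, 'o, 'a, 'p) vcat_scheme \<Rightarrow> ('o, 'c, 'a) vfun \<Rightarrow> 'o \<Rightarrow> 'a \<Rightarrow>
    ('o, 'c, 'a) vfun \<Rightarrow> ('o \<Rightarrow> 'a) \<Rightarrow> bool" where
  "operations_extend T X A U B J g D k \<longleftrightarrow>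
     (\<exists>q m. natural_family V T X D A (vHom U J \<one>) q \<and>
        m \<in> ahom V \<one> (vHom X (FO D \<one>) (FO B J)) \<and>
        pre X (FO D \<one>) (FO B J) (FO B \<one>) m (FH B J \<one> \<cdot> g) = k \<one> \<and>
        q \<one> = pre X (FO D \<one>) (FO B J) (FO B \<one>) m (FH B J \<one>))"

context symmetric_monoidal_closed
begin

lemma natural_family_iff:
  "natural_family V T X A B E p \<longleftrightarrow> E \<in> Ob V \<and>
     (\<forall>K \<in> vOb T. p K \<in> ahom V E (vHom X (FO A K) (FO B K))) \<and>
     (\<forall>K \<in> vOb T. \<forall>L \<in> vOb T. vc X (FO A K) (FO A L) (FO B L) (p L) (FH A K L)
        = vc X (FO A K) (FO B K) (FO B L) (FH B K L) (p K) \<cdot> sym_ar V E (vHom T K L))"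
  by (simp add: natural_family_def vc_def)

lemma natural_familyD:
  assumes "natural_family V T X A B E p"
  shows "E \<in> Ob V"
    "K \<in> vOb T \<Longrightarrow> p K \<in> Ar V" "K \<in> vOb T \<Longrightarrow> Dom V (p K) = E"
    "K \<in> vOb T \<Longrightarrow> Cod V (p K) = vHom X (FO A K) (FO B K)"
    "K \<in> vOb T \<Longrightarrow> L \<in> vOb T \<Longrightarrow> vc X (FO A K) (FO A L) (FO B L) (p L) (FH A K L)
        = vc X (FO A K) (FO B K) (FO B L) (FH B K L) (p K) \<cdot> sym_ar V E (vHom T K L)"
  using assms by (auto simp: natural_family_iff ahom_iff)

lemma prefunctorD:
  assumes "prefunctor T X D"
  shows "K \<in> vOb T \<Longrightarrow> FO D K \<in> vOb X"
    "K \<in> vOb T \<Longrightarrow> L \<in> vOb T \<Longrightarrow> FH D K L \<in> Ar V"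
    "K \<in> vOb T \<Longrightarrow> L \<in> vOb T \<Longrightarrow> Dom V (FH D K L) = vHom T K L"
    "K \<in> vOb T \<Longrightarrow> L \<in> vOb T \<Longrightarrow> Cod V (FH D K L) = vHom X (FO D K) (FO D L)"
  using assms by (auto simp: prefunctor_def ahom_iff)

lemma enriched_functor_prefunctor: "enriched_functor V T X F \<Longrightarrow> prefunctor T X F"
  by (simp add: enriched_functor_def prefunctor_def)

lemma universal_counitD:
  assumes "universal_counit X W x P k"
  shows "W \<in> Ob V" "x \<in> vOb X" "P \<in> vOb X" "k \<in> Ar V" "Dom V k = W" "Cod V k = vHom X P x"
  using assms by (auto simp: universal_counit_def ahom_iff)

lemma universal_counit_lift:
  assumes "universal_counit X W x P k" "y \<in> vOb X" "E \<in> Ob V" "s \<in> Ar V" "Dom V s = W \<otimes> E" "Cod V s = vHom X y x"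
  obtains t where "t \<in> Ar V" "Dom V t = E" "Cod V t = vHom X y P" "vc X y P x k t = s"
proof -
  have "\<exists>!t. t \<in> ahom V E (vHom X y P) \<and> vc X y P x k t = s"
    using assms by (simp add: universal_counit_def ahom_iff)
  then show thesis using that by (auto simp: ahom_iff)
qed

lemma universal_counit_inject:
  assumes "universal_counit X W x P k" "vc X y P x k t = vc X y P x k t'" "y \<in> vOb X" "t \<in> Ar V" "t' \<in> Ar V"
    "Dom V t = Dom V t'" "Cod V t = vHom X y P" "Cod V t' = vHom X y P"
    "vc X y P x k t' \<in> Ar V" "Cod V (vc X y P x k t') = vHom X y x" "Dom V (vc X y P x k t') = W \<otimes> Dom V t'"
  shows "t = t'"
proof -
  have "\<exists>!u. u \<in> ahom V (Dom V t') (vHom X y P) \<and> vc X y P x k u = vc X y P x k t'"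
    using assms(1,3,5,9-11) by (simp add: universal_counit_def ahom_iff)
  then show ?thesis using assms by (auto simp: ahom_iff)
qed

end

context vcategory
begin

lemma universal_counit_eqI:
  assumes "universal_counit X W x P k" "vc X y P x k t = vc X y P x k t'" "y \<in> vOb X" "t \<in> Ar V" "t' \<in> Ar V"
    "Dom V t = Dom V t'" "Cod V t = vHom X y P" "Cod V t' = vHom X y P"
  shows "t = t'"
  using assms universal_counitD[OF assms(1)] by - (rule universal_counit_inject, auto)

text \<open>The case E = \<one> of the universal property. It produces comparisons between a
  cotensor and any other object with a candidate counit.\<close>

lemma universal_counit_pre:
  assumes k: "universal_counit X W x P k" and "y \<in> vOb X" "k' \<in> Ar V" "Dom V k' = W" "Cod V k' = vHom X y x"
  obtains m where "m \<in> Ar V" "Dom V m = \<one>" "Cod V m = vHom X y P" "pre X y P x m k = k'"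
proof -
  note [simp] = universal_counitD[OF k]
  obtain m where m: "m \<in> Ar V" "Dom V m = \<one>" "Cod V m = vHom X y P" "vc X y P x k m = k' \<cdot> runit_ar V W"
    using universal_counit_lift[OF k, of y \<one> "k' \<cdot> runit_ar V W"] assms by auto
  then have "pre X y P x m k = k'" using assms by (simp add: pre_def)
  with m show thesis using that by blast
qed

lemma universal_counit_pre_eqI:
  assumes k: "universal_counit X W x P k" and "pre X y P x m k = pre X y P x n k" "y \<in> vOb X"
    "m \<in> Ar V" "Dom V m = \<one>" "Cod V m = vHom X y P" "n \<in> Ar V" "Dom V n = \<one>" "Cod V n = vHom X y P"
  shows "m = n"
  using k assms universal_counitD[OF k]
  by - (rule universal_counit_eqI[OF k], simp_all add: vc_eq_pre)

text \<open>Naturality of the comparison \<open>n\<close> between two cotensors of \<open>A\<close>.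
  Both sides agree after composition with the counit \<open>k L\<close>, by naturality of
  \<open>k'\<close> and of \<open>k\<close>.\<close>

lemma pointwise_cotensor_compare:
  assumes T: "vcategory V T" and A: "prefunctor T X A"
    and D: "pointwise_cotensor T X J A D k" and D': "pointwise_cotensor T X J A D' k'"
    and n: "\<And>L. L \<in> vOb T \<Longrightarrow> n L \<in> Ar V \<and> Dom V (n L) = \<one> \<and> Cod V (n L) = vHom X (FO D' L) (FO D L) \<and>
      pre X (FO D' L) (FO D L) (FO A L) (n L) (k L) = k' L"
    and [simp]: "K \<in> vOb T" "L \<in> vOb T"
  shows "post X (FO D' K) (FO D' L) (FO D L) (n L) (FH D' K L)
    = pre X (FO D' K) (FO D K) (FO D L) (n K) (FH D K L)"
proof -
  interpret T: vcategory V T by fact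
  have nk: "natural_family V T X D A J k" and nk': "natural_family V T X D' A J k'"
    and uc: "universal_counit X J (FO A L) (FO D L) (k L)"
    and pD: "prefunctor T X D" and pD': "prefunctor T X D'"
    using D D' by (auto simp: pointwise_cotensor_def)
  note [simp] = prefunctorD[OF A] prefunctorD[OF pD] prefunctorD[OF pD'] natural_familyD(1-4)[OF nk]
    natural_familyD(1-4)[OF nk']
  have [simp]: "n L \<in> Ar V" "Dom V (n L) = \<one>" "Cod V (n L) = vHom X (FO D' L) (FO D L)" if "L \<in> vOb T" for L
    using n[OF that] by auto
  show ?thesis
  proof (rule universal_counit_eqI[OF uc])
    have "vc X (FO D' K) (FO D L) (FO A L) (k L) (post X (FO D' K) (FO D' L) (FO D L) (n L) (FH D' K L))
      = vc X (FO D' K) (FO D' L) (FO A L) (k' L) (FH D' K L)"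
      using n[of L] by (simp add: vc_pre_post[symmetric])
    also have "\<dots> = vc X (FO D' K) (FO A K) (FO A L) (FH A K L) (k' K) \<cdot> sym_ar V J (vHom T K L)"
      by (simp add: natural_familyD(5)[OF nk'])
    also have "\<dots> = vc X (FO D' K) (FO A K) (FO A L) (FH A K L) (pre X (FO D' K) (FO D K) (FO A K) (n K) (k K))
         \<cdot> sym_ar V J (vHom T K L)"
      using n[of K] by simp
    also have "\<dots> = pre X (FO D' K) (FO D K) (FO A L) (n K)
        (vc X (FO D K) (FO A K) (FO A L) (FH A K L) (k K) \<cdot> sym_ar V J (vHom T K L))"
      by (simp add: vc_pre pre_Cmp)
    also have "\<dots> = pre X (FO D' K) (FO D K) (FO A L) (n K) (vc X (FO D K) (FO D L) (FO A L) (k L) (FH D K L))"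
      by (simp add: natural_familyD(5)[OF nk])
    also have "\<dots> = vc X (FO D' K) (FO D L) (FO A L) (k L) (pre X (FO D' K) (FO D K) (FO D L) (n K) (FH D K L))"
      by (simp add: vc_pre)
    finally show "vc X (FO D' K) (FO D L) (FO A L) (k L) (post X (FO D' K) (FO D' L) (FO D L) (n L) (FH D' K L))
      = vc X (FO D' K) (FO D L) (FO A L) (k L) (pre X (FO D' K) (FO D K) (FO D L) (n K) (FH D K L))" .
  qed auto
qed

text \<open>The extension is composed with the comparison between the two cotensors, which is
  natural by \<open>pointwise_cotensor_compare\<close>. This is needed because functors carry
  designated cotensors to arbitrary ones.\<close>

lemma operations_extend_independent:
  assumes T: "vcategory V T" and A: "prefunctor T X A" and B: "prefunctor U X B"
    and D: "pointwise_cotensor T X J A D k" and D': "pointwise_cotensor T X J A D' k'"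
    and g: "g \<in> ahom V J (vHom U J \<one>)" and J: "J \<in> vOb U" "\<one> \<in> vOb U" "\<one> \<in> vOb T"
    and AB: "FO A \<one> = FO B \<one>"
    and ex: "operations_extend T X A U B J g D k"
  shows "operations_extend T X A U B J g D' k'"
proof -
  interpret T: vcategory V T by fact
  have nk: "natural_family V T X D A J k" and nk': "natural_family V T X D' A J k'"
    and uc: "L \<in> vOb T \<Longrightarrow> universal_counit X J (FO A L) (FO D L) (k L)"
    and pD: "prefunctor T X D" and pD': "prefunctor T X D'" for L
    using D D' by (auto simp: pointwise_cotensor_def)
  note [simp] = prefunctorD[OF A] prefunctorD[OF pD] prefunctorD[OF pD'] natural_familyD(1-4)[OF nk]
    natural_familyD(1-4)[OF nk'] J prefunctorD[OF B]
  have [simp]: "g \<in> Ar V" "Dom V g = J" "Cod V g = vHom U J \<one>" using g by (auto simp: ahom_iff)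
  obtain q m where q: "natural_family V T X D A (vHom U J \<one>) q"
    and m: "m \<in> ahom V \<one> (vHom X (FO D \<one>) (FO B J))"
      "pre X (FO D \<one>) (FO B J) (FO B \<one>) m (FH B J \<one> \<cdot> g) = k \<one>"
      "q \<one> = pre X (FO D \<one>) (FO B J) (FO B \<one>) m (FH B J \<one>)"
    using ex by (auto simp: operations_extend_def)
  note [simp] = natural_familyD(1-4)[OF q]
  have [simp]: "m \<in> Ar V" "Dom V m = \<one>" "Cod V m = vHom X (FO D \<one>) (FO B J)" using m by (auto simp: ahom_iff)
  have "\<exists>n. n \<in> Ar V \<and> Dom V n = \<one> \<and> Cod V n = vHom X (FO D' L) (FO D L) \<and>
      pre X (FO D' L) (FO D L) (FO A L) n (k L) = k' L" if "L \<in> vOb T" for L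
  proof -
    have "k' L \<in> Ar V" "Dom V (k' L) = J" "Cod V (k' L) = vHom X (FO D' L) (FO A L)" "FO D' L \<in> vOb X"
      using that by auto
    then show ?thesis using universal_counit_pre[OF uc[OF that]] by metis
  qed
  then obtain n where n: "\<And>L. L \<in> vOb T \<Longrightarrow> n L \<in> Ar V \<and> Dom V (n L) = \<one> \<and> Cod V (n L) = vHom X (FO D' L) (FO D L) \<and>
      pre X (FO D' L) (FO D L) (FO A L) (n L) (k L) = k' L" by metis
  then have [simp]: "n L \<in> Ar V" "Dom V (n L) = \<one>" "Cod V (n L) = vHom X (FO D' L) (FO D L)" if "L \<in> vOb T" for L
    using that by auto
  let ?q = "\<lambda>L. pre X (FO D' L) (FO D L) (FO A L) (n L) (q L)"
  have "natural_family V T X D' A (vHom U J \<one>) ?q"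
    unfolding natural_family_iff
  proof (intro conjI ballI)
    fix K L assume [simp]: "K \<in> vOb T" "L \<in> vOb T"
    have "vc X (FO D' K) (FO D' L) (FO A L) (?q L) (FH D' K L)
      = vc X (FO D' K) (FO D L) (FO A L) (q L) (post X (FO D' K) (FO D' L) (FO D L) (n L) (FH D' K L))"
      by (simp add: vc_pre_post)
    also have "\<dots> = vc X (FO D' K) (FO D L) (FO A L) (q L) (pre X (FO D' K) (FO D K) (FO D L) (n K) (FH D K L))"
      using pointwise_cotensor_compare[OF T A D D' n, of K L] by simp
    also have "\<dots> = pre X (FO D' K) (FO D K) (FO A L) (n K) (vc X (FO D K) (FO A K) (FO A L) (FH A K L) (q K) \<cdot> sym_ar V (vHom U J \<one>) (vHom T K L))"
      by (simp add: vc_pre natural_familyD(5)[OF q])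
    also have "\<dots> = vc X (FO D' K) (FO A K) (FO A L) (FH A K L) (?q K) \<cdot> sym_ar V (vHom U J \<one>) (vHom T K L)"
      by (simp add: vc_pre pre_Cmp)
    finally show "vc X (FO D' K) (FO D' L) (FO A L) (?q L) (FH D' K L)
      = vc X (FO D' K) (FO A K) (FO A L) (FH A K L) (?q K) \<cdot> sym_ar V (vHom U J \<one>) (vHom T K L)" .
  qed (auto simp: ahom_iff)
  \<comment> \<open>The comparison at the unit is absorbed into the comparison with
    \<open>B J\<close>.\<close>
  moreover have "pre X (FO D' \<one>) (FO D \<one>) (FO B J) (n \<one>) m \<in> ahom V \<one> (vHom X (FO D' \<one>) (FO B J))"
    by (simp add: ahom_iff)
  moreover have "pre X (FO D' \<one>) (FO B J) (FO B \<one>) (pre X (FO D' \<one>) (FO D \<one>) (FO B J) (n \<one>) m) (FH B J \<one> \<cdot> g) = k' \<one>"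
    using n[of \<one>] m(2) by (simp add: pre_pre[symmetric] AB)
  moreover have "?q \<one> = pre X (FO D' \<one>) (FO B J) (FO B \<one>) (pre X (FO D' \<one>) (FO D \<one>) (FO B J) (n \<one>) m) (FH B J \<one>)"
    using m(3) by (simp add: pre_pre[symmetric] AB)
  ultimately show ?thesis unfolding operations_extend_def by blast
qed

end

text \<open>A relation instead of the record \<open>vfun_comp\<close>: composites formed with the
  composition of the small base and with that of its enlargement both occur, and agreement on the
  objects of \<open>T\<close> is all that naturality sees.\<close>

definition (in symmetric_monoidal_closed)
  composite_on :: "('t, 'o, 'a, 'n) vcat_scheme \<Rightarrow> ('c, 'd, 'a) vfun \<Rightarrow> ('t, 'c, 'a) vfun \<Rightarrow> ('t, 'd, 'a) vfun \<Rightarrow> bool" where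
  "composite_on T H A HA \<longleftrightarrow> (\<forall>K \<in> vOb T. FO HA K = FO H (FO A K)) \<and>
     (\<forall>K \<in> vOb T. \<forall>L \<in> vOb T. FH HA K L = FH H (FO A K) (FO A L) \<cdot> FH A K L)"

locale vfunctor = X: vcategory V X + Y: vcategory V Y
  for V :: "('o, 'a) smc" (structure) and X :: "('c, 'o, 'a, 'm) vcat_scheme"
    and Y :: "('d, 'o, 'a, 'n) vcat_scheme" +
  fixes H :: "('c, 'd, 'a) vfun"
  assumes enriched_functor: "enriched_functor V X Y H"
begin

lemma H_simps [simp]:
  "x \<in> vOb X \<Longrightarrow> FO H x \<in> vOb Y"
  "x \<in> vOb X \<Longrightarrow> y \<in> vOb X \<Longrightarrow> FH H x y \<in> Ar V"
  "x \<in> vOb X \<Longrightarrow> y \<in> vOb X \<Longrightarrow> Dom V (FH H x y) = vHom X x y"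
  "x \<in> vOb X \<Longrightarrow> y \<in> vOb X \<Longrightarrow> Cod V (FH H x y) = vHom Y (FO H x) (FO H y)"
  using enriched_functor by (auto simp: enriched_functor_def ahom_iff)

lemma H_vIde: "x \<in> vOb X \<Longrightarrow> FH H x x \<cdot> vIde X x = vIde Y (FO H x)"
  using enriched_functor by (auto simp: enriched_functor_def)

lemma H_vc:
  assumes "x \<in> vOb X" "y \<in> vOb X" "z \<in> vOb X" "p \<in> Ar V" "q \<in> Ar V"
    "Cod V p = vHom X y z" "Cod V q = vHom X x y"
  shows "FH H x z \<cdot> X.vc X x y z p q = X.vc Y (FO H x) (FO H y) (FO H z) (FH H y z \<cdot> p) (FH H x y \<cdot> q)"
proof -
  have "FH H x z \<cdot> X.vc X x y z p q = (FH H x z \<cdot> vCmp X x y z) \<cdot> (p \<odot> q)"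
    using assms by (simp add: X.vc_def)
  also have "FH H x z \<cdot> vCmp X x y z = vCmp Y (FO H x) (FO H y) (FO H z) \<cdot> (FH H y z \<odot> FH H x y)"
    using enriched_functor assms by (simp add: enriched_functor_def)
  finally show ?thesis using assms by (simp add: X.vc_def X.interchange)
qed

lemma H_pre:
  assumes "x \<in> vOb X" "y \<in> vOb X" "z \<in> vOb X" "p \<in> Ar V" "m \<in> Ar V"
    "Cod V p = vHom X y z" "Cod V m = vHom X x y" "Dom V m = \<one>"
  shows "FH H x z \<cdot> X.pre X x y z m p = X.pre Y (FO H x) (FO H y) (FO H z) (FH H x y \<cdot> m) (FH H y z \<cdot> p)"
  using assms H_vc[of x y z p m] by (simp add: X.pre_def flip: X.Cmp_assoc)

lemma prefunctor_composite:
  assumes "X.prefunctor T X A" "X.composite_on T H A HA"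
  shows "X.prefunctor T Y HA"
  using assms by (auto simp: X.prefunctor_def X.composite_on_def ahom_iff)

lemma natural_family_composite:
  assumes "vcategory V T" and A: "X.prefunctor T X A" and B: "X.prefunctor T X B"
    and HA: "X.composite_on T H A HA" and HB: "X.composite_on T H B HB"
    and p: "natural_family V T X A B E p"
  shows "natural_family V T Y HA HB E (\<lambda>K. FH H (FO A K) (FO B K) \<cdot> p K)"
  unfolding X.natural_family_iff
proof (intro conjI ballI)
  interpret T: vcategory V T by fact
  note [simp] = X.prefunctorD[OF A] X.prefunctorD[OF B] X.natural_familyD(1-4)[OF p]
  show "E \<in> Ob V" by simp
  fix K assume [simp]: "K \<in> vOb T"
  show "FH H (FO A K) (FO B K) \<cdot> p K \<in> ahom V E (vHom Y (FO HA K) (FO HB K))"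
    using HA HB by (simp add: ahom_iff X.composite_on_def)
  fix L assume [simp]: "L \<in> vOb T"
  show "X.vc Y (FO HA K) (FO HA L) (FO HB L) (FH H (FO A L) (FO B L) \<cdot> p L) (FH HA K L)
    = X.vc Y (FO HA K) (FO HB K) (FO HB L) (FH HB K L) (FH H (FO A K) (FO B K) \<cdot> p K) \<cdot> sym_ar V E (vHom T K L)"
    using HA HB by (simp add: X.composite_on_def H_vc[symmetric] X.natural_familyD(5)[OF p])
qed

lemma operations_extend_composite:
  assumes T: "vcategory V T" and A: "X.prefunctor T X A" and B: "X.prefunctor U X B" and D: "X.prefunctor T X D"
    and HA: "X.composite_on T H A HA" and HB: "X.composite_on U H B HB" and HD: "X.composite_on T H D HD"
    and g: "g \<in> ahom V J (vHom U J \<one>)" and J: "J \<in> vOb U" "\<one> \<in> vOb U" "\<one> \<in> vOb T"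
    and ex: "X.operations_extend T X A U B J g D k" and AB: "FO A \<one> = FO B \<one>"
  shows "X.operations_extend T Y HA U HB J g HD (\<lambda>K. FH H (FO D K) (FO A K) \<cdot> k K)"
proof -
  interpret T: vcategory V T by fact
  note [simp] = X.prefunctorD[OF A] X.prefunctorD[OF D] J X.prefunctorD[OF B]
  have [simp]: "g \<in> Ar V" "Dom V g = J" "Cod V g = vHom U J \<one>" using g by (auto simp: ahom_iff)
  obtain q m where q: "natural_family V T X D A (vHom U J \<one>) q"
    and m: "m \<in> ahom V \<one> (vHom X (FO D \<one>) (FO B J))"
      "X.pre X (FO D \<one>) (FO B J) (FO B \<one>) m (FH B J \<one> \<cdot> g) = k \<one>"
      "q \<one> = X.pre X (FO D \<one>) (FO B J) (FO B \<one>) m (FH B J \<one>)"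
    using ex by (auto simp: X.operations_extend_def)
  have [simp]: "m \<in> Ar V" "Dom V m = \<one>" "Cod V m = vHom X (FO D \<one>) (FO B J)" using m by (auto simp: ahom_iff)
  have HO: "FO HD \<one> = FO H (FO D \<one>)" "FO HB J = FO H (FO B J)" "FO HB \<one> = FO H (FO B \<one>)"
    "FH HB J \<one> = FH H (FO B J) (FO B \<one>) \<cdot> FH B J \<one>"
    using HD HB by (auto simp: X.composite_on_def)
  show ?thesis unfolding X.operations_extend_def
  proof (intro exI conjI)
    show "natural_family V T Y HD HA (vHom U J \<one>) (\<lambda>K. FH H (FO D K) (FO A K) \<cdot> q K)"
      by (rule natural_family_composite[OF T D A HD HA q])
    show "FH H (FO D \<one>) (FO B J) \<cdot> m \<in> ahom V \<one> (vHom Y (FO HD \<one>) (FO HB J))"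
      by (simp add: ahom_iff HO)
    show "X.pre Y (FO HD \<one>) (FO HB J) (FO HB \<one>) (FH H (FO D \<one>) (FO B J) \<cdot> m) (FH HB J \<one> \<cdot> g)
      = FH H (FO D \<one>) (FO A \<one>) \<cdot> k \<one>"
      unfolding m(2)[symmetric] by (simp add: HO H_pre AB)
    show "FH H (FO D \<one>) (FO A \<one>) \<cdot> q \<one> = X.pre Y (FO HD \<one>) (FO HB J) (FO HB \<one>)
       (FH H (FO D \<one>) (FO B J) \<cdot> m) (FH HB J \<one>)"
      unfolding m(3) by (simp add: HO H_pre AB)
  qed
qed

lemma pointwise_cotensor_composite:
  assumes T: "vcategory V T" and A: "X.prefunctor T X A" 
    and HA: "X.composite_on T H A HA" and HD: "X.composite_on T H D HD"
    and D: "X.pointwise_cotensor T X J A D k"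
    and H: "\<And>x P k. X.universal_counit X J x P k \<Longrightarrow> X.universal_counit Y J (FO H x) (FO H P) (FH H P x \<cdot> k)"
  shows "X.pointwise_cotensor T Y J HA HD (\<lambda>K. FH H (FO D K) (FO A K) \<cdot> k K)"
proof -
  have pD: "X.prefunctor T X D" and k: "natural_family V T X D A J k"
    and uc: "\<And>L. L \<in> vOb T \<Longrightarrow> X.universal_counit X J (FO A L) (FO D L) (k L)"
    using D by (auto simp: X.pointwise_cotensor_def)
  show ?thesis unfolding X.pointwise_cotensor_def
    using prefunctor_composite[OF pD HD] natural_family_composite[OF T pD A HD HA k] H[OF uc] HA HD
    by (auto simp: X.composite_on_def)
qed

end

text \<open>The extensions in the \<open>Y l\<close> are not glued. One candidate \<open>q\<close>
  is built in \<open>X\<close> from the cotensors \<open>A L\<close>, and uniqueness in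
  \<open>Y l\<close> shows that its image is the extension given there. Its naturality thus holds
  after every \<open>H l\<close>, and joint faithfulness removes the \<open>H l\<close>.\<close>

lemma (in vcategory) operations_extend_reflect:
  fixes Y :: "'l \<Rightarrow> ('d, 'o, 'a, 'n) vcat_scheme" and H :: "'l \<Rightarrow> ('c, 'd, 'a) vfun"
  assumes T: "vcategory V T" and U: "vcategory V U" and A: "enriched_functor V T X A" and B: "prefunctor U X B"
    and H: "\<And>l. l \<in> \<Lambda> \<Longrightarrow> vfunctor V X (Y l) (H l)"
    and H_pres: "\<And>l x P k W. l \<in> \<Lambda> \<Longrightarrow> W \<in> insert J (vOb T) \<Longrightarrow> universal_counit X W x P k \<Longrightarrow>
        universal_counit (Y l) W (FO (H l) x) (FO (H l) P) (FH (H l) P x \<cdot> k)"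
    and faithful: "\<And>x y g h. x \<in> vOb X \<Longrightarrow> y \<in> vOb X \<Longrightarrow> g \<in> Ar V \<Longrightarrow> h \<in> Ar V \<Longrightarrow> Dom V g = Dom V h \<Longrightarrow>
        Cod V g = vHom X x y \<Longrightarrow> Cod V h = vHom X x y \<Longrightarrow>
        (\<And>l. l \<in> \<Lambda> \<Longrightarrow> FH (H l) x y \<cdot> g = FH (H l) x y \<cdot> h) \<Longrightarrow> g = h"
    and HA: "\<And>l. l \<in> \<Lambda> \<Longrightarrow> composite_on T (H l) A (HA l)"
    and HB: "\<And>l. l \<in> \<Lambda> \<Longrightarrow> composite_on U (H l) B (HB l)"
    and HD: "\<And>l. l \<in> \<Lambda> \<Longrightarrow> composite_on T (H l) D (HD l)"
    and g: "g \<in> ahom V J (vHom U J \<one>)" and J: "J \<in> vOb U" "\<one> \<in> vOb U" "\<one> \<in> vOb T"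
    and a: "\<And>L. L \<in> vOb T \<Longrightarrow> \<gamma> L \<in> ahom V L (vHom T L \<one>)"
      "\<And>L. L \<in> vOb T \<Longrightarrow> universal_counit X L (FO A \<one>) (FO A L) (FH A L \<one> \<cdot> \<gamma> L)"
    and b: "universal_counit X J (FO B \<one>) (FO B J) (FH B J \<one> \<cdot> g)"
    and AB: "FO A \<one> = FO B \<one>"
    and D: "pointwise_cotensor T X J A D k"
    and ex: "\<And>l. l \<in> \<Lambda> \<Longrightarrow> operations_extend T (Y l) (HA l) U (HB l) J g (HD l) (\<lambda>K. FH (H l) (FO D K) (FO A K) \<cdot> k K)"
  shows "operations_extend T X A U B J g D k"
proof -
  interpret T: vcategory V T by fact
  interpret U: vcategory V U by fact
  have nk: "natural_family V T X D A J k" and pD: "prefunctor T X D"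
    using D by (auto simp: pointwise_cotensor_def)
  note [simp] = prefunctorD[OF enriched_functor_prefunctor[OF A]] prefunctorD[OF pD] J prefunctorD[OF B] natural_familyD(1-4)[OF nk]
  have [simp]: "\<gamma> L \<in> Ar V" "Dom V (\<gamma> L) = L" "Cod V (\<gamma> L) = vHom T L \<one>" "L \<in> Ob V" if "L \<in> vOb T" for L
    using a(1)[OF that] Dom_Ob[of "\<gamma> L"] by (auto simp: ahom_iff)
  have [simp]: "g \<in> Ar V" "Dom V g = J" "Cod V g = vHom U J \<one>" using g by (auto simp: ahom_iff)
  have [simp]: "FO D \<one> \<in> vOb X" "k \<one> \<in> Ar V" by auto
  \<comment> \<open>The comparison exists in \<open>X\<close> already, since \<open>B J\<close> is a
    cotensor of the common carrier.\<close>
  obtain m where [simp]: "m \<in> Ar V" "Dom V m = \<one>" "Cod V m = vHom X (FO D \<one>) (FO B J)"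
    and m: "pre X (FO D \<one>) (FO B J) (FO B \<one>) m (FH B J \<one> \<cdot> g) = k \<one>"
    using universal_counit_pre[OF b, of "FO D \<one>" "k \<one>"] AB by auto
  let ?q1 = "pre X (FO D \<one>) (FO B J) (FO B \<one>) m (FH B J \<one>)"
  let ?U = "vHom U J \<one>"
  \<comment> \<open>The equation is the naturality square of the desired family along \<gamma> L : L
    \<rightarrow> T(L, \<one>). As \<open>A L\<close> is a cotensor of the carrier with counit
    induced by \<gamma> L, the square can be solved for the component at L.\<close>
  have "\<exists>t. t \<in> Ar V \<and> Dom V t = ?U \<and> Cod V t = vHom X (FO D L) (FO A L) \<and>
       vc X (FO D L) (FO A L) (FO A \<one>) (FH A L \<one> \<cdot> \<gamma> L) t
       = vc X (FO D L) (FO D \<one>) (FO B \<one>) ?q1 (FH D L \<one> \<cdot> \<gamma> L) \<cdot> sym_ar V L ?U"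
    if L: "L \<in> vOb T" for L
  proof -
    let ?s = "vc X (FO D L) (FO D \<one>) (FO B \<one>) ?q1 (FH D L \<one> \<cdot> \<gamma> L) \<cdot> sym_ar V L ?U"
    have "?s \<in> Ar V" "Dom V ?s = L \<otimes> ?U" "Cod V ?s = vHom X (FO D L) (FO A \<one>)"
      using L AB by auto
    then show ?thesis
      using universal_counit_lift[OF a(2)[OF L], of "FO D L" ?U ?s] L by simp metis
  qed
  then obtain q0 where q0: "\<And>L. L \<in> vOb T \<Longrightarrow> q0 L \<in> Ar V \<and> Dom V (q0 L) = ?U \<and> Cod V (q0 L) = vHom X (FO D L) (FO A L) \<and>
       vc X (FO D L) (FO A L) (FO A \<one>) (FH A L \<one> \<cdot> \<gamma> L) (q0 L)
       = vc X (FO D L) (FO D \<one>) (FO B \<one>) ?q1 (FH D L \<one> \<cdot> \<gamma> L) \<cdot> sym_ar V L ?U"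
    by metis
  \<comment> \<open>At the unit the prescribed operation itself is taken, so that the last clause of
    \<open>operations_extend\<close> holds by definition.\<close>
  define q where "q L = (if L = \<one> then ?q1 else q0 L)" for L
  have [simp]: "q L \<in> Ar V" "Dom V (q L) = ?U" "Cod V (q L) = vHom X (FO D L) (FO A L)" if "L \<in> vOb T" for L
    using q0[OF that] AB by (auto simp: q_def)
  have nat: "FH (H l) (FO D K) (FO A L) \<cdot> vc X (FO D K) (FO D L) (FO A L) (q L) (FH D K L)
        = FH (H l) (FO D K) (FO A L) \<cdot> (vc X (FO D K) (FO A K) (FO A L) (FH A K L) (q K) \<cdot> sym_ar V ?U (vHom T K L))"
    if l: "l \<in> \<Lambda>" and [simp]: "K \<in> vOb T" "L \<in> vOb T" for l K L
  proof -
    interpret H: vfunctor V X "Y l" "H l" using H[OF l] .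
    let ?h = "FH (H l)" and ?H = "FO (H l)" and ?Y = "Y l"
    obtain q' m' where q': "natural_family V T ?Y (HD l) (HA l) ?U q'"
      and m': "m' \<in> ahom V \<one> (vHom ?Y (FO (HD l) \<one>) (FO (HB l) J))"
        "pre ?Y (FO (HD l) \<one>) (FO (HB l) J) (FO (HB l) \<one>) m' (FH (HB l) J \<one> \<cdot> g) = ?h (FO D \<one>) (FO A \<one>) \<cdot> k \<one>"
        "q' \<one> = pre ?Y (FO (HD l) \<one>) (FO (HB l) J) (FO (HB l) \<one>) m' (FH (HB l) J \<one>)"
      using ex[OF l] unfolding operations_extend_def by blast
    note comp = HA[OF l, unfolded composite_on_def] HB[OF l, unfolded composite_on_def] HD[OF l, unfolded composite_on_def]
    have [simp]: "m' \<in> Ar V" "Dom V m' = \<one>" "Cod V m' = vHom ?Y (?H (FO D \<one>)) (?H (FO B J))"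
      using m'(1) comp by (auto simp: ahom_iff)
    \<comment> \<open>\<open>H l\<close> keeps \<open>B J\<close> a cotensor, so the comparison that
      comes with the extension in \<open>Y l\<close> is forced to be the image of
      \<open>m\<close>.\<close>
    have mm': "m' = ?h (FO D \<one>) (FO B J) \<cdot> m"
    proof (rule H.Y.universal_counit_pre_eqI)
      show "universal_counit ?Y J (?H (FO B \<one>)) (?H (FO B J)) (?h (FO B J) (FO B \<one>) \<cdot> (FH B J \<one> \<cdot> g))"
        by (rule H_pres[OF l _ b]) simp
      show "pre ?Y (?H (FO D \<one>)) (?H (FO B J)) (?H (FO B \<one>)) m' (?h (FO B J) (FO B \<one>) \<cdot> (FH B J \<one> \<cdot> g))
        = pre ?Y (?H (FO D \<one>)) (?H (FO B J)) (?H (FO B \<one>)) (?h (FO D \<one>) (FO B J) \<cdot> m) (?h (FO B J) (FO B \<one>) \<cdot> (FH B J \<one> \<cdot> g))"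
        using m'(2) comp m by (simp add: H.H_pre[symmetric] AB)
    qed auto
    have q'1: "q' \<one> = ?h (FO D \<one>) (FO B \<one>) \<cdot> ?q1"
      using m'(3) comp by (simp add: mm' H.H_pre)
    have [simp]: "q' L \<in> Ar V" "Dom V (q' L) = ?U" "Cod V (q' L) = vHom ?Y (?H (FO D L)) (?H (FO A L))" if "L \<in> vOb T" for L
      using natural_familyD(2-4)[OF q' that] comp that by auto
    \<comment> \<open>Away from the unit both sides solve the naturality square along \<gamma> L,
      over the same component at the unit. They agree because the image of \<open>A L\<close> is
      still a cotensor of the image of the carrier.\<close>
    have q'L: "q' L = ?h (FO D L) (FO A L) \<cdot> q L" if [simp]: "L \<in> vOb T" for L
    proof (cases "L = \<one>")
      case True
      then show ?thesis using q'1 AB by (simp add: q_def)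
    next
      case False
      let ?a = "FH A L \<one> \<cdot> \<gamma> L" and ?d = "FH D L \<one> \<cdot> \<gamma> L"
      show ?thesis
      proof (rule H.Y.universal_counit_eqI)
        show "universal_counit ?Y L (?H (FO A \<one>)) (?H (FO A L)) (?h (FO A L) (FO A \<one>) \<cdot> ?a)"
          by (rule H_pres[OF l _ a(2)]) simp_all
        have "vc ?Y (?H (FO D L)) (?H (FO A L)) (?H (FO A \<one>)) (?h (FO A L) (FO A \<one>) \<cdot> ?a) (?h (FO D L) (FO A L) \<cdot> q L)
           = ?h (FO D L) (FO A \<one>) \<cdot> vc X (FO D L) (FO A L) (FO A \<one>) ?a (q L)"
          by (simp add: H.H_vc)
        also have "\<dots> = ?h (FO D L) (FO A \<one>) \<cdot> (vc X (FO D L) (FO D \<one>) (FO B \<one>) ?q1 ?d \<cdot> sym_ar V L ?U)"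
          using q0[of L] False by (simp add: q_def)
        also have "\<dots> = vc ?Y (?H (FO D L)) (?H (FO D \<one>)) (?H (FO B \<one>)) (q' \<one>) (?h (FO D L) (FO D \<one>) \<cdot> ?d) \<cdot> sym_ar V L ?U"
          by (simp add: q'1 H.H_vc[symmetric] AB)
        also have "\<dots> = vc ?Y (FO (HD l) L) (FO (HD l) \<one>) (FO (HA l) \<one>) (q' \<one>) (FH (HD l) L \<one>) \<cdot> ((Ide V ?U \<odot> \<gamma> L) \<cdot> sym_ar V L ?U)"
          using comp AB H.Y.vc_Cmp_right[of "?H (FO D L)" "?H (FO D \<one>)" "?H (FO B \<one>)" "q' \<one>" "?h (FO D L) (FO D \<one>) \<cdot> FH D L \<one>" "\<gamma> L"]
          by simp
        also have "\<dots> = vc ?Y (FO (HD l) L) (FO (HA l) L) (FO (HA l) \<one>) (FH (HA l) L \<one>) (q' L) \<cdot> (sym_ar V ?U (vHom T L \<one>) \<cdot> ((Ide V ?U \<odot> \<gamma> L) \<cdot> sym_ar V L ?U))"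
          using comp by (subst natural_familyD(5)[OF q']) auto
        also have "\<dots> = vc ?Y (FO (HD l) L) (FO (HA l) L) (FO (HA l) \<one>) (FH (HA l) L \<one>) (q' L) \<cdot> (\<gamma> L \<odot> Ide V ?U)"
          by (subst sym_natural_assoc) auto
        also have "\<dots> = vc ?Y (?H (FO D L)) (?H (FO A L)) (?H (FO A \<one>)) (?h (FO A L) (FO A \<one>) \<cdot> ?a) (q' L)"
          using comp H.Y.vc_Cmp_left[of "?H (FO D L)" "?H (FO A L)" "?H (FO A \<one>)" "?h (FO A L) (FO A \<one>) \<cdot> FH A L \<one>" "q' L" "\<gamma> L"]
          by simp
        finally show "vc ?Y (?H (FO D L)) (?H (FO A L)) (?H (FO A \<one>)) (?h (FO A L) (FO A \<one>) \<cdot> ?a) (q' L)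
          = vc ?Y (?H (FO D L)) (?H (FO A L)) (?H (FO A \<one>)) (?h (FO A L) (FO A \<one>) \<cdot> ?a) (?h (FO D L) (FO A L) \<cdot> q L)" ..
      qed auto
    qed
    have "vc ?Y (FO (HD l) K) (FO (HD l) L) (FO (HA l) L) (q' L) (FH (HD l) K L)
        = vc ?Y (FO (HD l) K) (FO (HA l) K) (FO (HA l) L) (FH (HA l) K L) (q' K) \<cdot> sym_ar V ?U (vHom T K L)"
      by (rule natural_familyD(5)[OF q']) auto
    then show ?thesis using comp by (simp add: q'L H.H_vc[symmetric])
  qed
  show ?thesis unfolding operations_extend_def
  proof (intro exI conjI)
    show "natural_family V T X D A ?U q"
      unfolding natural_family_iff
    proof (intro conjI ballI)
      fix K L assume [simp]: "K \<in> vOb T" "L \<in> vOb T"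
      show "vc X (FO D K) (FO D L) (FO A L) (q L) (FH D K L)
        = vc X (FO D K) (FO A K) (FO A L) (FH A K L) (q K) \<cdot> sym_ar V ?U (vHom T K L)"
        by (rule faithful[of "FO D K" "FO A L"]) (auto simp: nat)
    qed (auto simp: ahom_iff)
    show "m \<in> ahom V \<one> (vHom X (FO D \<one>) (FO B J))" by (simp add: ahom_iff)
    show "pre X (FO D \<one>) (FO B J) (FO B \<one>) m (FH B J \<one> \<cdot> g) = k \<one>" by (rule m)
    show "q \<one> = pre X (FO D \<one>) (FO B J) (FO B \<one>) m (FH B J \<one>)" by (simp add: q_def)
  qed
qed

section \<open>Generic operations of a theory\<close>

context symmetric_monoidal_closed
begin

text \<open>The counit exhibiting \<open>J\<close> as \<open>[J, \<one>]\<close> in \<open>T\<close>; for \<open>\<J>\<^sup>o\<^sup>p\<close> it is the transpose of \<open>J \<otimes> \<one> \<rightarrow> J\<close>.\<close>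
definition generic_op :: "('o, 'a) theory_rec \<Rightarrow> 'o \<Rightarrow> 'a" where
  "generic_op T J = FH (str T) J \<one> \<cdot> cur V J \<one> J (runit_ar V J)"

lemma arities_op_simps [simp]:
  "vOb (arities_op V \<J>) = \<J>" "vHom (arities_op V \<J>) J K = ihom V K J"
  by (simp_all add: arities_op_def vop_def)

lemma vCmp_arities_op:
  "vCmp (arities_op V \<J>) x y z = vCmp (self_enriched V) z y x \<cdot> sym_ar V (ihom V z y) (ihom V y x)"
  by (simp add: arities_op_def vop_def)

lemma vc_arities_op:
  assumes "x \<in> Ob V" "y \<in> Ob V" "z \<in> Ob V" "p \<in> Ar V" "q \<in> Ar V" "Cod V p = ihom V z y" "Cod V q = ihom V y x"
  shows "vc (arities_op V \<J>) x y z p q = vc (self_enriched V) z y x q p \<cdot> sym_ar V (Dom V p) (Dom V q)"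
  using assms by (simp add: vc_def vCmp_arities_op sym_natural)

text \<open>The transpose of the right unitor is the canonical isomorphism x \<cong> [\<one>, x];
  through it, composition with a generalized element of [x, y] becomes its evaluation.\<close>

lemma self_vc_name:
  assumes [simp]: "x \<in> Ob V" "y \<in> Ob V" "q \<in> Ar V" "Cod V q = ihom V x y"
  shows "vc (self_enriched V) \<one> x y q (cur V x \<one> x (runit_ar V x))
    = cur V y \<one> y (runit_ar V y) \<cdot> (ev_ar V x y \<cdot> (q \<odot> Ide V x))"
proof (rule uncur_inject[of \<one> y])
  have [simp]: "Dom V q \<in> Ob V" by simp
  have "ev_ar V \<one> y \<cdot> (vc (self_enriched V) \<one> x y q (cur V x \<one> x (runit_ar V x)) \<odot> Ide V \<one>)
    = ev_ar V x y \<cdot> ((q \<odot> runit_ar V x) \<cdot> assoc_ar V (Dom V q) x \<one>)"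
    by (simp add: ev_vc)
  also have "\<dots> = ev_ar V x y \<cdot> ((q \<odot> Ide V x) \<cdot> ((Ide V (Dom V q) \<odot> runit_ar V x) \<cdot> assoc_ar V (Dom V q) x \<one>))"
    by (simp add: interchange_assoc)
  also have "\<dots> = (ev_ar V x y \<cdot> (q \<odot> Ide V x)) \<cdot> runit_ar V (Dom V q \<otimes> x)"
    by (subst runit_tensor) auto
  also have "\<dots> = runit_ar V y \<cdot> ((ev_ar V x y \<cdot> (q \<odot> Ide V x)) \<odot> Ide V \<one>)"
    by (subst runit_natural) auto
  also have "\<dots> = ev_ar V \<one> y \<cdot> ((cur V y \<one> y (runit_ar V y) \<cdot> (ev_ar V x y \<cdot> (q \<odot> Ide V x))) \<odot> Ide V \<one>)"
    using interchange[of "ev_ar V x y \<cdot> (q \<odot> Ide V x)" "cur V y \<one> y (runit_ar V y)" "Ide V \<one>" "Ide V \<one>", symmetric]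
    by simp
  finally show "ev_ar V \<one> y \<cdot> (vc (self_enriched V) \<one> x y q (cur V x \<one> x (runit_ar V x)) \<odot> Ide V \<one>)
    = ev_ar V \<one> y \<cdot> ((cur V y \<one> y (runit_ar V y) \<cdot> (ev_ar V x y \<cdot> (q \<odot> Ide V x))) \<odot> Ide V \<one>)" .
qed auto

text \<open>The inverse is evaluation at the unit.\<close>

lemma name_iso:
  assumes [simp]: "y \<in> Ob V"
  shows "is_iso V (cur V y \<one> y (runit_ar V y))"
proof (rule is_isoI[of _ "ev_ar V \<one> y \<cdot> inv_ar V (runit_ar V (ihom V \<one> y))"])
  let ?e = "cur V y \<one> y (runit_ar V y)" and ?d = "ev_ar V \<one> y \<cdot> inv_ar V (runit_ar V (ihom V \<one> y))"
  show "?d \<cdot> ?e = Ide V (Dom V ?e)"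
  proof (rule iso_epi[of "runit_ar V y"])
    have "inv_ar V (runit_ar V (ihom V \<one> y)) \<cdot> (?e \<cdot> runit_ar V y) = ?e \<odot> Ide V \<one>"
      using runit_natural[of ?e "ihom V \<one> y", symmetric] by simp
    then show "(?d \<cdot> ?e) \<cdot> runit_ar V y = Ide V (Dom V ?e) \<cdot> runit_ar V y" by simp
  qed auto
  show "?e \<cdot> ?d = Ide V (Cod V ?e)"
  proof (rule uncur_inject[of \<one> y])
    have "ev_ar V \<one> y \<cdot> ((?e \<cdot> ?d) \<odot> Ide V \<one>) = ev_ar V \<one> y \<cdot> ((?e \<odot> Ide V \<one>) \<cdot> (?d \<odot> Ide V \<one>))"
      by (subst interchange) auto
    also have "\<dots> = ?d \<cdot> runit_ar V (ihom V \<one> y)"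
      using runit_natural[of ?d y] by simp
    also have "\<dots> = ev_ar V \<one> y" by simp
    finally show "ev_ar V \<one> y \<cdot> ((?e \<cdot> ?d) \<odot> Ide V \<one>) = ev_ar V \<one> y \<cdot> (Ide V (Cod V ?e) \<odot> Ide V \<one>)" by simp
  qed auto
qed auto

text \<open>A morphism y \<rightarrow> J of the opposite category is an element of [J, y]. By
  \<open>self_vc_name\<close>, composing it with the counit is evaluating it, up to the isomorphism
  y \<cong> [\<one>, y]; so the universal property is closedness of the base.\<close>

lemma name_universal_counit:
  assumes \<J>: "\<J> \<subseteq> Ob V" "\<one> \<in> \<J>" "J \<in> \<J>"
  shows "universal_counit (arities_op V \<J>) J \<one> J (cur V J \<one> J (runit_ar V J))"
proof -
  have [simp]: "J \<in> Ob V" using \<J> by auto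
  let ?e = "\<lambda>y. cur V y \<one> y (runit_ar V y)"
  have "\<exists>!t. t \<in> ahom V E (ihom V J y) \<and> vc (arities_op V \<J>) y J \<one> (?e J) t = s"
    if y: "y \<in> \<J>" and [simp]: "E \<in> Ob V" and "s \<in> ahom V (J \<otimes> E) (ihom V \<one> y)" for y E s
  proof -
    have [simp]: "y \<in> Ob V" using y \<J> by auto
    have [simp]: "s \<in> Ar V" "Dom V s = J \<otimes> E" "Cod V s = ihom V \<one> y" using that by (auto simp: ahom_iff)
    have [simp]: "is_iso V (?e y)" by (rule name_iso) simp
    have eq: "vc (arities_op V \<J>) y J \<one> (?e J) t = s \<longleftrightarrow>
        ev_ar V J y \<cdot> (t \<odot> Ide V J) = inv_ar V (?e y) \<cdot> (s \<cdot> sym_ar V E J)"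
      if [simp]: "t \<in> Ar V" "Dom V t = E" "Cod V t = ihom V J y" for t
    proof -
      have "vc (arities_op V \<J>) y J \<one> (?e J) t = ?e y \<cdot> ((ev_ar V J y \<cdot> (t \<odot> Ide V J)) \<cdot> sym_ar V J E)"
        by (simp add: vc_arities_op self_vc_name)
      moreover have *: "?e y \<cdot> (w \<cdot> sym_ar V J E) = s \<longleftrightarrow> w = inv_ar V (?e y) \<cdot> (s \<cdot> sym_ar V E J)"
        if [simp]: "w \<in> Ar V" "Dom V w = E \<otimes> J" "Cod V w = y" for w
      proof
        assume "?e y \<cdot> (w \<cdot> sym_ar V J E) = s"
        then have "inv_ar V (?e y) \<cdot> (s \<cdot> sym_ar V E J) = inv_ar V (?e y) \<cdot> ((?e y \<cdot> (w \<cdot> sym_ar V J E)) \<cdot> sym_ar V E J)" by simp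
        also have "\<dots> = w" by simp
        finally show "w = inv_ar V (?e y) \<cdot> (s \<cdot> sym_ar V E J)" ..
      qed simp
      ultimately show ?thesis by (subst *[symmetric]) auto
    qed
    let ?w = "inv_ar V (?e y) \<cdot> (s \<cdot> sym_ar V E J)"
    have "\<exists>!t. t \<in> ahom V E (ihom V J y) \<and> ev_ar V J y \<cdot> (t \<odot> Ide V J) = ?w"
      by (intro closed) (auto simp: ahom_iff)
    then show ?thesis using eq by (auto simp: ahom_iff)
  qed
  then show ?thesis using \<J> by (auto simp: universal_counit_def ahom_iff)
qed

lemma generic_op_in:
  assumes "enriched_functor V (arities_op V \<J>) U (str U)" "\<forall>J \<in> \<J>. FO (str U) J = J" "vcategory V U"
    "vOb U = \<J>" "\<one> \<in> \<J>" "\<J> \<subseteq> Ob V" "J \<in> \<J>"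
  shows "generic_op U J \<in> ahom V J (vHom U J \<one>)"
  using assms by (auto simp: enriched_functor_def generic_op_def ahom_iff)

text \<open>At the unit the transposed right unitor is the transposed left unitor, that is, the
  identity, and the structure functor preserves it.\<close>

lemma generic_op_unit:
  assumes "enriched_functor V (arities_op V \<J>) U (str U)" "\<forall>J \<in> \<J>. FO (str U) J = J" "\<one> \<in> \<J>"
  shows "generic_op U \<one> = vIde U \<one>"
  using assms by (auto simp: enriched_functor_def generic_op_def arities_op_def vop_def self_enriched_def lunit_eq_runit)

text \<open>The equation, here in \<open>U\<close>, by which \<open>commutant\<close> defines its
  own structure functor. It is \<open>self_vc_name\<close> transported along the structure functor
  of \<open>U\<close>.\<close>

lemma vc_generic_op:
  assumes F: "enriched_functor V (arities_op V \<J>) U (str U)" and FO: "\<forall>J \<in> \<J>. FO (str U) J = J"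
    and U: "vcategory V U" and \<J>: "vOb U = \<J>" "\<one> \<in> \<J>" "\<J> \<subseteq> Ob V" and [simp]: "J \<in> \<J>" "K \<in> \<J>"
  shows "vc U J K \<one> (generic_op U K) (FH (str U) J K)
    = generic_op U J \<cdot> (ev_ar V K J \<cdot> sym_ar V K (ihom V K J))"
proof -
  interpret U: vcategory V U by fact
  have [simp]: "J \<in> Ob V" "K \<in> Ob V"
    using \<open>J \<in> \<J>\<close> \<open>K \<in> \<J>\<close> \<J>(3) by blast+
  have S: "FH (str U) a b \<in> Ar V" "Dom V (FH (str U) a b) = ihom V b a" "Cod V (FH (str U) a b) = vHom U a b"
    if "a \<in> \<J>" "b \<in> \<J>" for a b
    using F FO that by (auto simp: enriched_functor_def ahom_iff)
  note [simp] = S \<J>(1,2)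
  let ?e = "\<lambda>y. cur V y \<one> y (runit_ar V y)"
  have "vc U J K \<one> (generic_op U K) (FH (str U) J K)
    = vCmp U J K \<one> \<cdot> (FH (str U) K \<one> \<odot> FH (str U) J K) \<cdot> (?e K \<odot> Ide V (ihom V K J))"
    by (simp add: vc_def generic_op_def interchange)
  also have "vCmp U J K \<one> \<cdot> (FH (str U) K \<one> \<odot> FH (str U) J K) = FH (str U) J \<one> \<cdot> vCmp (arities_op V \<J>) J K \<one>"
    using F FO by (simp add: enriched_functor_def)
  also have "(FH (str U) J \<one> \<cdot> vCmp (arities_op V \<J>) J K \<one>) \<cdot> (?e K \<odot> Ide V (ihom V K J))
    = FH (str U) J \<one> \<cdot> vc (arities_op V \<J>) J K \<one> (?e K) (Ide V (ihom V K J))"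
    by (simp add: vc_def vCmp_arities_op)
  also have "\<dots> = generic_op U J \<cdot> (ev_ar V K J \<cdot> sym_ar V K (ihom V K J))"
    by (simp add: vc_arities_op self_vc_name generic_op_def)
  finally show ?thesis .
qed

section \<open>Restricting, composing and lifting natural families\<close>

lemma natural_family_Cmp:
  assumes "vcategory V X" "vcategory V T" and D: "prefunctor T X D" and D': "prefunctor T X D'"
    and p: "natural_family V T X D D' E p" and [simp]: "h \<in> Ar V" "Cod V h = E"
  shows "natural_family V T X D D' (Dom V h) (\<lambda>K. p K \<cdot> h)"
  unfolding natural_family_iff
proof (intro conjI ballI)
  interpret X: vcategory V X by fact
  interpret T: vcategory V T by fact
  note [simp] = prefunctorD[OF D] prefunctorD[OF D'] natural_familyD(1-4)[OF p]
  show "Dom V h \<in> Ob V" by simp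
  fix K assume [simp]: "K \<in> vOb T"
  show "p K \<cdot> h \<in> ahom V (Dom V h) (vHom X (FO D K) (FO D' K))" by (simp add: ahom_iff)
  fix L assume [simp]: "L \<in> vOb T"
  show "vc X (FO D K) (FO D L) (FO D' L) (p L \<cdot> h) (FH D K L)
    = vc X (FO D K) (FO D' K) (FO D' L) (FH D' K L) (p K \<cdot> h) \<cdot> sym_ar V (Dom V h) (vHom T K L)"
    by (simp add: X.vc_Cmp_left X.vc_Cmp_right natural_familyD(5)[OF p] sym_natural)
qed

end

context vcategory
begin

lemma natural_family_vIde:
  assumes "vcategory V T" and D: "prefunctor T X D"
  shows "natural_family V T X D D \<one> (\<lambda>K. vIde X (FO D K))"
proof -
  interpret T: vcategory V T by fact
  note [simp] = prefunctorD[OF D]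
  show ?thesis unfolding natural_family_iff
    by (auto simp: ahom_iff vc_vIde_left vc_vIde_right runit_sym)
qed

text \<open>T(K, L) is moved past F by naturality of \<open>q\<close> and then past E by naturality
  of \<open>p\<close>; \<open>hexagon_inv\<close> fuses the two symmetries into the one for E
  \<otimes> F.\<close>

lemma natural_family_vc:
  assumes "vcategory V T" and D: "prefunctor T X D" and D': "prefunctor T X D'" and D'': "prefunctor T X D''"
    and p: "natural_family V T X D' D'' E p" and q: "natural_family V T X D D' F q"
  shows "natural_family V T X D D'' (E \<otimes> F) (\<lambda>K. vc X (FO D K) (FO D' K) (FO D'' K) (p K) (q K))"
  unfolding natural_family_iff
proof (intro conjI ballI)
  interpret T: vcategory V T by fact
  note [simp] = prefunctorD[OF D] prefunctorD[OF D'] prefunctorD[OF D''] natural_familyD(1-4)[OF p] natural_familyD(1-4)[OF q]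
  show "E \<otimes> F \<in> Ob V" by simp
  fix K assume [simp]: "K \<in> vOb T"
  show "vc X (FO D K) (FO D' K) (FO D'' K) (p K) (q K) \<in> ahom V (E \<otimes> F) (vHom X (FO D K) (FO D'' K))"
    by (simp add: ahom_iff)
  fix L assume [simp]: "L \<in> vOb T"
  let ?T = "vHom T K L"
  have "vc X (FO D K) (FO D L) (FO D'' L) (vc X (FO D L) (FO D' L) (FO D'' L) (p L) (q L)) (FH D K L)
    = vc X (FO D K) (FO D' L) (FO D'' L) (p L) (vc X (FO D K) (FO D L) (FO D' L) (q L) (FH D K L)) \<cdot> assoc_ar V E F ?T"
    by (simp add: vc_assoc)
  also have "\<dots> = vc X (FO D K) (FO D' L) (FO D'' L) (p L) (vc X (FO D K) (FO D' K) (FO D' L) (FH D' K L) (q K))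
      \<cdot> ((Ide V E \<odot> sym_ar V F ?T) \<cdot> assoc_ar V E F ?T)"
    by (simp add: natural_familyD(5)[OF q] vc_Cmp_right)
  also have "\<dots> = vc X (FO D K) (FO D' K) (FO D'' L) (vc X (FO D' K) (FO D' L) (FO D'' L) (p L) (FH D' K L)) (q K)
      \<cdot> (inv_ar V (assoc_ar V E ?T F) \<cdot> ((Ide V E \<odot> sym_ar V F ?T) \<cdot> assoc_ar V E F ?T))"
    by (simp add: vc_assoc_inv del: inv_ar_cancel)
  also have "\<dots> = vc X (FO D K) (FO D' K) (FO D'' L) (vc X (FO D' K) (FO D'' K) (FO D'' L) (FH D'' K L) (p K)) (q K)
      \<cdot> ((sym_ar V E ?T \<odot> Ide V F) \<cdot> (inv_ar V (assoc_ar V E ?T F) \<cdot> ((Ide V E \<odot> sym_ar V F ?T) \<cdot> assoc_ar V E F ?T)))"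
    by (simp add: natural_familyD(5)[OF p] vc_Cmp_left)
  also have "\<dots> = vc X (FO D K) (FO D'' K) (FO D'' L) (FH D'' K L) (vc X (FO D K) (FO D' K) (FO D'' K) (p K) (q K))
      \<cdot> (assoc_ar V ?T E F \<cdot> ((sym_ar V E ?T \<odot> Ide V F) \<cdot> (inv_ar V (assoc_ar V E ?T F) \<cdot> ((Ide V E \<odot> sym_ar V F ?T) \<cdot> assoc_ar V E F ?T))))"
    by (simp add: vc_assoc)
  finally show "vc X (FO D K) (FO D L) (FO D'' L) (vc X (FO D L) (FO D' L) (FO D'' L) (p L) (q L)) (FH D K L)
    = vc X (FO D K) (FO D'' K) (FO D'' L) (FH D'' K L) (vc X (FO D K) (FO D' K) (FO D'' K) (p K) (q K)) \<cdot> sym_ar V (E \<otimes> F) ?T"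
    by (simp only: hexagon_inv T.vHom_simp natural_familyD(1)[OF p] natural_familyD(1)[OF q] \<open>K \<in> vOb T\<close> \<open>L \<in> vOb T\<close>)
qed

text \<open>The components exist by the pointwise universal property, and their naturality is tested
  against the counits. This makes [J, A] a cotensor among functors, before any end is
  formed.\<close>

lemma pointwise_cotensor_lift:
  assumes "vcategory V T" and A: "prefunctor T X A" and D: "prefunctor T X D"
    and C: "pointwise_cotensor T X J A C k"
    and s: "natural_family V T X D A (J \<otimes> E) s" and [simp]: "E \<in> Ob V"
  obtains t where "natural_family V T X D C E t"
    "\<And>L. L \<in> vOb T \<Longrightarrow> vc X (FO D L) (FO C L) (FO A L) (k L) (t L) = s L"
proof -
  interpret T: vcategory V T by fact
  have k: "natural_family V T X C A J k" and pC: "prefunctor T X C" 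
    and uc: "\<And>L. L \<in> vOb T \<Longrightarrow> universal_counit X J (FO A L) (FO C L) (k L)"
    using C by (auto simp: pointwise_cotensor_def)
  note [simp] = prefunctorD[OF A] prefunctorD[OF D] prefunctorD[OF pC] natural_familyD(1-4)[OF k] natural_familyD(2-4)[OF s]
  have "\<exists>t. t \<in> Ar V \<and> Dom V t = E \<and> Cod V t = vHom X (FO D L) (FO C L) \<and>
      vc X (FO D L) (FO C L) (FO A L) (k L) t = s L" if "L \<in> vOb T" for L
  proof -
    have "FO D L \<in> vOb X" "s L \<in> Ar V" "Dom V (s L) = J \<otimes> E" "Cod V (s L) = vHom X (FO D L) (FO A L)"
      using that by auto
    then show ?thesis using universal_counit_lift[OF uc[OF that], of "FO D L" E "s L"] by simp metis
  qed
  then obtain t where t: "\<And>L. L \<in> vOb T \<Longrightarrow> t L \<in> Ar V \<and> Dom V (t L) = E \<and> Cod V (t L) = vHom X (FO D L) (FO C L) \<and>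
      vc X (FO D L) (FO C L) (FO A L) (k L) (t L) = s L" by metis
  then have [simp]: "t L \<in> Ar V" "Dom V (t L) = E" "Cod V (t L) = vHom X (FO D L) (FO C L)" 
      "vc X (FO D L) (FO C L) (FO A L) (k L) (t L) = s L" if "L \<in> vOb T" for L
    using that by auto
  have "natural_family V T X D C E t"
    unfolding natural_family_iff
  proof (intro conjI ballI)
    show "E \<in> Ob V" by simp
    fix K assume [simp]: "K \<in> vOb T"
    show "t K \<in> ahom V E (vHom X (FO D K) (FO C K))" by (simp add: ahom_iff)
    fix L assume [simp]: "L \<in> vOb T"
    let ?T = "vHom T K L"
    show "vc X (FO D K) (FO D L) (FO C L) (t L) (FH D K L)
      = vc X (FO D K) (FO C K) (FO C L) (FH C K L) (t K) \<cdot> sym_ar V E ?T"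
    proof (rule universal_counit_eqI[OF uc])
      \<comment> \<open>The left-hand side of \<open>hexagon_inv\<close>: it splits the symmetry for
        J \<otimes> E and T(K, L), so that J and E can be moved past T(K, L) one at a time.\<close>
      let ?h = "assoc_ar V ?T J E \<cdot> ((sym_ar V J ?T \<odot> Ide V E) \<cdot>
        (inv_ar V (assoc_ar V J ?T E) \<cdot> ((Ide V J \<odot> sym_ar V E ?T) \<cdot> assoc_ar V J E ?T)))"
      have "vc X (FO D K) (FO C L) (FO A L) (k L) (vc X (FO D K) (FO D L) (FO C L) (t L) (FH D K L))
        = vc X (FO D K) (FO D L) (FO A L) (s L) (FH D K L) \<cdot> inv_ar V (assoc_ar V J E ?T)"
        by (simp add: vc_assoc_inv)
      also have "\<dots> = vc X (FO D K) (FO A K) (FO A L) (FH A K L) (s K) \<cdot> (sym_ar V (J \<otimes> E) ?T \<cdot> inv_ar V (assoc_ar V J E ?T))"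
        by (simp add: natural_familyD(5)[OF s])
      also have "\<dots> = vc X (FO D K) (FO A K) (FO A L) (FH A K L) (vc X (FO D K) (FO C K) (FO A K) (k K) (t K))
         \<cdot> (?h \<cdot> inv_ar V (assoc_ar V J E ?T))"
        by (subst hexagon_inv) auto
      also have "\<dots> = vc X (FO D K) (FO C K) (FO A L) (vc X (FO C K) (FO A K) (FO A L) (FH A K L) (k K)) (t K)
         \<cdot> ((sym_ar V J ?T \<odot> Ide V E) \<cdot> (inv_ar V (assoc_ar V J ?T E) \<cdot> (Ide V J \<odot> sym_ar V E ?T)))"
        by (simp add: vc_assoc del: \<open>\<And>L. L \<in> vOb T \<Longrightarrow> vc X (FO D L) (FO C L) (FO A L) (k L) (t L) = s L\<close>)
      also have "\<dots> = vc X (FO D K) (FO C K) (FO A L) (vc X (FO C K) (FO C L) (FO A L) (k L) (FH C K L)) (t K)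
         \<cdot> (inv_ar V (assoc_ar V J ?T E) \<cdot> (Ide V J \<odot> sym_ar V E ?T))"
        by (simp add: natural_familyD(5)[OF k] vc_Cmp_left)
      also have "\<dots> = vc X (FO D K) (FO C L) (FO A L) (k L) (vc X (FO D K) (FO C K) (FO C L) (FH C K L) (t K)) \<cdot> (Ide V J \<odot> sym_ar V E ?T)"
        by (simp add: vc_assoc_inv)
      also have "\<dots> = vc X (FO D K) (FO C L) (FO A L) (k L) (vc X (FO D K) (FO C K) (FO C L) (FH C K L) (t K) \<cdot> sym_ar V E ?T)"
        by (simp add: vc_Cmp_right)
      finally show "vc X (FO D K) (FO C L) (FO A L) (k L) (vc X (FO D K) (FO D L) (FO C L) (t L) (FH D K L))
        = vc X (FO D K) (FO C L) (FO A L) (k L) (vc X (FO D K) (FO C K) (FO C L) (FH C K L) (t K) \<cdot> sym_ar V E ?T)" .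
    qed auto
  qed
  with t show thesis using that by blast
qed

text \<open>A natural family into \<open>[J, A]\<close> is determined by its component at the unit, because
  \<open>[J, A L]\<close> embeds into \<open>[L, [J, A \<one>]]\<close>.\<close>
lemma natural_family_eqI:
  assumes "vcategory V T" and A: "prefunctor T X A" and D: "prefunctor T X D"
    and C: "pointwise_cotensor T X J A C k"
    and p: "natural_family V T X D C E p" and p': "natural_family V T X D C E p'" and pp': "p \<one> = p' \<one>"
    and g: "g \<in> ahom V L (vHom T L \<one>)" "universal_counit X L (FO A \<one>) (FO A L) (FH A L \<one> \<cdot> g)"
    and [simp]: "\<one> \<in> vOb T" "L \<in> vOb T"
  shows "p L = p' L"
proof -
  interpret T: vcategory V T by fact
  have k: "natural_family V T X C A J k" and pC: "prefunctor T X C" 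
    and uc: "universal_counit X J (FO A L) (FO C L) (k L)"
    using C by (auto simp: pointwise_cotensor_def)
  note [simp] = prefunctorD[OF A] prefunctorD[OF D] prefunctorD[OF pC] natural_familyD(1-4)[OF k]
    natural_familyD(1-4)[OF p] natural_familyD(1-4)[OF p']
  have [simp]: "g \<in> Ar V" "Dom V g = L" "Cod V g = vHom T L \<one>" "L \<in> Ob V"
    using g(1) Dom_Ob[of g] by (auto simp: ahom_iff)
  define a where "a = FH A L \<one> \<cdot> g"
  have [simp]: "a \<in> Ar V" "Dom V a = L" "Cod V a = vHom X (FO A L) (FO A \<one>)" by (auto simp: a_def)
  let ?d = "FH C L \<one> \<cdot> g"
  \<comment> \<open>Naturality of the counit of [J, A] along the generic operation
    \<open>g\<close>.\<close>
  have d: "vc X (FO C L) (FO C \<one>) (FO A \<one>) (k \<one>) ?d = vc X (FO C L) (FO A L) (FO A \<one>) a (k L) \<cdot> sym_ar V J L"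
    using natural_familyD(5)[OF k, of L \<one>] by (simp add: vc_Cmp_right vc_Cmp_left sym_natural a_def)
  \<comment> \<open>The same composite is computed in two ways. By naturality of \<open>r\<close>,
    here, it depends only on the component of \<open>r\<close> at the unit.\<close>
  have *: "vc X (FO D L) (FO C L) (FO A \<one>) (vc X (FO C L) (FO C \<one>) (FO A \<one>) (k \<one>) ?d) (r L)
      = vc X (FO D L) (FO C \<one>) (FO A \<one>) (k \<one>) (vc X (FO D L) (FO D \<one>) (FO C \<one>) (r \<one>) (FH D L \<one>))
        \<cdot> ((Ide V J \<odot> (sym_ar V (vHom T L \<one>) E \<cdot> (g \<odot> Ide V E))) \<cdot> assoc_ar V J L E)"
    if r: "natural_family V T X D C E r" for r
  proof -
    note [simp] = natural_familyD(1-4)[OF r]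
    have "vc X (FO D L) (FO C L) (FO C \<one>) (FH C L \<one>) (r L)
      = vc X (FO D L) (FO D \<one>) (FO C \<one>) (r \<one>) (FH D L \<one>) \<cdot> sym_ar V (vHom T L \<one>) E"
      using natural_familyD(5)[OF r, of L \<one>] by simp
    then have "vc X (FO D L) (FO C L) (FO C \<one>) ?d (r L)
      = vc X (FO D L) (FO D \<one>) (FO C \<one>) (r \<one>) (FH D L \<one>) \<cdot> (sym_ar V (vHom T L \<one>) E \<cdot> (g \<odot> Ide V E))"
      by (simp add: vc_Cmp_left)
    moreover have "vc X (FO D L) (FO C L) (FO A \<one>) (vc X (FO C L) (FO C \<one>) (FO A \<one>) (k \<one>) ?d) (r L)
      = vc X (FO D L) (FO C \<one>) (FO A \<one>) (k \<one>) (vc X (FO D L) (FO C L) (FO C \<one>) ?d (r L)) \<cdot> assoc_ar V J L E"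
      by (simp add: vc_assoc)
    ultimately show ?thesis by (simp add: vc_Cmp_right[of "FO D L" "FO C \<one>"])
  qed
  \<comment> \<open>By naturality of the counit it contains \<open>r L\<close> behind the universal
    counits \<open>a\<close> and \<open>k L\<close>, which can both be cancelled.\<close>
  have **: "vc X (FO D L) (FO C L) (FO A \<one>) (vc X (FO C L) (FO C \<one>) (FO A \<one>) (k \<one>) ?d) r
      = vc X (FO D L) (FO A L) (FO A \<one>) a (vc X (FO D L) (FO C L) (FO A L) (k L) r) \<cdot>
         (assoc_ar V L J E \<cdot> (sym_ar V J L \<odot> Ide V E))"
    if [simp]: "r \<in> Ar V" "Dom V r = E" "Cod V r = vHom X (FO D L) (FO C L)" for r
    by (simp add: d vc_Cmp_left vc_assoc)
  have "vc X (FO D L) (FO C L) (FO A L) (k L) (p L) = vc X (FO D L) (FO C L) (FO A L) (k L) (p' L)"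
  proof (rule universal_counit_eqI[OF g(2)[folded a_def]])
    show "vc X (FO D L) (FO A L) (FO A \<one>) a (vc X (FO D L) (FO C L) (FO A L) (k L) (p L))
      = vc X (FO D L) (FO A L) (FO A \<one>) a (vc X (FO D L) (FO C L) (FO A L) (k L) (p' L))"
    proof (rule iso_epi[of "assoc_ar V L J E \<cdot> (sym_ar V J L \<odot> Ide V E)"])
      show "vc X (FO D L) (FO A L) (FO A \<one>) a (vc X (FO D L) (FO C L) (FO A L) (k L) (p L)) \<cdot> (assoc_ar V L J E \<cdot> (sym_ar V J L \<odot> Ide V E))
        = vc X (FO D L) (FO A L) (FO A \<one>) a (vc X (FO D L) (FO C L) (FO A L) (k L) (p' L)) \<cdot> (assoc_ar V L J E \<cdot> (sym_ar V J L \<odot> Ide V E))"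
        by (subst (1 2) **[symmetric]) (simp_all only: *[OF p] *[OF p'] pp' natural_familyD[OF p] natural_familyD[OF p'] \<open>L \<in> vOb T\<close>)
    qed (auto intro!: is_iso_Cmp is_iso_tensor)
  qed auto
  then show ?thesis by - (rule universal_counit_eqI[OF uc], auto)
qed

end

section \<open>Categories of algebras\<close>

text \<open>The parameter \<open>V0\<close> only influences which ends are chosen.\<close>
locale algebra_pair_over = vcategory V X + T: vcategory V T + U: vcategory V U
  for V :: "('o, 'a) smc" (structure) and X :: "('c, 'o, 'a) cvcat"
    and T U :: "('o, 'a) theory_rec" +
  fixes V0 :: "('o, 'a) smc" and \<J> :: "'o set" and A B :: "('o, 'c, 'a) vfun"
  assumes arity_set: "\<J> \<subseteq> Ob V" "\<one> \<in> \<J>"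
    and theory_Ob [simp]: "vOb T = \<J>" "vOb U = \<J>"
    and str_U: "enriched_functor V (arities_op V \<J>) U (str U)" "\<forall>J \<in> \<J>. FO (str U) J = J"
    and A: "enriched_functor V T X A" and B: "enriched_functor V U X B"
    and carrier: "FO A \<one> = FO B \<one>"
    and generic_T: "\<And>L. L \<in> \<J> \<Longrightarrow> generic_op T L \<in> ahom V L (vHom T L \<one>)"
    and A_counit: "\<And>L. L \<in> \<J> \<Longrightarrow> universal_counit X L (FO A \<one>) (FO A L) (FH A L \<one> \<cdot> generic_op T L)"
    and B_counit: "\<And>L. L \<in> \<J> \<Longrightarrow> universal_counit X L (FO B \<one>) (FO B L) (FH B L \<one> \<cdot> generic_op U L)"
    and cotn_counit: "\<And>J x. J \<in> \<J> \<Longrightarrow> x \<in> vOb X \<Longrightarrow> universal_counit X J x (cotn X J x) (coun X J x)"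
    and cotn_unit: "\<And>x. x \<in> vOb X \<Longrightarrow> cotn X \<one> x = x" "\<And>x. x \<in> vOb X \<Longrightarrow> coun X \<one> x = vIde X x"
    and ends: "\<And>D D'. prefunctor T X D \<Longrightarrow> prefunctor T X D' \<Longrightarrow> \<exists>e p. is_hom_end V T X D D' e p"
begin

section \<open>The cotensors [J, A] and the hom-objects of algebras\<close>

abbreviation P :: "'o \<Rightarrow> ('o, 'c, 'a) vfun" where "P J \<equiv> alg_cotn V X J A"
abbreviation E :: "('o, 'c, 'a) vfun \<Rightarrow> ('o, 'c, 'a) vfun \<Rightarrow> 'o" where "E \<equiv> end_ob V0 V T X"
abbreviation \<pi> :: "('o, 'c, 'a) vfun \<Rightarrow> ('o, 'c, 'a) vfun \<Rightarrow> 'o \<Rightarrow> 'a" where "\<pi> \<equiv> end_proj V0 V T X"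
abbreviation k :: "'o \<Rightarrow> 'o \<Rightarrow> 'a" where "k J L \<equiv> coun X J (FO A L)"
abbreviation comm :: "('o, 'a) theory_rec" where "comm \<equiv> commutant V0 V \<J> T X A"

lemma arity_Ob [simp]: "J \<in> \<J> \<Longrightarrow> J \<in> Ob V" "\<one> \<in> \<J>"
  using arity_set by auto

lemma prefunctor_A: "prefunctor T X A" and prefunctor_B: "prefunctor U X B"
  using A B by (auto intro: enriched_functor_prefunctor)

lemma A_simps [simp]:
  "K \<in> \<J> \<Longrightarrow> FO A K \<in> vOb X" "K \<in> \<J> \<Longrightarrow> L \<in> \<J> \<Longrightarrow> FH A K L \<in> Ar V"
  "K \<in> \<J> \<Longrightarrow> L \<in> \<J> \<Longrightarrow> Dom V (FH A K L) = vHom T K L"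
  "K \<in> \<J> \<Longrightarrow> L \<in> \<J> \<Longrightarrow> Cod V (FH A K L) = vHom X (FO A K) (FO A L)"
  using prefunctorD[OF prefunctor_A] by auto

lemma B_simps [simp]:
  "K \<in> \<J> \<Longrightarrow> FO B K \<in> vOb X" "K \<in> \<J> \<Longrightarrow> L \<in> \<J> \<Longrightarrow> FH B K L \<in> Ar V"
  "K \<in> \<J> \<Longrightarrow> L \<in> \<J> \<Longrightarrow> Dom V (FH B K L) = vHom U K L"
  "K \<in> \<J> \<Longrightarrow> L \<in> \<J> \<Longrightarrow> Cod V (FH B K L) = vHom X (FO B K) (FO B L)"
  using prefunctorD[OF prefunctor_B] by auto

lemma B_vIde: "K \<in> \<J> \<Longrightarrow> FH B K K \<cdot> vIde U K = vIde X (FO B K)"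
  using B by (auto simp: enriched_functor_def)

lemma B_vc:
  assumes "x \<in> \<J>" "y \<in> \<J>" "z \<in> \<J>" "p \<in> Ar V" "q \<in> Ar V"
    "Cod V p = vHom U y z" "Cod V q = vHom U x y"
  shows "FH B x z \<cdot> vc U x y z p q = vc X (FO B x) (FO B y) (FO B z) (FH B y z \<cdot> p) (FH B x y \<cdot> q)"
proof -
  interpret B: vfunctor V U X B using B by unfold_locales
  show ?thesis using assms by (simp add: B.H_vc)
qed

lemma generic_U_simps [simp]:
  assumes "J \<in> \<J>"
  shows "generic_op U J \<in> Ar V" "Dom V (generic_op U J) = J" "Cod V (generic_op U J) = vHom U J \<one>"
  using generic_op_in[OF str_U U.vcategory_axioms _ _ arity_set(1) assms] by (auto simp: ahom_iff)

lemma str_U_simps [simp]: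
  assumes "J \<in> \<J>" "K \<in> \<J>"
  shows "FH (str U) J K \<in> Ar V" "Dom V (FH (str U) J K) = ihom V K J" "Cod V (FH (str U) J K) = vHom U J K"
  using str_U assms by (auto simp: enriched_functor_def ahom_iff)

lemma k_simps [simp]:
  assumes "J \<in> \<J>" "L \<in> \<J>"
  shows "k J L \<in> Ar V" "Dom V (k J L) = J" "Cod V (k J L) = vHom X (cotn X J (FO A L)) (FO A L)"
    "cotn X J (FO A L) \<in> vOb X"
  using universal_counitD[OF cotn_counit[of J "FO A L"]] assms by auto

lemma FO_P [simp]: "L \<in> \<J> \<Longrightarrow> FO (P J) L = cotn X J (FO A L)"
  by (auto simp: alg_cotn_def cotn_unit)

lemma P_unit [simp]: "P \<one> = A"
  by (simp add: alg_cotn_def)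

lemma cotn_map:
  assumes [simp]: "J \<in> \<J>" and x: "x \<in> vOb X" and y: "y \<in> vOb X"
  shows "cotn_map V X J x y \<in> ahom V (vHom X x y) (vHom X (cotn X J x) (cotn X J y))"
    "vc X (cotn X J x) (cotn X J y) y (coun X J y) (cotn_map V X J x y)
     = vc X (cotn X J x) x y (Ide V (vHom X x y)) (coun X J x) \<cdot> sym_ar V J (vHom X x y)"
proof -
  let ?s = "vc X (cotn X J x) x y (Ide V (vHom X x y)) (coun X J x) \<cdot> sym_ar V J (vHom X x y)"
  note [simp] = x y universal_counitD[OF cotn_counit[OF assms(1) x]] universal_counitD[OF cotn_counit[OF assms(1) y]]
  have "?s \<in> ahom V (J \<otimes> vHom X x y) (vHom X (cotn X J x) y)" by (auto simp: ahom_iff)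
  then have "\<exists>!t. t \<in> ahom V (vHom X x y) (vHom X (cotn X J x) (cotn X J y)) \<and>
      vc X (cotn X J x) (cotn X J y) y (coun X J y) t = ?s"
    using cotn_counit[OF assms(1) y] by (simp add: universal_counit_def)
  from theI'[OF this]
  show "cotn_map V X J x y \<in> ahom V (vHom X x y) (vHom X (cotn X J x) (cotn X J y))"
    "vc X (cotn X J x) (cotn X J y) y (coun X J y) (cotn_map V X J x y) = ?s"
    by (simp_all add: cotn_map_def vc_def)
qed

lemma pointwise_cotensor_P:
  assumes [simp]: "J \<in> \<J>"
  shows "pointwise_cotensor T X J A (P J) (k J)"
\<comment> \<open>For the unit, [\<one>, A] is \<open>A\<close> with identities as counits, and the
  claim is the unit laws. For other arities naturality comes from the equation defining
  \<open>cotn_map\<close>.\<close>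
proof (cases "J = \<one>")
  case True
  show ?thesis unfolding pointwise_cotensor_def True
    using prefunctor_A cotn_counit[of \<one>]
    by (auto simp: natural_family_iff ahom_iff cotn_unit vc_vIde_left vc_vIde_right runit_sym)
next
  case False
  have [simp]: "cotn_map V X J x y \<in> Ar V" "Dom V (cotn_map V X J x y) = vHom X x y"
    "Cod V (cotn_map V X J x y) = vHom X (cotn X J x) (cotn X J y)" if "x \<in> vOb X" "y \<in> vOb X" for x y
    using cotn_map(1)[OF assms that] by (auto simp: ahom_iff)
  have FH: "FH (P J) K L = cotn_map V X J (FO A K) (FO A L) \<cdot> FH A K L" for K L
    using False by (simp add: alg_cotn_def)
  have "vc X (cotn X J (FO A K)) (cotn X J (FO A L)) (FO A L) (k J L) (FH (P J) K L)
    = vc X (cotn X J (FO A K)) (FO A K) (FO A L) (FH A K L) (k J K) \<cdot> sym_ar V J (vHom T K L)"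
    if [simp]: "K \<in> \<J>" "L \<in> \<J>" for K L
  proof -
    have "vc X (cotn X J (FO A K)) (cotn X J (FO A L)) (FO A L) (k J L) (FH (P J) K L)
      = vc X (cotn X J (FO A K)) (FO A K) (FO A L) (Ide V (vHom X (FO A K) (FO A L))) (k J K)
         \<cdot> (sym_ar V J (vHom X (FO A K) (FO A L)) \<cdot> (Ide V J \<odot> FH A K L))"
      by (simp add: FH vc_Cmp_right cotn_map(2))
    also have "\<dots> = (vc X (cotn X J (FO A K)) (FO A K) (FO A L) (Ide V (vHom X (FO A K) (FO A L))) (k J K)
         \<cdot> (FH A K L \<odot> Ide V J)) \<cdot> sym_ar V J (vHom T K L)"
      by (subst sym_natural) auto
    also have "\<dots> = vc X (cotn X J (FO A K)) (FO A K) (FO A L) (FH A K L) (k J K) \<cdot> sym_ar V J (vHom T K L)"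
      using vc_Cmp_left[of "cotn X J (FO A K)" "FO A K" "FO A L" "Ide V (vHom X (FO A K) (FO A L))" "k J K" "FH A K L"]
      by simp
    finally show ?thesis .
  qed
  then show ?thesis unfolding pointwise_cotensor_def
    by (auto simp: natural_family_iff ahom_iff cotn_counit prefunctor_def) (auto simp: FH)
qed

lemma prefunctor_P: "J \<in> \<J> \<Longrightarrow> prefunctor T X (P J)"
  using pointwise_cotensor_P by (simp add: pointwise_cotensor_def)

lemma natural_family_k: "J \<in> \<J> \<Longrightarrow> natural_family V T X (P J) A J (k J)"
  using pointwise_cotensor_P by (simp add: pointwise_cotensor_def)

lemma P_simps [simp]:
  assumes "J \<in> \<J>" "K \<in> \<J>" "L \<in> \<J>"
  shows "FH (P J) K L \<in> Ar V" "Dom V (FH (P J) K L) = vHom T K L"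
    "Cod V (FH (P J) K L) = vHom X (cotn X J (FO A K)) (cotn X J (FO A L))"
  using prefunctorD[OF prefunctor_P[OF assms(1)]] assms by auto

text \<open>The predicate behind the choice can be met as soon as some end exists in
  \<open>V\<close>: an end in \<open>V0\<close> is taken if there is one, and any end
  otherwise.\<close>

lemma hom_end:
  assumes "prefunctor T X D" "prefunctor T X D'"
  shows "is_hom_end V T X D D' (E D D') (\<pi> D D')"
proof -
  have "\<exists>ep. case ep of (e, p) \<Rightarrow> is_hom_end V T X D D' e p \<and>
        ((\<exists>e' \<in> Ob V0. \<exists>p'. is_hom_end V T X D D' e' p') \<longrightarrow> e \<in> Ob V0)"
    using ends[OF assms] by auto
  from someI_ex[OF this] show ?thesis
    unfolding end_ob_def end_proj_def hom_end_def by (auto split: prod.splits)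
qed

lemma natural_family_\<pi>: "prefunctor T X D \<Longrightarrow> prefunctor T X D' \<Longrightarrow> natural_family V T X D D' (E D D') (\<pi> D D')"
  using hom_end by (auto simp: is_hom_end_def)

lemma \<pi>_simps [simp]:
  assumes "prefunctor T X D" "prefunctor T X D'"
  shows "E D D' \<in> Ob V" "K \<in> \<J> \<Longrightarrow> \<pi> D D' K \<in> Ar V" "K \<in> \<J> \<Longrightarrow> Dom V (\<pi> D D' K) = E D D'"
    "K \<in> \<J> \<Longrightarrow> Cod V (\<pi> D D' K) = vHom X (FO D K) (FO D' K)"
  using natural_familyD[OF natural_family_\<pi>[OF assms]] by auto

lemma end_tuple:
  assumes "prefunctor T X D" "prefunctor T X D'" "natural_family V T X D D' Q q"
  shows "end_tuple V0 V T X D D' Q q \<in> Ar V" "Dom V (end_tuple V0 V T X D D' Q q) = Q"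
    "Cod V (end_tuple V0 V T X D D' Q q) = E D D'"
    "K \<in> \<J> \<Longrightarrow> \<pi> D D' K \<cdot> end_tuple V0 V T X D D' Q q = q K"
proof -
  have "\<exists>!h. h \<in> ahom V Q (E D D') \<and> (\<forall>K \<in> vOb T. \<pi> D D' K \<cdot> h = q K)"
    using hom_end[OF assms(1,2)] assms(3) by (auto simp: is_hom_end_def)
  from theI'[OF this]
  show "end_tuple V0 V T X D D' Q q \<in> Ar V" "Dom V (end_tuple V0 V T X D D' Q q) = Q"
    "Cod V (end_tuple V0 V T X D D' Q q) = E D D'"
    "K \<in> \<J> \<Longrightarrow> \<pi> D D' K \<cdot> end_tuple V0 V T X D D' Q q = q K"
    by (auto simp: end_tuple_def ahom_iff)
qed

lemma natural_family_Cmp_\<pi>: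
  assumes "prefunctor T X D" "prefunctor T X D'" "h \<in> Ar V" "Cod V h = E D D'"
  shows "natural_family V T X D D' (Dom V h) (\<lambda>K. \<pi> D D' K \<cdot> h)"
  by (rule natural_family_Cmp[OF vcategory_axioms T.vcategory_axioms assms(1,2) natural_family_\<pi> assms(3,4)])
    (use assms in auto)

lemma end_eqI:
  assumes D: "prefunctor T X D" "prefunctor T X D'" and h: "h \<in> Ar V" "h' \<in> Ar V" "Dom V h = Dom V h'"
    "Cod V h = E D D'" "Cod V h' = E D D'"
    and eq: "\<And>K. K \<in> \<J> \<Longrightarrow> \<pi> D D' K \<cdot> h = \<pi> D D' K \<cdot> h'"
  shows "h = h'"
proof -
  have "\<exists>!u. u \<in> ahom V (Dom V h) (E D D') \<and> (\<forall>K \<in> vOb T. \<pi> D D' K \<cdot> u = \<pi> D D' K \<cdot> h)"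
    using hom_end[OF D] natural_family_Cmp_\<pi>[OF D h(1,4)] by (auto simp: is_hom_end_def)
  moreover have "h \<in> ahom V (Dom V h) (E D D')" "h' \<in> ahom V (Dom V h) (E D D')" using h by (auto simp: ahom_iff)
  ultimately show ?thesis using eq by (metis theory_Ob(1))
qed

text \<open>The generic operations of \<open>T\<close> supply what \<open>natural_family_eqI\<close>
  asks for at every arity, so equality of morphisms into [K, A] may be checked on carriers.\<close>

lemma end_eqI_unit:
  assumes D: "prefunctor T X D" and K: "K \<in> \<J>" and h: "h \<in> Ar V" "h' \<in> Ar V" "Dom V h = Dom V h'"
    "Cod V h = E D (P K)" "Cod V h' = E D (P K)"
    and eq: "\<pi> D (P K) \<one> \<cdot> h = \<pi> D (P K) \<one> \<cdot> h'"
  shows "h = h'"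
proof (rule end_eqI[OF D prefunctor_P[OF K] h])
  fix L assume L: "L \<in> \<J>"
  show "\<pi> D (P K) L \<cdot> h = \<pi> D (P K) L \<cdot> h'"
    using natural_family_eqI[OF T.vcategory_axioms prefunctor_A D pointwise_cotensor_P[OF K]
        natural_family_Cmp_\<pi>[OF D prefunctor_P[OF K] h(1,4)]
        natural_family_Cmp_\<pi>[OF D prefunctor_P[OF K] h(2,5), folded h(3)] eq generic_T[OF L] A_counit[OF L]] L
    by simp
qed

lemma Alg_vCmp:
  assumes D: "prefunctor T X D" "prefunctor T X D'" "prefunctor T X D''"
  shows "vCmp (Alg V0 V \<J> T X) D D' D'' \<in> Ar V"
    "Dom V (vCmp (Alg V0 V \<J> T X) D D' D'') = E D' D'' \<otimes> E D D'"
    "Cod V (vCmp (Alg V0 V \<J> T X) D D' D'') = E D D''"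
    "K \<in> \<J> \<Longrightarrow> p \<in> Ar V \<Longrightarrow> q \<in> Ar V \<Longrightarrow> Cod V p = E D' D'' \<Longrightarrow> Cod V q = E D D' \<Longrightarrow>
       \<pi> D D'' K \<cdot> (vCmp (Alg V0 V \<J> T X) D D' D'' \<cdot> (p \<odot> q))
       = vc X (FO D K) (FO D' K) (FO D'' K) (\<pi> D' D'' K \<cdot> p) (\<pi> D D' K \<cdot> q)"
proof -
  let ?f = "\<lambda>K. vCmp X (FO D K) (FO D' K) (FO D'' K) \<cdot> (\<pi> D' D'' K \<odot> \<pi> D D' K)"
  have "natural_family V T X D D'' (E D' D'' \<otimes> E D D') ?f"
    using natural_family_vc[OF T.vcategory_axioms D natural_family_\<pi>[OF D(2,3)] natural_family_\<pi>[OF D(1,2)]]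
    by (simp add: vc_def)
  note t = end_tuple[OF D(1,3) this]
  then show c: "vCmp (Alg V0 V \<J> T X) D D' D'' \<in> Ar V"
    "Dom V (vCmp (Alg V0 V \<J> T X) D D' D'') = E D' D'' \<otimes> E D D'"
    "Cod V (vCmp (Alg V0 V \<J> T X) D D' D'') = E D D''"
    by (auto simp: Alg_def)
  assume K: "K \<in> \<J>" and pq: "p \<in> Ar V" "q \<in> Ar V" "Cod V p = E D' D''" "Cod V q = E D D'"
  have "\<pi> D D'' K \<cdot> (vCmp (Alg V0 V \<J> T X) D D' D'' \<cdot> (p \<odot> q))
    = (\<pi> D D'' K \<cdot> vCmp (Alg V0 V \<J> T X) D D' D'') \<cdot> (p \<odot> q)"
    using K pq D c by simp
  also have "\<pi> D D'' K \<cdot> vCmp (Alg V0 V \<J> T X) D D' D'' = ?f K"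
    using t(4)[OF K] by (simp add: Alg_def)
  also have "\<dots> \<cdot> (p \<odot> q) = vc X (FO D K) (FO D' K) (FO D'' K) (\<pi> D' D'' K \<cdot> p) (\<pi> D D' K \<cdot> q)"
    using K pq D prefunctorD(1)[OF D(1)] prefunctorD(1)[OF D(2)] prefunctorD(1)[OF D(3)]
    by (simp add: vc_def interchange)
  finally show "\<pi> D D'' K \<cdot> (vCmp (Alg V0 V \<J> T X) D D' D'' \<cdot> (p \<odot> q))
       = vc X (FO D K) (FO D' K) (FO D'' K) (\<pi> D' D'' K \<cdot> p) (\<pi> D D' K \<cdot> q)" .
qed

lemma Alg_vIde:
  assumes D: "prefunctor T X D"
  shows "vIde (Alg V0 V \<J> T X) D \<in> Ar V" "Dom V (vIde (Alg V0 V \<J> T X) D) = \<one>"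
    "Cod V (vIde (Alg V0 V \<J> T X) D) = E D D"
    "K \<in> \<J> \<Longrightarrow> \<pi> D D K \<cdot> vIde (Alg V0 V \<J> T X) D = vIde X (FO D K)"
  using end_tuple[OF D D natural_family_vIde[OF T.vcategory_axioms D]] by (auto simp: Alg_def)

lemma alg_coun:
  assumes "J \<in> \<J>"
  shows "alg_coun V0 V T X J A \<in> Ar V" "Dom V (alg_coun V0 V T X J A) = J"
    "Cod V (alg_coun V0 V T X J A) = E (P J) A"
    "L \<in> \<J> \<Longrightarrow> \<pi> (P J) A L \<cdot> alg_coun V0 V T X J A = k J L"
  using end_tuple[OF prefunctor_P[OF assms] prefunctor_A natural_family_k[OF assms]] by (auto simp: alg_coun_def)

text \<open>The existence half of the universal property of [K, A] in the category of algebras, with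
  the factorization read off in the components.\<close>

lemma end_lift:
  assumes K: "K \<in> \<J>" and D: "prefunctor T X D"
    and s: "natural_family V T X D A (K \<otimes> Q) s" and Q: "Q \<in> Ob V"
  obtains t where "t \<in> Ar V" "Dom V t = Q" "Cod V t = E D (P K)"
    "\<And>L. L \<in> \<J> \<Longrightarrow> vc X (FO D L) (cotn X K (FO A L)) (FO A L) (k K L) (\<pi> D (P K) L \<cdot> t) = s L"
proof -
  obtain t where t: "natural_family V T X D (P K) Q t"
    "\<And>L. L \<in> vOb T \<Longrightarrow> vc X (FO D L) (FO (P K) L) (FO A L) (k K L) (t L) = s L"
    using pointwise_cotensor_lift[OF T.vcategory_axioms prefunctor_A D pointwise_cotensor_P[OF K] s Q] by blast
  show thesis
    by (rule that[of "end_tuple V0 V T X D (P K) Q t"])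
      (use end_tuple[OF D prefunctor_P[OF K] t(1)] t(2) K in auto)
qed

section \<open>The commutant in terms of components\<close>

lemma comm_simps [simp]: "vOb comm = \<J>" "vHom comm J K = E (P J) (P K)" "FO (str comm) J = J"
  by (simp_all add: commutant_def Let_def Alg_def)

text \<open>The structure functor of the commutant is defined by an equation in a hom-object of
  algebras. The projections of the end turn it into one equation in \<open>X\<close> for each arity
  L, with a unique solution because every counit \<open>k K L\<close> is universal. The last part is
  the criterion for commuting with the structure functors.\<close>

lemma str_comm:
  assumes J [simp]: "J \<in> \<J>" and K [simp]: "K \<in> \<J>"
  shows "FH (str comm) J K \<in> Ar V" "Dom V (FH (str comm) J K) = ihom V K J"
    "Cod V (FH (str comm) J K) = E (P J) (P K)"
    "L \<in> \<J> \<Longrightarrow> vc X (cotn X J (FO A L)) (cotn X K (FO A L)) (FO A L) (k K L) (\<pi> (P J) (P K) L \<cdot> FH (str comm) J K)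
      = k J L \<cdot> (ev_ar V K J \<cdot> sym_ar V K (ihom V K J))"
    "\<And>t. \<lbrakk>t \<in> Ar V; Dom V t = ihom V K J; Cod V t = E (P J) (P K);
      \<And>L. L \<in> \<J> \<Longrightarrow> vc X (cotn X J (FO A L)) (cotn X K (FO A L)) (FO A L) (k K L) (\<pi> (P J) (P K) L \<cdot> t)
      = k J L \<cdot> (ev_ar V K J \<cdot> sym_ar V K (ihom V K J))\<rbrakk> \<Longrightarrow> FH (str comm) J K = t"
proof -
  let ?e = "ev_ar V K J \<cdot> sym_ar V K (ihom V K J)"
  let ?R = "\<lambda>t. t \<in> ahom V (ihom V K J) (E (P J) (P K)) \<and>
     vCmp (Alg V0 V \<J> T X) (P J) (P K) A \<cdot> (alg_coun V0 V T X K A \<odot> t) = alg_coun V0 V T X J A \<cdot> ?e"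
  note [simp] = prefunctor_P[OF J] prefunctor_P[OF K] prefunctor_A alg_coun(1-3)[OF J] alg_coun(1-3)[OF K] Alg_vCmp(1-3)
  have str: "FH (str comm) J K = (THE t. ?R t)"
    by (simp add: commutant_def Let_def Alg_def)
  have R: "?R t \<longleftrightarrow> t \<in> Ar V \<and> Dom V t = ihom V K J \<and> Cod V t = E (P J) (P K) \<and>
     (\<forall>L \<in> \<J>. vc X (cotn X J (FO A L)) (cotn X K (FO A L)) (FO A L) (k K L) (\<pi> (P J) (P K) L \<cdot> t) = k J L \<cdot> ?e)"
    (is "_ \<longleftrightarrow> ?R' t") for t
  proof (cases "t \<in> Ar V \<and> Dom V t = ihom V K J \<and> Cod V t = E (P J) (P K)")
    case True
    then have [simp]: "t \<in> Ar V" "Dom V t = ihom V K J" "Cod V t = E (P J) (P K)" by auto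
    have 1: "\<pi> (P J) A L \<cdot> (vCmp (Alg V0 V \<J> T X) (P J) (P K) A \<cdot> (alg_coun V0 V T X K A \<odot> t))
      = vc X (cotn X J (FO A L)) (cotn X K (FO A L)) (FO A L) (k K L) (\<pi> (P J) (P K) L \<cdot> t)" if "L \<in> \<J>" for L
      using that by (simp add: Alg_vCmp(4) alg_coun(4))
    have 2: "\<pi> (P J) A L \<cdot> (alg_coun V0 V T X J A \<cdot> ?e) = k J L \<cdot> ?e" if "L \<in> \<J>" for L
    proof -
      have "\<pi> (P J) A L \<cdot> (alg_coun V0 V T X J A \<cdot> ?e) = (\<pi> (P J) A L \<cdot> alg_coun V0 V T X J A) \<cdot> ?e"
        using that by (subst Cmp_assoc) auto
      then show ?thesis using that by (simp only: alg_coun(4)[OF J])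
    qed
    have "vCmp (Alg V0 V \<J> T X) (P J) (P K) A \<cdot> (alg_coun V0 V T X K A \<odot> t) = alg_coun V0 V T X J A \<cdot> ?e
      \<longleftrightarrow> (\<forall>L \<in> \<J>. vc X (cotn X J (FO A L)) (cotn X K (FO A L)) (FO A L) (k K L) (\<pi> (P J) (P K) L \<cdot> t) = k J L \<cdot> ?e)"
      (is "?x = ?y \<longleftrightarrow> ?rhs")
    proof
      assume "?x = ?y"
      then show ?rhs using 1 2 by metis
    next
      assume ?rhs
      then show "?x = ?y"
        by - (rule end_eqI[of "P J" A], use 1 2 in auto)
    qed
    with True show ?thesis by (simp add: ahom_iff)
  qed (auto simp: ahom_iff)
  \<comment> \<open>A restriction of the counit family of [J, A], lifted through the cotensor [K, A]
    to solve the equation.\<close>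
  have "natural_family V T X (P J) A (K \<otimes> ihom V K J) (\<lambda>L. k J L \<cdot> ?e)"
    using natural_family_Cmp[OF vcategory_axioms T.vcategory_axioms _ _ natural_family_k[OF J], of ?e] by simp
  then obtain t where t: "t \<in> Ar V" "Dom V t = ihom V K J" "Cod V t = E (P J) (P K)"
    "\<And>L. L \<in> \<J> \<Longrightarrow> vc X (FO (P J) L) (cotn X K (FO A L)) (FO A L) (k K L) (\<pi> (P J) (P K) L \<cdot> t) = k J L \<cdot> ?e"
    using end_lift[OF K prefunctor_P[OF J], of "ihom V K J" "\<lambda>L. k J L \<cdot> ?e"] by auto
  have uniq: "t' = t" if "?R' t'" for t'
  proof (rule end_eqI[of "P J" "P K"])
    fix L assume [simp]: "L \<in> \<J>"
    show "\<pi> (P J) (P K) L \<cdot> t' = \<pi> (P J) (P K) L \<cdot> t"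
      by (rule universal_counit_eqI[OF cotn_counit[of K "FO A L"], of "cotn X J (FO A L)"]) (use that t in auto)
  qed (use that t in auto)
  have t': "?R' t" using t by simp
  then have the: "(THE t. ?R t) = t"
    unfolding R by (rule the_equality) (rule uniq)
  show "FH (str comm) J K \<in> Ar V" "Dom V (FH (str comm) J K) = ihom V K J"
    "Cod V (FH (str comm) J K) = E (P J) (P K)"
    "L \<in> \<J> \<Longrightarrow> vc X (cotn X J (FO A L)) (cotn X K (FO A L)) (FO A L) (k K L) (\<pi> (P J) (P K) L \<cdot> FH (str comm) J K)
      = k J L \<cdot> ?e"
    unfolding str the using t' by auto
  have "FH (str comm) J K = u" if "?R' u" for u
    unfolding str the using uniq[OF that] ..
  then show "\<lbrakk>u \<in> Ar V; Dom V u = ihom V K J; Cod V u = E (P J) (P K);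
      \<And>L. L \<in> \<J> \<Longrightarrow> vc X (cotn X J (FO A L)) (cotn X K (FO A L)) (FO A L) (k K L) (\<pi> (P J) (P K) L \<cdot> u)
      = k J L \<cdot> ?e\<rbrakk> \<Longrightarrow> FH (str comm) J K = u" for u by blast
qed

end

section \<open>Commutation\<close>

context algebra_pair_over
begin

text \<open>The component U(J, \<one>) \<rightarrow> Alg([J, A], A) of \<open>M\<close>, followed by
  the projections of the end, is the extension. The comparison \<open>m\<close> is the component at
  J of the inverse of the isomorphism \<open>f\<close>.\<close>

lemma commutes_imp_operations_extend:
  assumes "commutes V0 V \<J> X T A U B" and J [simp]: "J \<in> \<J>"
  shows "operations_extend T X A U B J (generic_op U J) (P J) (k J)"
proof -
  obtain M f where M: "theory_morphism V \<J> U comm M"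
    and f: "natural_iso V U X B (vfun_comp V (commutant_algebra V0 V T X A) M) f"
    and f1: "f \<one> = vIde X (FO B \<one>)"
    using assms by (auto simp: commutes_def)
  define R where "R = vfun_comp V (commutant_algebra V0 V T X A) M"
  have FOM: "FO M L = L" if "L \<in> \<J>" for L
    using M that str_U(2) by (simp add: theory_morphism_def vfun_comp_def)
  have M_str: "FH M L K \<cdot> FH (str U) L K = FH (str comm) L K" if "L \<in> \<J>" "K \<in> \<J>" for L K
    using M that str_U(2) by (simp add: theory_morphism_def vfun_comp_def)
  have [simp]: "FH M L K \<in> Ar V" "Dom V (FH M L K) = vHom U L K" "Cod V (FH M L K) = E (P L) (P K)"
    if "L \<in> \<J>" "K \<in> \<J>" for L K
    using M that by (auto simp: theory_morphism_def enriched_functor_def FOM ahom_iff)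
  have R_FO: "FO R L = cotn X L (FO A \<one>)" if "L \<in> \<J>" for L
    using that by (simp add: R_def vfun_comp_def commutant_algebra_def FOM)
  have R_FH: "FH R L K = \<pi> (P L) (P K) \<one> \<cdot> FH M L K" if "L \<in> \<J>" "K \<in> \<J>" for L K
    using that by (simp add: R_def vfun_comp_def commutant_algebra_def FOM)
  obtain g where g: "natural_family V U X R B \<one> g"
    and fg: "\<And>K. K \<in> \<J> \<Longrightarrow> vc X (FO B K) (FO R K) (FO B K) (g K) (f K) = vIde X (FO B K) \<cdot> lunit_ar V \<one>"
    using f unfolding natural_iso_def R_def[symmetric] natural_transformation_def by (auto simp: vc_def)
  note [simp] = prefunctor_P[OF J] prefunctor_A
  have R1: "FO R \<one> = FO B \<one>" using carrier by (simp add: R_FO cotn_unit)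
  have [simp]: "g L \<in> Ar V" "Dom V (g L) = \<one>" "Cod V (g L) = vHom X (cotn X L (FO A \<one>)) (FO B L)" if "L \<in> \<J>" for L
    using natural_familyD(2-4)[OF g, of L] that by (auto simp: R_FO)
  have [simp]: "Cod V (g \<one>) = vHom X (FO B \<one>) (FO B \<one>)"
    using natural_familyD(4)[OF g, of \<one>] by (simp add: R1)
  \<comment> \<open>Since \<open>f\<close> is the identity on the carrier, so is its inverse, and
    naturality of \<open>g\<close> on U(J, \<one>) involves only the comparison
    \<open>g J\<close>.\<close>
  have g1: "g \<one> = vIde X (FO B \<one>)"
  proof (rule iso_epi[of "lunit_ar V \<one>"])
    show "g \<one> \<cdot> lunit_ar V \<one> = vIde X (FO B \<one>) \<cdot> lunit_ar V \<one>"
      using fg[of \<one>] by (simp add: f1 R1 vc_vIde_right lunit_eq_runit)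
  qed auto
  \<comment> \<open>This typechecks because \<open>P \<one>\<close> is \<open>A\<close> itself, so
    that \<open>M\<close> on U(J, \<one>) takes values in the end for [J, A] and A.\<close>
  let ?q = "\<lambda>L. \<pi> (P J) A L \<cdot> FH M J \<one>"
  have q: "natural_family V T X (P J) A (vHom U J \<one>) ?q"
    using natural_family_Cmp_\<pi>[of "P J" A "FH M J \<one>"] by simp
  have [simp]: "cotn X J (FO B \<one>) \<in> vOb X" 
    using k_simps(4)[of J \<one>] carrier by simp
  have q1: "?q \<one> = pre X (cotn X J (FO B \<one>)) (FO B J) (FO B \<one>) (g J) (FH B J \<one>)"
  proof (rule iso_epi[of "lunit_ar V (vHom U J \<one>)"])
    have "?q \<one> \<cdot> lunit_ar V (vHom U J \<one>) = vc X (FO R J) (FO R \<one>) (FO B \<one>) (g \<one>) (FH R J \<one>)"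
      using carrier by (simp add: g1 R1 R_FH R_FO vc_vIde_left)
    also have "\<dots> = vc X (FO R J) (FO B J) (FO B \<one>) (FH B J \<one>) (g J) \<cdot> sym_ar V \<one> (vHom U J \<one>)"
      using natural_familyD(5)[OF g, of J \<one>] by simp
    also have "\<dots> = pre X (cotn X J (FO B \<one>)) (FO B J) (FO B \<one>) (g J) (FH B J \<one>) \<cdot> lunit_ar V (vHom U J \<one>)"
      using carrier by (simp add: R_FO vc_eq_pre runit_sym)
    finally show "?q \<one> \<cdot> lunit_ar V (vHom U J \<one>)
      = pre X (cotn X J (FO B \<one>)) (FO B J) (FO B \<one>) (g J) (FH B J \<one>) \<cdot> lunit_ar V (vHom U J \<one>)" .
  qed (use carrier in auto)
  let ?e = "cur V J \<one> J (runit_ar V J)"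
  \<comment> \<open>The generic operation is the image of J \<cong> [\<one>, J] under the structure
    functor of \<open>U\<close>. \<open>M\<close> carries that functor to the one of the commutant,
    which sends this isomorphism to the counit of [J, A].\<close>
  have "?q \<one> \<cdot> generic_op U J = k J \<one>"
  proof (rule iso_epi[of "lunit_ar V J"])
    let ?t = "\<pi> (P J) A \<one> \<cdot> FH (str comm) J \<one>"
    have [simp]: "FH (str comm) J \<one> \<in> Ar V" "Dom V (FH (str comm) J \<one>) = ihom V \<one> J"
      "Cod V (FH (str comm) J \<one>) = E (P J) A"
      using str_comm(1-3)[of J \<one>] by auto
    have "?t \<cdot> lunit_ar V (ihom V \<one> J) = k J \<one> \<cdot> (ev_ar V \<one> J \<cdot> sym_ar V \<one> (ihom V \<one> J))"
      using str_comm(4)[of J \<one> \<one>] k_simps(4)[of J \<one>] by (simp add: cotn_unit vc_vIde_left)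
    moreover have "(?q \<one> \<cdot> generic_op U J) \<cdot> lunit_ar V J = (?t \<cdot> lunit_ar V (ihom V \<one> J)) \<cdot> (Ide V \<one> \<odot> ?e)"
    proof -
      have "\<pi> (P J) A \<one> \<cdot> FH M J \<one> \<cdot> FH (str U) J \<one> = ?t"
        by (simp add: M_str)
      then have "?q \<one> \<cdot> generic_op U J = ?t \<cdot> ?e"
        by (simp add: generic_op_def flip: Cmp_assoc) 
      then show ?thesis by (simp add: lunit_natural)
    qed
    moreover have "(k J \<one> \<cdot> (ev_ar V \<one> J \<cdot> sym_ar V \<one> (ihom V \<one> J))) \<cdot> (Ide V \<one> \<odot> ?e) = k J \<one> \<cdot> lunit_ar V J"
      by (simp add: sym_natural runit_sym)
    ultimately show "(?q \<one> \<cdot> generic_op U J) \<cdot> lunit_ar V J = k J \<one> \<cdot> lunit_ar V J" by (simp only:)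
  qed auto
  then have "pre X (cotn X J (FO B \<one>)) (FO B J) (FO B \<one>) (g J) (FH B J \<one> \<cdot> generic_op U J) = k J \<one>"
    using q1 carrier by (simp add: pre_Cmp)
  then show ?thesis
    unfolding operations_extend_def using q q1 carrier
    by (intro exI[of _ ?q] exI[of _ "g J"]) (simp add: ahom_iff)
qed

text \<open>On carriers the morphism to be constructed is \<open>B\<close> conjugated by the
  isomorphisms \<open>i\<close> and \<open>j\<close> between the objects [J, c] and
  \<open>B J\<close>. Its functoriality is therefore inherited from \<open>B\<close>, and
  \<open>j\<close> is the required isomorphism of algebras.\<close>

lemma operations_extend_imp_commutes:
  assumes ex: "\<And>J. J \<in> \<J> \<Longrightarrow> operations_extend T X A U B J (generic_op U J) (P J) (k J)"
  shows "commutes V0 V \<J> X T A U B"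
proof -
  define c where "c = FO B \<one>"
  have c [simp]: "FO A \<one> = c" "FO B \<one> = c" "c \<in> vOb X" using carrier by (auto simp: c_def)
  have [simp]: "cotn X J c \<in> vOb X" "coun X J c \<in> Ar V" "Dom V (coun X J c) = J"
    "Cod V (coun X J c) = vHom X (cotn X J c) c" if "J \<in> \<J>" for J
    using k_simps[OF that, of \<one>] by auto
  have "\<exists>q i. natural_family V T X (P J) A (vHom U J \<one>) q \<and> i \<in> ahom V \<one> (vHom X (cotn X J c) (FO B J)) \<and>
      pre X (cotn X J c) (FO B J) c i (FH B J \<one> \<cdot> generic_op U J) = coun X J c \<and>
      q \<one> = pre X (cotn X J c) (FO B J) c i (FH B J \<one>)" if "J \<in> \<J>" for J
    using ex[OF that] that by (simp add: operations_extend_def)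
  then obtain q i where q: "\<And>J. J \<in> \<J> \<Longrightarrow> natural_family V T X (P J) A (vHom U J \<one>) (q J)"
    and i: "\<And>J. J \<in> \<J> \<Longrightarrow> i J \<in> ahom V \<one> (vHom X (cotn X J c) (FO B J))"
    and ib: "\<And>J. J \<in> \<J> \<Longrightarrow> pre X (cotn X J c) (FO B J) c (i J) (FH B J \<one> \<cdot> generic_op U J) = coun X J c"
    and q1: "\<And>J. J \<in> \<J> \<Longrightarrow> q J \<one> = pre X (cotn X J c) (FO B J) c (i J) (FH B J \<one>)"
    by metis
  have [simp]: "i J \<in> Ar V" "Dom V (i J) = \<one>" "Cod V (i J) = vHom X (cotn X J c) (FO B J)" if "J \<in> \<J>" for J
    using i[OF that] by (auto simp: ahom_iff)
  have [simp]: "q J L \<in> Ar V" "Dom V (q J L) = vHom U J \<one>" "Cod V (q J L) = vHom X (cotn X J (FO A L)) (FO A L)"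
    if "J \<in> \<J>" "L \<in> \<J>" for J L
    using natural_familyD(2-4)[OF q[OF that(1)], of L] that by auto
  \<comment> \<open>The comparison in the opposite direction, from universality of the designated
    cotensor. It is inverse to \<open>i J\<close>, as both cotensors of the carrier have universal
    counits.\<close>
  have "\<exists>m. m \<in> Ar V \<and> Dom V m = \<one> \<and> Cod V m = vHom X (FO B J) (cotn X J c) \<and>
     pre X (FO B J) (cotn X J c) c m (coun X J c) = FH B J \<one> \<cdot> generic_op U J" if J: "J \<in> \<J>" for J
    by (rule universal_counit_pre[OF cotn_counit[OF J c(3)], of "FO B J" "FH B J \<one> \<cdot> generic_op U J"])
      (use J in auto)
  then obtain j where j: "\<And>J. J \<in> \<J> \<Longrightarrow> j J \<in> Ar V \<and> Dom V (j J) = \<one> \<and> Cod V (j J) = vHom X (FO B J) (cotn X J c) \<and>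
     pre X (FO B J) (cotn X J c) c (j J) (coun X J c) = FH B J \<one> \<cdot> generic_op U J" by metis
  then have [simp]: "j J \<in> Ar V" "Dom V (j J) = \<one>" "Cod V (j J) = vHom X (FO B J) (cotn X J c)" if "J \<in> \<J>" for J
    using that by auto
  have ij: "pre X (FO B J) (cotn X J c) (FO B J) (j J) (i J) = vIde X (FO B J)" if [simp]: "J \<in> \<J>" for J
  proof (rule universal_counit_pre_eqI[OF B_counit[of J]])
    show "pre X (FO B J) (FO B J) (FO B \<one>) (pre X (FO B J) (cotn X J c) (FO B J) (j J) (i J)) (FH B J \<one> \<cdot> generic_op U J)
       = pre X (FO B J) (FO B J) (FO B \<one>) (vIde X (FO B J)) (FH B J \<one> \<cdot> generic_op U J)"
      using j[of J] ib[of J] by (simp add: pre_vIde pre_pre[symmetric])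
  qed auto
  have ji: "pre X (cotn X J c) (FO B J) (cotn X J c) (i J) (j J) = vIde X (cotn X J c)" if [simp]: "J \<in> \<J>" for J
  proof (rule universal_counit_pre_eqI[OF cotn_counit[of J c]])
    show "pre X (cotn X J c) (cotn X J c) c (pre X (cotn X J c) (FO B J) (cotn X J c) (i J) (j J)) (coun X J c)
       = pre X (cotn X J c) (cotn X J c) c (vIde X (cotn X J c)) (coun X J c)"
      using j[of J] ib[of J] by (simp add: pre_vIde pre_pre[symmetric])
  qed auto
  \<comment> \<open>Known at the unit from the choice of \<open>i J\<close>. Both sides are natural
    families into \<open>A\<close>, seen as the cotensor [\<one>, A], so they agree
    everywhere.\<close>
  have q_generic: "q J L \<cdot> generic_op U J = k J L" if [simp]: "J \<in> \<J>" "L \<in> \<J>" for J L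
  proof (rule natural_family_eqI[OF T.vcategory_axioms prefunctor_A prefunctor_P _ _ natural_family_k])
    show "natural_family V T X (P J) A J (\<lambda>L. q J L \<cdot> generic_op U J)"
      using natural_family_Cmp[OF vcategory_axioms T.vcategory_axioms prefunctor_P prefunctor_A q, of J "generic_op U J"]
      by simp
    show "q J \<one> \<cdot> generic_op U J = k J \<one>"
      using ib[of J] by (simp add: q1 pre_Cmp)
    show "pointwise_cotensor T X \<one> A A (k \<one>)" using pointwise_cotensor_P[of \<one>] by simp
    show "generic_op T L \<in> ahom V L (vHom T L \<one>)" by (rule generic_T) simp
    show "universal_counit X L (FO A \<one>) (FO A L) (FH A L \<one> \<cdot> generic_op T L)" by (rule A_counit) simp
  qed auto
  \<comment> \<open>K \<otimes> U(J, K) \<rightarrow> U(J, \<one>), composition with the generic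
    operation of K. Followed by \<open>q J\<close> it is the family to be lifted through
    [K, A].\<close>
  let ?u = "\<lambda>J K. vc U J K \<one> (generic_op U K) (Ide V (vHom U J K))"
  have "\<exists>t. t \<in> Ar V \<and> Dom V t = vHom U J K \<and> Cod V t = E (P J) (P K) \<and>
    (\<forall>L \<in> \<J>. vc X (cotn X J (FO A L)) (cotn X K (FO A L)) (FO A L) (k K L) (\<pi> (P J) (P K) L \<cdot> t)
      = q J L \<cdot> ?u J K)"
    if [simp]: "J \<in> \<J>" "K \<in> \<J>" for J K
  proof -
    have "natural_family V T X (P J) A (K \<otimes> vHom U J K) (\<lambda>L. q J L \<cdot> ?u J K)"
      using natural_family_Cmp[OF vcategory_axioms T.vcategory_axioms prefunctor_P prefunctor_A q, of J "?u J K"]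
      by simp
    from end_lift[OF that(2) prefunctor_P[OF that(1)] this]
    obtain t where "t \<in> Ar V" "Dom V t = vHom U J K" "Cod V t = E (P J) (P K)"
      "\<And>L. L \<in> \<J> \<Longrightarrow> vc X (FO (P J) L) (cotn X K (FO A L)) (FO A L) (k K L) (\<pi> (P J) (P K) L \<cdot> t)
      = q J L \<cdot> ?u J K"
      by auto
    then show ?thesis by (intro exI[of _ t]) auto
  qed
  then obtain h where h: "\<And>J K. J \<in> \<J> \<Longrightarrow> K \<in> \<J> \<Longrightarrow> h J K \<in> Ar V \<and> Dom V (h J K) = vHom U J K \<and>
      Cod V (h J K) = E (P J) (P K) \<and>
    (\<forall>L \<in> \<J>. vc X (cotn X J (FO A L)) (cotn X K (FO A L)) (FO A L) (k K L) (\<pi> (P J) (P K) L \<cdot> h J K)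
      = q J L \<cdot> ?u J K)" by metis
  then have [simp]: "h J K \<in> Ar V" "Dom V (h J K) = vHom U J K" "Cod V (h J K) = E (P J) (P K)"
    if "J \<in> \<J>" "K \<in> \<J>" for J K using that by auto
  have hL: "vc X (cotn X J (FO A L)) (cotn X K (FO A L)) (FO A L) (k K L) (\<pi> (P J) (P K) L \<cdot> h J K)
      = q J L \<cdot> ?u J K" if "J \<in> \<J>" "K \<in> \<J>" "L \<in> \<J>" for J K L
    using h that by blast
  note [simp] = prefunctor_P
  \<comment> \<open>The conjugation formula. Both sides have the same composite with the counit of
    [K, c], since \<open>j K\<close> turns this counit into the one of \<open>B K\<close>.\<close>
  have h1: "\<pi> (P J) (P K) \<one> \<cdot> h J K = post X (cotn X J c) (FO B K) (cotn X K c) (j K)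
      (pre X (cotn X J c) (FO B J) (FO B K) (i J) (FH B J K))" if [simp]: "J \<in> \<J>" "K \<in> \<J>" for J K
  proof (rule universal_counit_eqI[OF cotn_counit[of K c]])
    have "vc X (cotn X J c) (cotn X K c) c (coun X K c) (post X (cotn X J c) (FO B K) (cotn X K c) (j K)
      (pre X (cotn X J c) (FO B J) (FO B K) (i J) (FH B J K)))
      = vc X (cotn X J c) (FO B K) c (FH B K \<one> \<cdot> generic_op U K) (pre X (cotn X J c) (FO B J) (FO B K) (i J) (FH B J K))"
      using j[of K] by (simp add: vc_pre_post[symmetric])
    also have "\<dots> = pre X (cotn X J c) (FO B J) c (i J) (vc X (FO B J) (FO B K) c (FH B K \<one> \<cdot> generic_op U K) (FH B J K))"
      by (subst vc_pre) auto
    also have "vc X (FO B J) (FO B K) c (FH B K \<one> \<cdot> generic_op U K) (FH B J K) = FH B J \<one> \<cdot> ?u J K"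
      using B_vc[of J K \<one> "generic_op U K" "Ide V (vHom U J K)"] by simp
    also have "pre X (cotn X J c) (FO B J) c (i J) (FH B J \<one> \<cdot> ?u J K) = q J \<one> \<cdot> ?u J K"
      by (simp add: q1 pre_Cmp)
    finally show "vc X (cotn X J c) (cotn X K c) c (coun X K c) (\<pi> (P J) (P K) \<one> \<cdot> h J K)
      = vc X (cotn X J c) (cotn X K c) c (coun X K c) (post X (cotn X J c) (FO B K) (cotn X K c) (j K)
      (pre X (cotn X J c) (FO B J) (FO B K) (i J) (FH B J K)))"
      using hL[of J K \<one>] by simp
  qed auto
  let ?M = "\<lparr>FO = (\<lambda>J. J), FH = h\<rparr>"
  let ?\<A> = "Alg V0 V \<J> T X"
  have comm_vIde: "vIde comm J = vIde ?\<A> (P J)" for J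
    by (simp add: commutant_def Let_def)
  have comm_vCmp: "vCmp comm J K L = vCmp ?\<A> (P J) (P K) (P L)" for J K L
    by (simp add: commutant_def Let_def)
  have "enriched_functor V U comm ?M"
    unfolding enriched_functor_def
  proof (intro conjI ballI)
    fix J assume "J \<in> vOb U"
    then have [simp]: "J \<in> \<J>" by simp
    show "FO ?M J \<in> vOb comm" by simp
    have "h J J \<cdot> vIde U J = vIde ?\<A> (P J)"
    proof (rule end_eqI_unit[of "P J" J])
      have "\<pi> (P J) (P J) \<one> \<cdot> (h J J \<cdot> vIde U J) = (\<pi> (P J) (P J) \<one> \<cdot> h J J) \<cdot> vIde U J"
        by simp
      also have "\<dots> = post X (cotn X J c) (FO B J) (cotn X J c) (j J)
          (pre X (cotn X J c) (FO B J) (FO B J) (i J) (vIde X (FO B J)))"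
        by (simp only: h1 \<open>J \<in> \<J>\<close>) (simp add: post_Cmp[symmetric] pre_Cmp[symmetric] B_vIde)
      also have "\<dots> = vIde X (cotn X J c)"
        by (simp add: pre_eq_post[of "i J" "vIde X (FO B J)"] post_vIde pre_eq_post[of "i J" "j J", symmetric] ji)
      finally show "\<pi> (P J) (P J) \<one> \<cdot> (h J J \<cdot> vIde U J) = \<pi> (P J) (P J) \<one> \<cdot> vIde ?\<A> (P J)"
        by (simp add: Alg_vIde(4))
    qed (auto simp: Alg_vIde)
    then show "FH ?M J J \<cdot> vIde U J = vIde comm (FO ?M J)" by (simp add: comm_vIde)
    fix K assume "K \<in> vOb U"
    then have [simp]: "K \<in> \<J>" by simp
    show "FH ?M J K \<in> ahom V (vHom U J K) (vHom comm (FO ?M J) (FO ?M K))" by (simp add: ahom_iff)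
    fix L assume "L \<in> vOb U"
    then have [simp]: "L \<in> \<J>" by simp
    let ?b = "\<lambda>J K. pre X (cotn X J c) (FO B J) (FO B K) (i J) (FH B J K)"
    have "h J L \<cdot> vCmp U J K L = vCmp ?\<A> (P J) (P K) (P L) \<cdot> (h K L \<odot> h J K)"
    proof (rule end_eqI_unit[of "P J" L])
      have "\<pi> (P J) (P L) \<one> \<cdot> (h J L \<cdot> vCmp U J K L) = (\<pi> (P J) (P L) \<one> \<cdot> h J L) \<cdot> vCmp U J K L"
        by simp
      also have "\<dots> = post X (cotn X J c) (FO B L) (cotn X L c) (j L)
          (pre X (cotn X J c) (FO B J) (FO B L) (i J) (FH B J L \<cdot> vCmp U J K L))"
        by (simp only: h1 \<open>J \<in> \<J>\<close> \<open>L \<in> \<J>\<close>) (simp add: post_Cmp[symmetric] pre_Cmp[symmetric])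
      also have "FH B J L \<cdot> vCmp U J K L = vc X (FO B J) (FO B K) (FO B L) (FH B K L) (FH B J K)"
        using B_vc[of J K L "Ide V (vHom U K L)" "Ide V (vHom U J K)"] by (simp add: vc_def)
      also have "post X (cotn X J c) (FO B L) (cotn X L c) (j L)
          (pre X (cotn X J c) (FO B J) (FO B L) (i J) (vc X (FO B J) (FO B K) (FO B L) (FH B K L) (FH B J K)))
        = post X (cotn X J c) (FO B L) (cotn X L c) (j L) (vc X (cotn X J c) (FO B K) (FO B L) (FH B K L) (?b J K))"
        by (simp add: vc_pre)
      \<comment> \<open>The identity of \<open>B K\<close> is inserted as a composite of
        \<open>i K\<close> and \<open>j K\<close>, which splits the conjugated composite into two
        conjugates.\<close>
      also have "FH B K L = pre X (FO B K) (cotn X K c) (FO B L) (j K) (?b K L)"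
        by (simp add: pre_pre ij pre_vIde)
      also have "vc X (cotn X J c) (FO B K) (FO B L) (pre X (FO B K) (cotn X K c) (FO B L) (j K) (?b K L)) (?b J K)
        = vc X (cotn X J c) (cotn X K c) (FO B L) (?b K L) (post X (cotn X J c) (FO B K) (cotn X K c) (j K) (?b J K))"
        by (subst vc_pre_post) auto
      also have "post X (cotn X J c) (FO B L) (cotn X L c) (j L)
          (vc X (cotn X J c) (cotn X K c) (FO B L) (?b K L) (post X (cotn X J c) (FO B K) (cotn X K c) (j K) (?b J K)))
        = vc X (cotn X J c) (cotn X K c) (cotn X L c) (\<pi> (P K) (P L) \<one> \<cdot> h K L) (\<pi> (P J) (P K) \<one> \<cdot> h J K)"
        by (simp add: h1 post_vc)
      also have "\<dots> = \<pi> (P J) (P L) \<one> \<cdot> (vCmp ?\<A> (P J) (P K) (P L) \<cdot> (h K L \<odot> h J K))"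
        by (simp add: Alg_vCmp(4))
      finally show "\<pi> (P J) (P L) \<one> \<cdot> (h J L \<cdot> vCmp U J K L)
        = \<pi> (P J) (P L) \<one> \<cdot> (vCmp ?\<A> (P J) (P K) (P L) \<cdot> (h K L \<odot> h J K))" .
    qed (auto simp: Alg_vCmp)
    then show "FH ?M J L \<cdot> vCmp U J K L = vCmp comm (FO ?M J) (FO ?M K) (FO ?M L) \<cdot> (FH ?M K L \<odot> FH ?M J K)"
      by (simp add: comm_vCmp)
  qed
  \<comment> \<open>By the uniqueness part of \<open>str_comm\<close> only the component equations
    remain; they are \<open>vc_generic_op\<close> pushed through \<open>q J\<close>, which sends the
    generic operation to the counit.\<close>
  moreover have "FH (str comm) J K = h J K \<cdot> FH (str U) J K" if [simp]: "J \<in> \<J>" "K \<in> \<J>" for J K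
  proof (rule str_comm(5))
    fix L assume [simp]: "L \<in> \<J>"
    have "vc X (cotn X J (FO A L)) (cotn X K (FO A L)) (FO A L) (k K L) (\<pi> (P J) (P K) L \<cdot> (h J K \<cdot> FH (str U) J K))
      = vc X (cotn X J (FO A L)) (cotn X K (FO A L)) (FO A L) (k K L) (\<pi> (P J) (P K) L \<cdot> h J K) \<cdot> (Ide V K \<odot> FH (str U) J K)"
      using vc_Cmp_right[of "cotn X J (FO A L)" "cotn X K (FO A L)" "FO A L" "k K L" "\<pi> (P J) (P K) L \<cdot> h J K" "FH (str U) J K"]
      by simp
    also have "\<dots> = q J L \<cdot> (?u J K \<cdot> (Ide V K \<odot> FH (str U) J K))"
      by (subst hL) auto
    also have "?u J K \<cdot> (Ide V K \<odot> FH (str U) J K) = vc U J K \<one> (generic_op U K) (FH (str U) J K)"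
      using U.vc_Cmp_right[of J K \<one> "generic_op U K" "Ide V (vHom U J K)" "FH (str U) J K"] by simp
    also have "\<dots> = generic_op U J \<cdot> (ev_ar V K J \<cdot> sym_ar V K (ihom V K J))"
      by (rule vc_generic_op[OF str_U U.vcategory_axioms _ _ arity_set(1)]) auto
    also have "q J L \<cdot> \<dots> = (q J L \<cdot> generic_op U J) \<cdot> (ev_ar V K J \<cdot> sym_ar V K (ihom V K J))"
      by simp
    finally show "vc X (cotn X J (FO A L)) (cotn X K (FO A L)) (FO A L) (k K L) (\<pi> (P J) (P K) L \<cdot> (h J K \<cdot> FH (str U) J K))
      = k J L \<cdot> (ev_ar V K J \<cdot> sym_ar V K (ihom V K J))"
      by (simp only: q_generic \<open>J \<in> \<J>\<close> \<open>L \<in> \<J>\<close>)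
  qed auto
  ultimately have "theory_morphism V \<J> U comm ?M"
    using str_U(2) by (simp add: theory_morphism_def vfun_comp_def)
  moreover have "natural_iso V U X B (vfun_comp V (commutant_algebra V0 V T X A) ?M) j"
  proof -
    define R where "R = vfun_comp V (commutant_algebra V0 V T X A) ?M"
    have R_FO: "FO R L = cotn X L c" if "L \<in> \<J>" for L
      using that by (simp add: R_def vfun_comp_def commutant_algebra_def)
    have R_FH: "FH R L K = \<pi> (P L) (P K) \<one> \<cdot> h L K" if "L \<in> \<J>" "K \<in> \<J>" for L K
      using that by (simp add: R_def vfun_comp_def commutant_algebra_def)
    have "natural_family V U X B R \<one> j"
      unfolding natural_family_iff
    proof (intro conjI ballI)
      fix K L assume "K \<in> vOb U" "L \<in> vOb U"
      then have [simp]: "K \<in> \<J>" "L \<in> \<J>" by auto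
      show "j K \<in> ahom V \<one> (vHom X (FO B K) (FO R K))" by (simp add: ahom_iff R_FO)
      let ?t = "post X (FO B K) (FO B L) (cotn X L c) (j L) (FH B K L)"
      have "vc X (FO B K) (cotn X K c) (cotn X L c) (FH R K L) (j K) \<cdot> sym_ar V \<one> (vHom U K L)
        = pre X (FO B K) (cotn X K c) (cotn X L c) (j K) (FH R K L) \<cdot> lunit_ar V (vHom U K L)"
        by (simp add: R_FH vc_eq_pre runit_sym)
      also have "pre X (FO B K) (cotn X K c) (cotn X L c) (j K) (FH R K L) = ?t"
        by (simp add: R_FH h1 pre_post pre_pre ij pre_vIde)
      finally show "vc X (FO B K) (FO B L) (FO R L) (j L) (FH B K L)
        = vc X (FO B K) (FO R K) (FO R L) (FH R K L) (j K) \<cdot> sym_ar V \<one> (vHom U K L)"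
        by (simp add: R_FO vc_eq_post)
    qed auto
    moreover have "natural_family V U X R B \<one> i"
      unfolding natural_family_iff
    proof (intro conjI ballI)
      fix K L assume "K \<in> vOb U" "L \<in> vOb U"
      then have [simp]: "K \<in> \<J>" "L \<in> \<J>" by auto
      show "i K \<in> ahom V \<one> (vHom X (FO R K) (FO B K))" by (simp add: ahom_iff R_FO)
      have ij': "post X (FO B L) (cotn X L c) (FO B L) (i L) (j L) = vIde X (FO B L)"
        using ij[of L] pre_eq_post[of "j L" "i L"] by simp
      have "post X (cotn X K c) (cotn X L c) (FO B L) (i L) (FH R K L) = pre X (cotn X K c) (FO B K) (FO B L) (i K) (FH B K L)"
        by (simp add: R_FH h1 post_post ij' post_vIde)
      then show "vc X (FO R K) (FO R L) (FO B L) (i L) (FH R K L)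
        = vc X (FO R K) (FO B K) (FO B L) (FH B K L) (i K) \<cdot> sym_ar V \<one> (vHom U K L)"
        by (simp add: R_FO vc_eq_pre vc_eq_post R_FH runit_sym)
    qed auto
    ultimately show ?thesis
      unfolding natural_iso_def R_def[symmetric] natural_transformation_def
      using vc_eq_pre[of "FO B K" "cotn X K c" "FO B K" "i K" "j K" for K] ij ji
      by (intro conjI exI[of _ i]) (auto simp: R_FO vc_def[symmetric] vc_eq_pre lunit_eq_runit)
  qed
  \<comment> \<open>The generic operation of \<one> and the designated counit for \<one> are
    identities, so the equation defining \<open>j \<one>\<close> says that it is the
    identity.\<close>
  moreover have "j \<one> = vIde X (FO B \<one>)"
    using j[of \<one>] generic_op_unit[OF str_U arity_set(2)] B_vIde[of \<one>]
    by (simp add: cotn_unit pre_eq_post[of "j \<one>" "vIde X c"] post_vIde)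
  ultimately show ?thesis unfolding commutes_def by blast
qed

lemma commutes_iff:
  "commutes V0 V \<J> X T A U B \<longleftrightarrow> (\<forall>J \<in> \<J>. operations_extend T X A U B J (generic_op U J) (P J) (k J))"
  using commutes_imp_operations_extend operations_extend_imp_commutes by blast

end

section \<open>Small limits, products and ends\<close>

text \<open>An infinite cardinal equals its square. Pairs, and with them the coded shapes of limits
  below, fit into the type that measures smallness.\<close>

lemma infinite_pairing:
  assumes "infinite (UNIV :: 'u set)"
  obtains g :: "'u \<times> 'u \<Rightarrow> 'u" where "inj g"
proof -
  have "\<exists>g :: 'u \<times> 'u \<Rightarrow> 'u. bij_betw g (UNIV \<times> UNIV) UNIV"
    unfolding card_of_ordIso by (rule card_of_Times_same_infinite[OF assms])
  then show thesis using that by (auto simp: bij_betw_def)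
qed

lemma small_in_Times:
  fixes I :: "'i set" and R :: "'r set"
  assumes inf: "infinite (UNIV :: 'u set)" and "small_in TYPE('u) I" "small_in TYPE('u) R"
  shows "small_in TYPE('u) (I \<times> R)"
proof -
  obtain g :: "'u \<times> 'u \<Rightarrow> 'u" where g: "inj g" using infinite_pairing[OF inf] .
  obtain e e' where e: "inj_on (e :: 'i \<Rightarrow> 'u) I" "inj_on (e' :: 'r \<Rightarrow> 'u) R"
    using assms by (auto simp: small_in_def)
  have "inj_on (\<lambda>(i, r). g (e i, e' r)) (I \<times> R)"
    by (rule inj_onI) (auto simp: inj_eq[OF g] inj_on_eq_iff[OF e(1)] inj_on_eq_iff[OF e(2)])
  then show ?thesis by (auto simp: small_in_def)
qed

lemma small_in_subset: "small_in U S \<Longrightarrow> R \<subseteq> S \<Longrightarrow> small_in U R"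
  by (auto simp: small_in_def intro: inj_on_subset)

text \<open>The shape has an object for each \<open>i \<in> I\<close> and each \<open>r \<in> R\<close>, and two arrows \<open>s r \<rightarrow> r\<close> and
  \<open>t r \<rightarrow> r\<close> for each \<open>r\<close>. Objects and arrows are coded as pairs, with \<open>0\<close> for identities.\<close>
lemma small_bipartite_limit:
  fixes C :: "('o, 'a, 'm) category_scheme" and I :: "'i set" and R :: "'r set"
  assumes C: "ordinary_category C" and lim: "has_small_limits TYPE('u) C" and inf: "infinite (UNIV :: 'u set)"
    and I: "small_in TYPE('u) I" and R: "small_in TYPE('u) R"
    and D: "\<And>i. i \<in> I \<Longrightarrow> D i \<in> Ob C" and F: "\<And>r. r \<in> R \<Longrightarrow> F r \<in> Ob C"
    and s: "\<And>r. r \<in> R \<Longrightarrow> s r \<in> I" and t: "\<And>r. r \<in> R \<Longrightarrow> t r \<in> I"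
    and \<sigma>: "\<And>r. r \<in> R \<Longrightarrow> \<sigma> r \<in> ahom C (D (s r)) (F r)"
    and \<tau>: "\<And>r. r \<in> R \<Longrightarrow> \<tau> r \<in> ahom C (D (t r)) (F r)"
  shows "\<exists>L p. L \<in> Ob C \<and> (\<forall>i \<in> I. p i \<in> ahom C L (D i)) \<and>
    (\<forall>r \<in> R. Cmp C (\<sigma> r) (p (s r)) = Cmp C (\<tau> r) (p (t r))) \<and>
    (\<forall>Q q. Q \<in> Ob C \<and> (\<forall>i \<in> I. q i \<in> ahom C Q (D i)) \<and>
       (\<forall>r \<in> R. Cmp C (\<sigma> r) (q (s r)) = Cmp C (\<tau> r) (q (t r))) \<longrightarrow>
       (\<exists>!h. h \<in> ahom C Q L \<and> (\<forall>i \<in> I. Cmp C (p i) h = q i)))"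
proof -
  interpret ordinary_category C by fact
  obtain g :: "'u \<times> 'u \<Rightarrow> 'u" where g: "inj g" using infinite_pairing[OF inf] .
  obtain \<nu> :: "nat \<Rightarrow> 'u" where \<nu>: "inj \<nu>" using infinite_countable_subset[OF inf] by auto
  obtain e e' where e: "inj_on (e :: 'i \<Rightarrow> 'u) I" "inj_on (e' :: 'r \<Rightarrow> 'u) R"
    using I R by (auto simp: small_in_def)
  \<comment> \<open>A node of the shape with a number: 0 stands for the identity, and for a node
    from R the numbers 1 and 2 stand for the arrows out of the nodes \<open>s r\<close> and
    \<open>t r\<close>.\<close>
  define W where "W = (Inl ` I \<union> Inr ` R) \<times> (UNIV :: nat set)"
  \<comment> \<open>The codes \<nu> 0 and \<nu> 1 keep the summands I and R apart.\<close>
  define \<psi> where "\<psi> y = (case y of (Inl i, n) \<Rightarrow> g (\<nu> 0, g (e i, \<nu> n)) | (Inr r, n) \<Rightarrow> g (\<nu> 1, g (e' r, \<nu> n)))" for y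
  have "inj_on \<psi> W"
  proof (rule inj_onI)
    note eqs = inj_eq[OF g] inj_eq[OF \<nu>] inj_on_eq_iff[OF e(1)] inj_on_eq_iff[OF e(2)]
    fix y z assume "y \<in> W" "z \<in> W" "\<psi> y = \<psi> z"
    then show "y = z"
      by (cases y; cases z; cases "fst y"; cases "fst z") (auto simp: \<psi>_def W_def eqs)
  qed
  define \<phi> where "\<phi> = inv_into W \<psi>"
  have \<phi> [simp]: "\<phi> (\<psi> y) = y" if "y \<in> W" for y
    using \<open>inj_on \<psi> W\<close> that by (simp add: \<phi>_def)
  have W [simp]: "(Inl i, n) \<in> W \<longleftrightarrow> i \<in> I" "(Inr r, n) \<in> W \<longleftrightarrow> r \<in> R" for i r n
    by (auto simp: W_def)
  define OS where "OS = {u. \<exists>i \<in> I. u = \<psi> (Inl i, 0)} \<union> {u. \<exists>r \<in> R. u = \<psi> (Inr r, 0)}"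
  define AS where "AS = OS \<union> {u. \<exists>r \<in> R. u = \<psi> (Inr r, 1)} \<union> {u. \<exists>r \<in> R. u = \<psi> (Inr r, 2)}"
  \<comment> \<open>Composition returns the arrow that is not an identity. This is adequate because
    two non-identities are never composable: they start at nodes from I and end at nodes from
    R.\<close>
  define S where "S = \<lparr>Ob = OS, Ar = AS,
     Dom = (\<lambda>u. case \<phi> u of (Inl i, _) \<Rightarrow> \<psi> (Inl i, 0)
        | (Inr r, n) \<Rightarrow> if n = 0 then \<psi> (Inr r, 0) else if n = 1 then \<psi> (Inl (s r), 0) else \<psi> (Inl (t r), 0)),
     Cod = (\<lambda>u. \<psi> (fst (\<phi> u), 0)), Ide = (\<lambda>u. u), Cmp = (\<lambda>v u. if snd (\<phi> u) = 0 then v else u)\<rparr>"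
  have S: "Ob S = OS" "Ar S = AS" "Ide S = (\<lambda>u. u)" "Cmp S v u = (if snd (\<phi> u) = 0 then v else u)"
    "i \<in> I \<Longrightarrow> Dom S (\<psi> (Inl i, 0)) = \<psi> (Inl i, 0)" "r \<in> R \<Longrightarrow> Dom S (\<psi> (Inr r, 0)) = \<psi> (Inr r, 0)"
    "r \<in> R \<Longrightarrow> Dom S (\<psi> (Inr r, 1)) = \<psi> (Inl (s r), 0)" "r \<in> R \<Longrightarrow> Dom S (\<psi> (Inr r, 2)) = \<psi> (Inl (t r), 0)"
    "i \<in> I \<Longrightarrow> Cod S (\<psi> (Inl i, n)) = \<psi> (Inl i, 0)" "r \<in> R \<Longrightarrow> Cod S (\<psi> (Inr r, n)) = \<psi> (Inr r, 0)"
    for i r n u v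
    by (simp_all add: S_def)
  have \<psi>_eq: "\<psi> y = \<psi> z \<longleftrightarrow> y = z" if "y \<in> W" "z \<in> W" for y z
    using \<open>inj_on \<psi> W\<close> that by (auto simp: inj_on_def)
  have ar_cases: "(\<exists>i \<in> I. u = \<psi> (Inl i, 0)) \<or> (\<exists>r \<in> R. u = \<psi> (Inr r, 0)) \<or> (\<exists>r \<in> R. u = \<psi> (Inr r, 1)) \<or> (\<exists>r \<in> R. u = \<psi> (Inr r, 2))"
    if "u \<in> AS" for u using that by (auto simp: AS_def OS_def)
  have OS_I [simp]: "i \<in> I \<Longrightarrow> \<psi> (Inl i, 0) \<in> OS" "r \<in> R \<Longrightarrow> \<psi> (Inr r, 0) \<in> OS" 
    "i \<in> I \<Longrightarrow> \<psi> (Inl i, 0) \<in> AS" "r \<in> R \<Longrightarrow> \<psi> (Inr r, 0) \<in> AS" "r \<in> R \<Longrightarrow> \<psi> (Inr r, 1) \<in> AS" "r \<in> R \<Longrightarrow> \<psi> (Inr r, 2) \<in> AS" for i r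
    by (auto simp: OS_def AS_def)
  have dom0: "Dom S u = u \<and> Cod S u = u" if "u \<in> AS" "snd (\<phi> u) = 0" for u
    using ar_cases[OF that(1)] that(2) S by auto
  have dom1: "snd (\<phi> (Cod S u)) = 0 \<and> (\<exists>r \<in> R. Cod S u = \<psi> (Inr r, 0)) \<and> (\<exists>i \<in> I. Dom S u = \<psi> (Inl i, 0))"
    if "u \<in> AS" "snd (\<phi> u) \<noteq> 0" for u
    using ar_cases[OF that(1)] that(2) S s t by auto
  have only_id: "snd (\<phi> v) = 0" if uv: "u \<in> AS" "v \<in> AS" "Dom S v = Cod S u" "snd (\<phi> u) \<noteq> 0" for u v
  proof (rule ccontr)
    assume "snd (\<phi> v) \<noteq> 0"
    then obtain i where "i \<in> I" "Dom S v = \<psi> (Inl i, 0)" using dom1[OF uv(2)] by blast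
    moreover obtain r where "r \<in> R" "Cod S u = \<psi> (Inr r, 0)" using dom1[OF uv(1,4)] by blast
    ultimately show False using \<psi>_eq[of "(Inl i, 0)" "(Inr r, 0)"] uv(3) by simp
  qed
  have in_OS: "Dom S u \<in> OS" "Cod S u \<in> OS" if "u \<in> AS" for u
    using ar_cases[OF that] S s t by auto
  have OS_AS: "u \<in> AS \<and> snd (\<phi> u) = 0" if "u \<in> OS" for u
    using that by (auto simp: OS_def)
  have cat: "ordinary_category S"
  proof
    show "Dom S f \<in> Ob S \<and> Cod S f \<in> Ob S" if "f \<in> Ar S" for f
      using in_OS that by (simp add: S(1,2))
    show "Ide S x \<in> ahom S x x" if "x \<in> Ob S" for x
      using dom0 OS_AS that by (simp add: S(1-3) ahom_iff)
    show "Cmp S g f \<in> ahom S x z" if fg: "f \<in> ahom S x y" "g \<in> ahom S y z" for f g x y z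
    proof (cases "snd (\<phi> f) = 0")
      case True
      then have "x = y" using dom0[of f] fg(1) by (simp add: ahom_iff S(2))
      with True fg show ?thesis by (simp add: S(4))
    next
      case False
      then have "snd (\<phi> g) = 0" using fg by (intro only_id[of f g]) (simp_all add: ahom_iff S(2))
      then have "y = z" using dom0[of g] fg(2) by (simp add: ahom_iff S(2))
      with False fg show ?thesis by (simp add: S(4))
    qed
    show "Cmp S f (Ide S x) = f" if "f \<in> ahom S x y" for f x y
    proof -
      have "x \<in> OS" using that in_OS(1)[of f] by (simp add: ahom_iff S(2))
      then show ?thesis using OS_AS by (simp add: S(3,4))
    qed
    show "Cmp S (Ide S y) f = f" if "f \<in> ahom S x y" for f x y
      using that dom0[of f] by (simp add: ahom_iff S(2-4))
    show "Cmp S (Cmp S h g) f = Cmp S h (Cmp S g f)"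
      if fgh: "f \<in> ahom S w x" "g \<in> ahom S x y" "h \<in> ahom S y z" for f g h w x y z
    proof (cases "snd (\<phi> f) = 0")
      case False
      then have "snd (\<phi> g) = 0" using fgh by (intro only_id[of f g]) (simp_all add: ahom_iff S(2))
      then show ?thesis by (simp add: S(4))
    qed (simp add: S(4))
  qed
  define D0 where "D0 u = (case fst (\<phi> u) of Inl i \<Rightarrow> D i | Inr r \<Rightarrow> F r)" for u
  define D1 where "D1 u = (case \<phi> u of (Inl i, _) \<Rightarrow> Ide C (D i)
    | (Inr r, n) \<Rightarrow> if n = 0 then Ide C (F r) else if n = 1 then \<sigma> r else \<tau> r)" for u
  have D01: "i \<in> I \<Longrightarrow> D0 (\<psi> (Inl i, 0)) = D i" "r \<in> R \<Longrightarrow> D0 (\<psi> (Inr r, 0)) = F r"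
    "i \<in> I \<Longrightarrow> D1 (\<psi> (Inl i, 0)) = Ide C (D i)" "r \<in> R \<Longrightarrow> D1 (\<psi> (Inr r, 0)) = Ide C (F r)"
    "r \<in> R \<Longrightarrow> D1 (\<psi> (Inr r, 1)) = \<sigma> r" "r \<in> R \<Longrightarrow> D1 (\<psi> (Inr r, 2)) = \<tau> r" for i r
    by (simp_all add: D0_def D1_def)
  have D1_in: "D1 u \<in> ahom C (D0 (Dom S u)) (D0 (Cod S u))" if "u \<in> AS" for u
    using ar_cases[OF that] by (elim disjE bexE) (use S D01 \<sigma> \<tau> s t D F ide_in in \<open>simp_all\<close>)
  have D0_in: "D0 u \<in> Ob C" if "u \<in> OS" for u
    using that D F D01 by (auto simp: OS_def)
  have D1_id: "D1 u = Ide C (D0 u)" if "u \<in> AS" "snd (\<phi> u) = 0" for u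
    using ar_cases[OF that(1)] that(2) D01 by auto
  have diagram: "is_diagram S C D0 D1"
    unfolding is_diagram_def
  proof (intro conjI ballI impI)
    fix u v assume uv: "u \<in> Ar S" "v \<in> Ar S" "Cod S u = Dom S v"
    show "D1 (Cmp S v u) = Cmp C (D1 v) (D1 u)"
    proof (cases "snd (\<phi> u) = 0")
      case True
      then show ?thesis
        using uv D1_in[of v] dom0[of u] D1_id[of u] by (simp add: S(1-4) ide_right)
    next
      case False
      then have "snd (\<phi> v) = 0" using only_id[of u v] uv by (simp add: S(2))
      then show ?thesis
        using uv False D1_in[of u] dom0[of v] D1_id[of v] by (simp add: S(1-4) ide_left)
    qed
  qed (use D0_in D1_in D1_id OS_AS S(1-3) in auto)
  obtain L p where Lp: "is_limit S C D0 D1 L p"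
    using lim cat diagram unfolding has_small_limits_def by blast
  then have cone: "is_cone S C D0 D1 L p" by (simp add: is_limit_def)
  let ?p = "\<lambda>i. p (\<psi> (Inl i, 0))"
  have cone_eq: "Cmp C (\<sigma> r) (q (\<psi> (Inl (s r), 0))) = q (\<psi> (Inr r, 0))"
    "Cmp C (\<tau> r) (q (\<psi> (Inl (t r), 0))) = q (\<psi> (Inr r, 0))"
    if "is_cone S C D0 D1 Q q" "r \<in> R" for Q q r
  proof -
    have *: "Cmp C (D1 f) (q (Dom S f)) = q (Cod S f)" if "f \<in> AS" for f
      using \<open>is_cone S C D0 D1 Q q\<close> that by (simp add: is_cone_def S(2))
    show "Cmp C (\<sigma> r) (q (\<psi> (Inl (s r), 0))) = q (\<psi> (Inr r, 0))"
      using *[OF OS_I(5)[OF that(2)]] that(2) S D01 by simp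
    show "Cmp C (\<tau> r) (q (\<psi> (Inl (t r), 0))) = q (\<psi> (Inr r, 0))"
      using *[OF OS_I(6)[OF that(2)]] that(2) S D01 by simp
  qed
  have p_in: "p u \<in> ahom C L (D0 u)" if "u \<in> OS" for u
    using cone that by (simp add: is_cone_def S(1))
  show ?thesis
  proof (intro exI[of _ L] exI[of _ ?p] conjI ballI allI impI)
    show "L \<in> Ob C" using cone by (simp add: is_cone_def)
    show "?p i \<in> ahom C L (D i)" if "i \<in> I" for i
      using p_in[of "\<psi> (Inl i, 0)"] that D01 by simp
    show "Cmp C (\<sigma> r) (?p (s r)) = Cmp C (\<tau> r) (?p (t r))" if "r \<in> R" for r
      using cone_eq[OF cone that] by simp
    fix Q q assume q: "Q \<in> Ob C \<and> (\<forall>i \<in> I. q i \<in> ahom C Q (D i)) \<and>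
       (\<forall>r \<in> R. Cmp C (\<sigma> r) (q (s r)) = Cmp C (\<tau> r) (q (t r)))"
    \<comment> \<open>The leg at a node from R is the common value of the two composites; the leg
      for \<open>s r\<close> is used.\<close>
    define q' where "q' u = (case fst (\<phi> u) of Inl i \<Rightarrow> q i | Inr r \<Rightarrow> Cmp C (\<sigma> r) (q (s r)))" for u
    have q': "i \<in> I \<Longrightarrow> q' (\<psi> (Inl i, 0)) = q i" "r \<in> R \<Longrightarrow> q' (\<psi> (Inr r, 0)) = Cmp C (\<sigma> r) (q (s r))" for i r
      by (simp_all add: q'_def)
    have q'_in: "q' u \<in> ahom C Q (D0 u)" if "u \<in> OS" for u
    proof -
      have "Cmp C (\<sigma> r) (q (s r)) \<in> ahom C Q (F r)" if "r \<in> R" for r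
        using cmp_in[OF _ \<sigma>[OF that]] q s[OF that] by blast
      then show ?thesis using that q D01(1,2) q' unfolding OS_def by auto
    qed
    have "is_cone S C D0 D1 Q q'"
      unfolding is_cone_def
    proof (intro conjI ballI)
      fix f assume "f \<in> Ar S"
      then have "f \<in> AS" by (simp add: S(2))
      then show "Cmp C (D1 f) (q' (Dom S f)) = q' (Cod S f)"
      proof (cases "snd (\<phi> f) = 0")
        case True
        then show ?thesis using dom0[of f] D1_id[of f] q'_in[of f] in_OS[of f] \<open>f \<in> AS\<close> by (simp add: ide_left)
      next
        case False
        then show ?thesis using ar_cases[OF \<open>f \<in> AS\<close>]
          by (elim disjE bexE) (use S D01 q' s t q in simp_all)
      qed
    qed (use q q'_in S(1) in auto)
    then have ex1: "\<exists>!h. h \<in> ahom C Q L \<and> (\<forall>u \<in> OS. Cmp C (p u) h = q' u)"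
      using Lp by (simp add: is_limit_def S(1))
    have "(\<forall>u \<in> OS. Cmp C (p u) h = q' u) \<longleftrightarrow> (\<forall>i \<in> I. Cmp C (?p i) h = q i)" if h: "h \<in> ahom C Q L" for h
    proof
      assume "\<forall>u \<in> OS. Cmp C (p u) h = q' u"
      then show "\<forall>i \<in> I. Cmp C (?p i) h = q i" using q' by auto
    next
      assume *: "\<forall>i \<in> I. Cmp C (?p i) h = q i"
      have "Cmp C (p (\<psi> (Inr r, 0))) h = Cmp C (\<sigma> r) (q (s r))" if "r \<in> R" for r
      proof -
        have "Cmp C (p (\<psi> (Inr r, 0))) h = Cmp C (Cmp C (\<sigma> r) (?p (s r))) h"
          using cone_eq(1)[OF cone that] by simp
        also have "\<dots> = Cmp C (\<sigma> r) (Cmp C (?p (s r)) h)"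
          using h \<sigma>[OF that] p_in[of "\<psi> (Inl (s r), 0)"] s[OF that] D01 by (intro cmp_assoc) auto
        finally show ?thesis using * s[OF that] by simp
      qed
      with * show "\<forall>u \<in> OS. Cmp C (p u) h = q' u" using q' by (auto simp: OS_def)
    qed
    then have "(\<lambda>h. h \<in> ahom C Q L \<and> (\<forall>u \<in> OS. Cmp C (p u) h = q' u))
      = (\<lambda>h. h \<in> ahom C Q L \<and> (\<forall>i \<in> I. Cmp C (?p i) h = q i))"
      by (intro ext conj_cong refl)
    with ex1 show "\<exists>!h. h \<in> ahom C Q L \<and> (\<forall>i \<in> I. Cmp C (?p i) h = q i)" by simp
  qed
qed

text \<open>The bipartite shape with an empty set of relations.\<close>

lemma small_product:
  fixes I :: "'i set"
  assumes "ordinary_category C" "has_small_limits TYPE('u) C" "infinite (UNIV :: 'u set)"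
    "small_in TYPE('u) I" "\<And>i. i \<in> I \<Longrightarrow> D i \<in> Ob C"
  shows "\<exists>P p. is_product C I D P p"
proof -
  have "small_in TYPE('u) ({} :: unit set)" by (simp add: small_in_def)
  then have "\<exists>L p. L \<in> Ob C \<and> (\<forall>i \<in> I. p i \<in> ahom C L (D i)) \<and>
    (\<forall>Q q. Q \<in> Ob C \<and> (\<forall>i \<in> I. q i \<in> ahom C Q (D i)) \<longrightarrow>
       (\<exists>!h. h \<in> ahom C Q L \<and> (\<forall>i \<in> I. Cmp C (p i) h = q i)))"
    using small_bipartite_limit[OF assms(1-4), of "{} :: unit set" D] assms(5) by simp
  then obtain L p where L: "L \<in> Ob C \<and> (\<forall>i \<in> I. p i \<in> ahom C L (D i)) \<and>
    (\<forall>Q q. Q \<in> Ob C \<and> (\<forall>i \<in> I. q i \<in> ahom C Q (D i)) \<longrightarrow>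
       (\<exists>!h. h \<in> ahom C Q L \<and> (\<forall>i \<in> I. Cmp C (p i) h = q i)))" by (elim exE)
  show ?thesis unfolding is_product_def
  proof (intro exI conjI ballI allI impI)
    fix Q q assume "Q \<in> Ob C" "\<forall>i \<in> I. q i \<in> ahom C Q (D i)"
    with L show "\<exists>!h. h \<in> ahom C Q L \<and> (\<forall>i \<in> I. Cmp C (p i) h = q i)" by simp
  qed (use L in auto)
qed

lemma (in symmetric_monoidal_closed) cur_inject:
  assumes "cur V z x y f = cur V z x y f'" "f \<in> Ar V" "Dom V f = z \<otimes> x" "Cod V f = y"
    "f' \<in> Ar V" "Dom V f' = z \<otimes> x" "Cod V f' = y" "x \<in> Ob V" "z \<in> Ob V"
  shows "f = f'"
  using cur(2)[of f z x y] cur(2)[of f' z x y] assms by metis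

text \<open>Transposed, the naturality condition for K and L equates two arrows into
  [T(K, L), X(A K, B L)]. So the end is a limit of bipartite shape, with the objects of
  \<open>T\<close> as nodes and their pairs as relations, and a small set of objects has a small set
  of pairs.\<close>

lemma (in vcategory) small_hom_end:
  assumes lim: "has_small_limits TYPE('u) V" and inf: "infinite (UNIV :: 'u set)"
    and T: "vcategory V T" and small: "small_in TYPE('u) (vOb T)"
    and A: "prefunctor T X A" and B: "prefunctor T X B"
  shows "\<exists>E p. is_hom_end V T X A B E p"
proof -
  interpret T: vcategory V T by fact
  note [simp] = prefunctorD[OF A] prefunctorD[OF B]
  let ?D = "\<lambda>K. vHom X (FO A K) (FO B K)"
  define F where "F r = ihom V (vHom T (fst r) (snd r)) (vHom X (FO A (fst r)) (FO B (snd r)))" for r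
  define \<sigma> where "\<sigma> r = (case r of (K, L) \<Rightarrow> cur V (?D L) (vHom T K L) (vHom X (FO A K) (FO B L))
    (vc X (FO A K) (FO A L) (FO B L) (Ide V (?D L)) (FH A K L)))" for r
  define \<tau> where "\<tau> r = (case r of (K, L) \<Rightarrow> cur V (?D K) (vHom T K L) (vHom X (FO A K) (FO B L))
    (vc X (FO A K) (FO B K) (FO B L) (FH B K L) (Ide V (?D K)) \<cdot> sym_ar V (?D K) (vHom T K L)))" for r
  \<comment> \<open>Naturality as equality of transposes: \<sigma> and \<tau> are the transposes of
    the two sides for the universal arguments, and currying is injective.\<close>
  have nat: "natural_family V T X A B Q q \<longleftrightarrow> Q \<in> Ob V \<and> (\<forall>K \<in> vOb T. q K \<in> ahom V Q (?D K)) \<and>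
      (\<forall>r \<in> vOb T \<times> vOb T. \<sigma> r \<cdot> q (snd r) = \<tau> r \<cdot> q (fst r))" for Q q
  proof -
    have key: "vc X (FO A K) (FO A L) (FO B L) (q L) (FH A K L) = vc X (FO A K) (FO B K) (FO B L) (FH B K L) (q K) \<cdot> sym_ar V Q (vHom T K L)
      \<longleftrightarrow> \<sigma> (K, L) \<cdot> q L = \<tau> (K, L) \<cdot> q K"
      if q: "Q \<in> Ob V" "\<forall>K \<in> vOb T. q K \<in> ahom V Q (?D K)" and [simp]: "K \<in> vOb T" "L \<in> vOb T" for K L
    proof -
      have [simp]: "Q \<in> Ob V" "K \<in> vOb T \<Longrightarrow> q K \<in> Ar V" "K \<in> vOb T \<Longrightarrow> Dom V (q K) = Q" "K \<in> vOb T \<Longrightarrow> Cod V (q K) = ?D K" for K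
        using q by (auto simp: ahom_iff)
      let ?l = "vc X (FO A K) (FO A L) (FO B L) (q L) (FH A K L)"
      let ?r = "vc X (FO A K) (FO B K) (FO B L) (FH B K L) (q K) \<cdot> sym_ar V Q (vHom T K L)"
      let ?c = "cur V Q (vHom T K L) (vHom X (FO A K) (FO B L))"
      have l: "\<sigma> (K, L) \<cdot> q L = ?c ?l"
        using vc_Cmp_left[of "FO A K" "FO A L" "FO B L" "Ide V (?D L)" "FH A K L" "q L"]
        by (simp add: \<sigma>_def cur_Cmp)
      have r: "\<tau> (K, L) \<cdot> q K = ?c ?r"
        using vc_Cmp_right[of "FO A K" "FO B K" "FO B L" "FH B K L" "Ide V (?D K)" "q K"]
        by (simp add: \<tau>_def cur_Cmp sym_natural)
      show ?thesis unfolding l r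
        by (rule iffI[OF arg_cong], assumption, erule cur_inject) auto
    qed
    have pairs: "(\<forall>r \<in> vOb T \<times> vOb T. \<sigma> r \<cdot> q (snd r) = \<tau> r \<cdot> q (fst r))
      \<longleftrightarrow> (\<forall>K \<in> vOb T. \<forall>L \<in> vOb T. \<sigma> (K, L) \<cdot> q L = \<tau> (K, L) \<cdot> q K)"
      by (simp only: split_paired_Ball_Sigma fst_conv snd_conv)
    show ?thesis unfolding natural_family_iff pairs
      by (intro conj_cong ball_cong refl) (rule key)
  qed
  have "F r \<in> Ob V" "\<sigma> r \<in> ahom V (?D (snd r)) (F r)" "\<tau> r \<in> ahom V (?D (fst r)) (F r)"
    if "r \<in> vOb T \<times> vOb T" for r
    using that by (auto simp: F_def \<sigma>_def \<tau>_def ahom_iff)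
  then have "\<exists>E p. E \<in> Ob V \<and> (\<forall>K \<in> vOb T. p K \<in> ahom V E (?D K)) \<and>
      (\<forall>r \<in> vOb T \<times> vOb T. \<sigma> r \<cdot> p (snd r) = \<tau> r \<cdot> p (fst r)) \<and>
      (\<forall>Q q. Q \<in> Ob V \<and> (\<forall>K \<in> vOb T. q K \<in> ahom V Q (?D K)) \<and>
      (\<forall>r \<in> vOb T \<times> vOb T. \<sigma> r \<cdot> q (snd r) = \<tau> r \<cdot> q (fst r)) \<longrightarrow>
      (\<exists>!h. h \<in> ahom V Q E \<and> (\<forall>K \<in> vOb T. p K \<cdot> h = q K)))"
    by (intro small_bipartite_limit[OF ordinary_category_axioms lim inf small small_in_Times[OF inf small small],
        where F = F]) (auto simp del: split_paired_Ball_Sigma)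
  then obtain E p where "E \<in> Ob V \<and> (\<forall>K \<in> vOb T. p K \<in> ahom V E (?D K)) \<and>
      (\<forall>r \<in> vOb T \<times> vOb T. \<sigma> r \<cdot> p (snd r) = \<tau> r \<cdot> p (fst r)) \<and>
      (\<forall>Q q. Q \<in> Ob V \<and> (\<forall>K \<in> vOb T. q K \<in> ahom V Q (?D K)) \<and>
      (\<forall>r \<in> vOb T \<times> vOb T. \<sigma> r \<cdot> q (snd r) = \<tau> r \<cdot> q (fst r)) \<longrightarrow>
      (\<exists>!h. h \<in> ahom V Q E \<and> (\<forall>K \<in> vOb T. p K \<cdot> h = q K)))" by (elim exE)
  then show ?thesis unfolding is_hom_end_def nat
    by - (rule exI[of _ E], rule exI[of _ p], elim conjE, intro conjI; assumption)
qed

section \<open>Enlarging the base\<close>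

locale smc_enlargement = V: symmetric_monoidal_closed V + V': symmetric_monoidal_closed V'
  for V V' :: "('o, 'a) smc" +
  assumes full: "full_smc_subcategory V V'"
begin

lemma Ob_enlarge [simp]: "x \<in> Ob V \<Longrightarrow> x \<in> Ob V'"
  using full by (auto simp: full_smc_subcategory_def)

lemma Ar_enlarge [simp]:
  "f \<in> Ar V \<Longrightarrow> f \<in> Ar V'" "f \<in> Ar V \<Longrightarrow> Dom V' f = Dom V f" "f \<in> Ar V \<Longrightarrow> Cod V' f = Cod V f"
  using full by (auto simp: full_smc_subcategory_def)

lemma enlarge_simps [simp]:
  "x \<in> Ob V \<Longrightarrow> Ide V' x = Ide V x"
  "f \<in> Ar V \<Longrightarrow> g \<in> Ar V \<Longrightarrow> Dom V g = Cod V f \<Longrightarrow> Cmp V' g f = Cmp V g f"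
  "x \<in> Ob V \<Longrightarrow> y \<in> Ob V \<Longrightarrow> tensor_ob V' x y = tensor_ob V x y"
  "f \<in> Ar V \<Longrightarrow> g \<in> Ar V \<Longrightarrow> tensor_ar V' f g = tensor_ar V f g"
  "unit_ob V' = unit_ob V"
  "x \<in> Ob V \<Longrightarrow> y \<in> Ob V \<Longrightarrow> z \<in> Ob V \<Longrightarrow> assoc_ar V' x y z = assoc_ar V x y z"
  "x \<in> Ob V \<Longrightarrow> lunit_ar V' x = lunit_ar V x"
  "x \<in> Ob V \<Longrightarrow> runit_ar V' x = runit_ar V x"
  "x \<in> Ob V \<Longrightarrow> y \<in> Ob V \<Longrightarrow> sym_ar V' x y = sym_ar V x y"
  "x \<in> Ob V \<Longrightarrow> y \<in> Ob V \<Longrightarrow> ihom V' x y = ihom V x y"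
  "x \<in> Ob V \<Longrightarrow> y \<in> Ob V \<Longrightarrow> ev_ar V' x y = ev_ar V x y"
  by (insert full, unfold full_smc_subcategory_def, (elim conjE, rule sym, blast dest: sym)+)

lemma ahom_enlarge [simp]: "x \<in> Ob V \<Longrightarrow> y \<in> Ob V \<Longrightarrow> ahom V' x y = ahom V x y"
proof -
  assume xy: "x \<in> Ob V" "y \<in> Ob V"
  have eq: "Ar V = {f \<in> Ar V'. Dom V' f \<in> Ob V \<and> Cod V' f \<in> Ob V}"
    using full unfolding full_smc_subcategory_def by (elim conjE)
  have "f \<in> ahom V' x y \<longleftrightarrow> f \<in> ahom V x y" for f
  proof
    assume f: "f \<in> ahom V' x y"
    then have "f \<in> Ar V" unfolding eq using xy by (simp add: ahom_iff)
    with f show "f \<in> ahom V x y" by (simp add: ahom_iff)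
  qed (simp add: ahom_iff)
  then show ?thesis by blast
qed

text \<open>Evaluation is shared by both bases, so the transpose in the small base satisfies the
  property that characterizes the one in the enlargement.\<close>

lemma cur_enlarge [simp]:
  assumes "f \<in> Ar V" "Dom V f = tensor_ob V z x" "Cod V f = y" "x \<in> Ob V" "z \<in> Ob V"
  shows "cur V' z x y f = cur V z x y f"
  using assms V.Cod_Ob[of f] by (intro V'.cur_eqI) auto

lemma is_iso_enlarge: "is_iso V f \<Longrightarrow> is_iso V' f"
  unfolding is_iso_def by (auto simp: ahom_iff intro!: bexI)

lemma vcategory_enlarge:
  assumes "vcategory V X"
  shows "vcategory V' X"
proof -
  interpret vcategory V X by fact
  have [simp]: "tensor_ob V x y \<in> Ob V" if "x \<in> Ob V" "y \<in> Ob V" for x y using that by simp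
  show ?thesis
  proof
    show "vCmp X x y z \<in> ahom V' (tensor_ob V' (vHom X y z) (vHom X x y)) (vHom X x z)"
      if "x \<in> vOb X" "y \<in> vOb X" "z \<in> vOb X" for x y z
      using vCmp_in that by simp
    show "vIde X x \<in> ahom V' (unit_ob V') (vHom X x x)" if "x \<in> vOb X" for x
      using vIde_in that by simp
    show "Cmp V' (vCmp X w x z) (tensor_ar V' (vCmp X x y z) (Ide V' (vHom X w x)))
        = Cmp V' (Cmp V' (vCmp X w y z) (tensor_ar V' (Ide V' (vHom X y z)) (vCmp X w x y)))
            (assoc_ar V' (vHom X y z) (vHom X x y) (vHom X w x))"
      if "w \<in> vOb X" "x \<in> vOb X" "y \<in> vOb X" "z \<in> vOb X" for w x y z
      using vCmp_assoc that by simp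
  qed (use vIde_right vIde_left in auto)
qed

lemma enriched_functor_enlarge:
  assumes F: "enriched_functor V X Y F" and "vcategory V X" "vcategory V Y"
  shows "enriched_functor V' X Y F"
proof -
  interpret X: vcategory V X by fact
  interpret Y: vcategory V Y by fact
  have [simp]: "FO F x \<in> vOb Y" "FH F x y \<in> Ar V" "Dom V (FH F x y) = vHom X x y"
    "Cod V (FH F x y) = vHom Y (FO F x) (FO F y)" if "x \<in> vOb X" "y \<in> vOb X" for x y
    using F that by (auto simp: enriched_functor_def ahom_iff)
  show ?thesis using F by (simp add: enriched_functor_def)
qed

text \<open>Over \<open>V'\<close> the bijection is required for more objects E. The detour through
  \<open>is_cotensor\<close> avoids them: the comparison into [W, X(y, x)] is the same arrow over
  both bases, and an inverse in \<open>V\<close> remains one in \<open>V'\<close>.\<close>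

lemma universal_counit_enlarge:
  assumes "vcategory V X" "V.universal_counit X W x P k"
  shows "V'.universal_counit X W x P k"
proof -
  interpret X: vcategory V X by fact
  interpret X': vcategory V' X by (rule vcategory_enlarge) fact
  note [simp] = V.universal_counitD[OF assms(2)]
  have "is_cotensor V X W x P k"
    using assms(2) by (simp add: X.is_cotensor_iff_universal_counit)
  then have "is_cotensor V' X W x P k"
    unfolding is_cotensor_def using is_iso_enlarge by (auto simp: ahom_iff)
  then show ?thesis by (simp add: X'.is_cotensor_iff_universal_counit)
qed

text \<open>Here the objects E of \<open>V\<close> are among those of \<open>V'\<close>, and
  fullness keeps the factorizing arrows in \<open>V\<close>.\<close>

lemma universal_counit_restrict:
  assumes "vcategory V X" "V'.universal_counit X W x P k" "W \<in> Ob V"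
  shows "V.universal_counit X W x P k"
proof -
  interpret X: vcategory V X by fact
  note [simp] = V'.universal_counitD[OF assms(2)] assms(3)
  have k: "k \<in> ahom V W (vHom X P x)" using assms(2) by (simp add: V'.universal_counit_def)
  then have [simp]: "k \<in> Ar V" "Dom V k = W" "Cod V k = vHom X P x" by (auto simp: ahom_iff)
  have vc: "V'.vc X y P x k t = V.vc X y P x k t" if "y \<in> vOb X" "t \<in> ahom V E (vHom X y P)" for y E t
    using that by (auto simp: V'.vc_def V.vc_def ahom_iff)
  have "\<exists>!t. t \<in> ahom V E (vHom X y P) \<and> V.vc X y P x k t = s"
    if "y \<in> vOb X" "E \<in> Ob V" "s \<in> ahom V (tensor_ob V W E) (vHom X y x)" for y E s
  proof -
    have "E \<in> Ob V'" "s \<in> ahom V' (tensor_ob V' W E) (vHom X y x)"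
      using that by simp_all
    then have "\<exists>!t. t \<in> ahom V' E (vHom X y P) \<and> V'.vc X y P x k t = s"
      using assms(2)[unfolded V'.universal_counit_def, THEN conjunct2, THEN conjunct2, THEN conjunct2, THEN conjunct2,
          THEN bspec[of _ _ y], THEN bspec[of _ _ E], THEN bspec[of _ _ s]] that(1) by simp
    moreover have "(\<lambda>t. t \<in> ahom V' E (vHom X y P) \<and> V'.vc X y P x k t = s)
      = (\<lambda>t. t \<in> ahom V E (vHom X y P) \<and> V.vc X y P x k t = s)"
      using that vc by auto
    ultimately show ?thesis by simp
  qed
  then show ?thesis using k by (simp add: V.universal_counit_def)
qed

lemma arities_op_functor_enlarge:
  assumes F: "enriched_functor V (arities_op V \<J>) U F" and "vcategory V U" and \<J>: "\<J> \<subseteq> Ob V"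
  shows "enriched_functor V' (arities_op V' \<J>) U F"
proof -
  interpret U: vcategory V U by fact
  have [simp]: "x \<in> Ob V" if "x \<in> \<J>" for x using that \<J> by auto
  have [simp]: "FO F x \<in> vOb U" "FH F x y \<in> Ar V" "Dom V (FH F x y) = ihom V y x"
    "Cod V (FH F x y) = vHom U (FO F x) (FO F y)" if "x \<in> \<J>" "y \<in> \<J>" for x y
    using F that by (auto simp: enriched_functor_def ahom_iff)
  have cmp: "vCmp (arities_op V' \<J>) x y z = vCmp (arities_op V \<J>) x y z"
    "vCmp (arities_op V \<J>) x y z \<in> Ar V" "Dom V (vCmp (arities_op V \<J>) x y z) = tensor_ob V (ihom V z y) (ihom V y x)"
    "Cod V (vCmp (arities_op V \<J>) x y z) = ihom V z x"
    if "x \<in> \<J>" "y \<in> \<J>" "z \<in> \<J>" for x y z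
    using that by (auto simp: V.vCmp_arities_op V'.vCmp_arities_op) (auto simp: self_enriched_def)
  have ide: "vIde (arities_op V' \<J>) x = vIde (arities_op V \<J>) x"
    "vIde (arities_op V \<J>) x \<in> Ar V" "Cod V (vIde (arities_op V \<J>) x) = ihom V x x" if "x \<in> \<J>" for x
    using that by (auto simp: arities_op_def vop_def self_enriched_def)
  show ?thesis using F by (simp add: enriched_functor_def cmp ide)
qed

end

context symmetric_monoidal_closed
begin

section \<open>Composites of algebras with functors preserving cotensors\<close>

lemma enriched_functor_comp:
  assumes F: "enriched_functor V X Y F" and G: "enriched_functor V Y Z G"
    and X: "vcategory V X" and Y: "vcategory V Y" and Z: "vcategory V Z"
  shows "enriched_functor V X Z (vfun_comp V G F)"
proof -
  interpret X: vcategory V X by fact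
  interpret Y: vcategory V Y by fact
  interpret Z: vcategory V Z by fact
  interpret F: vfunctor V X Y F using F by unfold_locales
  interpret G: vfunctor V Y Z G using G by unfold_locales
  have "FH G (FO F x) (FO F z) \<cdot> (FH F x z \<cdot> vCmp X x y z)
    = vCmp Z (FO G (FO F x)) (FO G (FO F y)) (FO G (FO F z)) \<cdot>
       ((FH G (FO F y) (FO F z) \<cdot> FH F y z) \<odot> (FH G (FO F x) (FO F y) \<cdot> FH F x y))"
    if "x \<in> vOb X" "y \<in> vOb X" "z \<in> vOb X" for x y z
  proof -
    have "FH F x z \<cdot> vCmp X x y z = vc Y (FO F x) (FO F y) (FO F z) (FH F y z) (FH F x y)"
      using F that by (simp add: enriched_functor_def vc_def)
    then show ?thesis using that by (simp add: G.H_vc) (simp add: vc_def)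
  qed
  then show ?thesis
    unfolding enriched_functor_def by (auto simp: vfun_comp_def ahom_iff F.H_vIde G.H_vIde)
qed

lemma preserves_cotensors_comp:
  assumes F: "prefunctor X Y F" and G: "prefunctor Y Z G"
    and X: "vcategory V X" 
    and "preserves_cotensors V \<J> X Y F" "preserves_cotensors V \<J> Y Z G"
  shows "preserves_cotensors V \<J> X Z (vfun_comp V G F)"
  unfolding preserves_cotensors_def
proof (intro ballI allI impI)
  interpret X: vcategory V X by fact
  note [simp] = prefunctorD[OF F] prefunctorD[OF G]
  fix J x P k assume J: "J \<in> \<J>" and k: "is_cotensor V X J x P k"
  then have [simp]: "x \<in> vOb X" "P \<in> vOb X" "k \<in> Ar V" "Dom V k = J" "Cod V k = vHom X P x"
    by (auto simp: is_cotensor_def ahom_iff)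
  have "is_cotensor V Z J (FO G (FO F x)) (FO G (FO F P)) (FH G (FO F P) (FO F x) \<cdot> (FH F P x \<cdot> k))"
    using assms(4,5) J k by (simp add: preserves_cotensors_def)
  then show "is_cotensor V Z J (FO (vfun_comp V G F) x) (FO (vfun_comp V G F) P) (FH (vfun_comp V G F) P x \<cdot> k)"
    by (simp add: vfun_comp_def)
qed

text \<open>In the opposite of the arities, J is the cotensor [J, \<one>] by
  \<open>name_universal_counit\<close>. The structure functor carries this to \<open>T\<close>, with
  the generic operation as counit, and \<open>A\<close> carries it on to \<open>X\<close>.\<close>

lemma algebra_generic_counit:
  assumes \<J>: "system_of_arities V \<J>" and T: "is_theory V \<J> T" and A: "is_algebra V \<J> T X A" and X: "vcategory V X"
    and J: "J \<in> \<J>"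
  shows "universal_counit X J (FO A \<one>) (FO A J) (FH A J \<one> \<cdot> generic_op T J)"
proof -
  interpret X: vcategory V X by fact
  have \<J>': "\<J> \<subseteq> Ob V" "\<one> \<in> \<J>" using \<J> by (auto simp: system_of_arities_def)
  have "J \<in> Ob V" using \<J>' J by auto
  have "is_cotensor V (arities_op V \<J>) J \<one> J (cur V J \<one> J (runit_ar V J)) \<longleftrightarrow>
      universal_counit (arities_op V \<J>) J \<one> J (cur V J \<one> J (runit_ar V J))"
    using \<J>'(1) by (intro is_cotensor_iff) (auto simp: vCmp_arities_op ahom_iff subset_eq)
  then have "is_cotensor V (arities_op V \<J>) J \<one> J (cur V J \<one> J (runit_ar V J))"
    using name_universal_counit[OF \<J>' J] by simp
  then have "is_cotensor V T J (FO (str T) \<one>) (FO (str T) J) (generic_op T J)"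
    using T J unfolding is_theory_def preserves_cotensors_def generic_op_def by blast
  then have "is_cotensor V T J \<one> J (generic_op T J)"
    using T J \<J>' by (simp add: is_theory_def)
  then have "is_cotensor V X J (FO A \<one>) (FO A J) (FH A J \<one> \<cdot> generic_op T J)"
    using A J unfolding is_algebra_def preserves_cotensors_def by blast
  then show ?thesis by (simp add: X.is_cotensor_iff_universal_counit)
qed

lemma algebra_comp:
  assumes "is_theory V \<J> T" "is_algebra V \<J> T X A" and X: "vcategory V X" and Y: "vcategory V Y"
    and "enriched_functor V X Y H" "preserves_cotensors V \<J> X Y H"
  shows "is_algebra V \<J> T Y (vfun_comp V H A)"
proof -
  have T: "vcategory V T"
    using assms(1) symmetric_monoidal_closed_axioms by (simp add: is_theory_def vcategory_def)
  show ?thesis using assms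
    by (auto simp: is_algebra_def intro: enriched_functor_comp preserves_cotensors_comp enriched_functor_prefunctor T)
qed

end

context smc_enlargement
begin

lemma generic_op_enlarge:
  assumes "is_theory V \<J> T" "\<J> \<subseteq> Ob V" "unit_ob V \<in> \<J>" "J \<in> \<J>"
  shows "V'.generic_op T J = V.generic_op T J" "V.generic_op T J \<in> ahom V J (vHom T J (unit_ob V))"
proof -
  have T: "vcategory V T"
    using assms V.symmetric_monoidal_closed_axioms by (simp add: is_theory_def vcategory_def)
  have [simp]: "J \<in> Ob V" using assms by auto
  have "FH (str T) J (unit_ob V) \<in> Ar V" "Dom V (FH (str T) J (unit_ob V)) = ihom V (unit_ob V) J"
    using assms by (auto simp: is_theory_def enriched_functor_def ahom_iff)
  then show "V'.generic_op T J = V.generic_op T J"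
    by (simp add: V'.generic_op_def V.generic_op_def)
  show "V.generic_op T J \<in> ahom V J (vHom T J (unit_ob V))"
    using assms T by (intro V.generic_op_in) (auto simp: is_theory_def)
qed

lemma algebra_generic_counit_enlarge:
  assumes \<J>: "system_of_arities V \<J>" and T: "is_theory V \<J> T" and A: "is_algebra V \<J> T X A" and X: "vcategory V X"
    and J: "J \<in> \<J>"
  shows "V'.universal_counit X J (FO A (unit_ob V')) (FO A J) (Cmp V' (FH A J (unit_ob V')) (V'.generic_op T J))"
proof -
  have \<J>': "\<J> \<subseteq> Ob V" "unit_ob V \<in> \<J>" using \<J> by (auto simp: system_of_arities_def)
  have "V.universal_counit X J (FO A (unit_ob V)) (FO A J) (Cmp V (FH A J (unit_ob V)) (V.generic_op T J))"
    by (rule V.algebra_generic_counit) fact+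
  moreover have "Cmp V' (FH A J (unit_ob V)) (V.generic_op T J) = Cmp V (FH A J (unit_ob V)) (V.generic_op T J)"
    using A T J \<J>' generic_op_enlarge(2)[OF T \<J>' J]
    by (auto simp: is_algebra_def enriched_functor_def ahom_iff is_theory_def)
  ultimately show ?thesis
    using universal_counit_enlarge[OF X] generic_op_enlarge(1)[OF T \<J>' J] by simp
qed

text \<open>The objects of a theory are the arities, a small set. This is where the ends that define
  categories of algebras come from, although they are only asserted over \<open>V'\<close>.\<close>

lemma algebra_pair_over_enlargement:
  assumes \<J>: "system_of_arities V \<J>" and X: "vcategory V X" and desig: "designated_cotensors V \<J> X"
    and lim: "has_small_limits TYPE('u) V'" and inf: "infinite (UNIV :: 'u set)" and small: "small_in TYPE('u) \<J>"
    and pair: "algebra_pair V \<J> X T A U B"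
  shows "algebra_pair_over V' X T U \<J> A B"
proof -
  interpret X: vcategory V X by fact
  interpret X': vcategory V' X by (rule vcategory_enlarge) fact
  have T: "is_theory V \<J> T" and U: "is_theory V \<J> U" and A: "is_algebra V \<J> T X A" and B: "is_algebra V \<J> U X B"
    and AB: "FO A (unit_ob V) = FO B (unit_ob V)"
    using pair by (auto simp: algebra_pair_def)
  have \<J>': "\<J> \<subseteq> Ob V" "unit_ob V \<in> \<J>" using \<J> by (auto simp: system_of_arities_def)
  have VT: "vcategory V T" and VU: "vcategory V U"
    using T U V.symmetric_monoidal_closed_axioms by (auto simp: is_theory_def vcategory_def)
  interpret T': vcategory V' T by (rule vcategory_enlarge[OF VT])
  interpret U': vcategory V' U by (rule vcategory_enlarge[OF VU])
  have TU: "vOb T = \<J>" "vOb U = \<J>" using T U by (auto simp: is_theory_def)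
  show ?thesis
  proof
    show "\<J> \<subseteq> Ob V'" using \<J>' by auto
    show "unit_ob V' \<in> \<J>" using \<J>' by simp
    show "enriched_functor V' (arities_op V' \<J>) U (str U)"
      using U by (intro arities_op_functor_enlarge VU \<J>') (simp add: is_theory_def)
    show "\<forall>J \<in> \<J>. FO (str U) J = J" using U by (simp add: is_theory_def)
    show "enriched_functor V' T X A" "enriched_functor V' U X B"
      using A B by (auto simp: is_algebra_def intro: enriched_functor_enlarge VT VU X)
    show "FO A (unit_ob V') = FO B (unit_ob V')" using AB by simp
    show "V'.generic_op T L \<in> ahom V' L (vHom T L (unit_ob V'))" if "L \<in> \<J>" for L
    proof -
      have "L \<in> Ob V" "vHom T L (unit_ob V) \<in> Ob V" 
        using that \<J>' TU enriched_category.vHom_in[of V T] VT by (auto simp: vcategory_def)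
      then show ?thesis using generic_op_enlarge[OF T \<J>' that] by simp
    qed
    show "V'.universal_counit X L (FO A (unit_ob V')) (FO A L) (Cmp V' (FH A L (unit_ob V')) (V'.generic_op T L))" if "L \<in> \<J>" for L
      by (rule algebra_generic_counit_enlarge[OF \<J> T A X that])
    show "V'.universal_counit X L (FO B (unit_ob V')) (FO B L) (Cmp V' (FH B L (unit_ob V')) (V'.generic_op U L))" if "L \<in> \<J>" for L
      by (rule algebra_generic_counit_enlarge[OF \<J> U B X that])
    show "V'.universal_counit X J x (cotn X J x) (coun X J x)" if "J \<in> \<J>" "x \<in> vOb X" for J x
      using desig that by (intro universal_counit_enlarge X)
        (simp add: designated_cotensors_def X.is_cotensor_iff_universal_counit)
    show "cotn X (unit_ob V') x = x" "coun X (unit_ob V') x = vIde X x" if "x \<in> vOb X" for x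
      using desig that by (auto simp: designated_cotensors_def)
    show "\<exists>e p. is_hom_end V' T X D D' e p" if "V'.prefunctor T X D" "V'.prefunctor T X D'" for D D'
      using X'.small_hom_end[OF lim inf T'.vcategory_axioms _ that] small TU by simp
  qed (rule TU)+
qed

end

text \<open>Joint faithfulness speaks of a single morphism into a product. Arrows that agree after
  each functor agree after that morphism, by uniqueness of tupling, and it is monic.\<close>

lemma (in symmetric_monoidal_closed) jointly_faithful_eqI:
  assumes prod: "is_product V \<Lambda> (\<lambda>l. vHom (Y l) (FO (H l) x) (FO (H l) y)) Q r"
    and jf: "jointly_faithful V X \<Lambda> Y H" and x: "x \<in> vOb X" "y \<in> vOb X" and X: "vcategory V X"
    and H: "\<And>l. l \<in> \<Lambda> \<Longrightarrow> FH (H l) x y \<in> ahom V (vHom X x y) (vHom (Y l) (FO (H l) x) (FO (H l) y))"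
    and gh: "g \<in> Ar V" "h \<in> Ar V" "Dom V g = Dom V h" "Cod V g = vHom X x y" "Cod V h = vHom X x y"
    and eq: "\<And>l. l \<in> \<Lambda> \<Longrightarrow> FH (H l) x y \<cdot> g = FH (H l) x y \<cdot> h"
  shows "g = h"
proof -
  interpret X: vcategory V X by fact
  let ?D = "\<lambda>l. vHom (Y l) (FO (H l) x) (FO (H l) y)"
  let ?P = "prod_ob V \<Lambda> ?D" and ?p = "prod_proj V \<Lambda> ?D"
  \<comment> \<open>Existence of some product makes the arbitrarily chosen \<open>prod_cone\<close>
    one.\<close>
  have "\<exists>Pp. case Pp of (P, p) \<Rightarrow> is_product V \<Lambda> ?D P p" using prod by auto
  from someI_ex[OF this] have P: "is_product V \<Lambda> ?D ?P ?p"
    by (auto simp: prod_cone_def prod_ob_def prod_proj_def split: prod.splits)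
  have ex1: "\<exists>!u. u \<in> ahom V Q ?P \<and> (\<forall>l \<in> \<Lambda>. ?p l \<cdot> u = q l)"
    if "Q \<in> Ob V" "\<forall>l \<in> \<Lambda>. q l \<in> ahom V Q (?D l)" for Q q
    using P that by (simp add: is_product_def)
  define t where "t = prod_tuple V \<Lambda> ?D (vHom X x y) (\<lambda>l. FH (H l) x y)"
  have t: "t \<in> ahom V (vHom X x y) ?P \<and> (\<forall>l \<in> \<Lambda>. ?p l \<cdot> t = FH (H l) x y)"
    unfolding t_def prod_tuple_def by (rule theI'[OF ex1]) (use H x in auto)
  have p: "l \<in> \<Lambda> \<Longrightarrow> ?p l \<in> ahom V ?P (?D l)" for l
    using P by (simp add: is_product_def)
  have pt: "?p l \<cdot> (t \<cdot> u) = FH (H l) x y \<cdot> u" if "l \<in> \<Lambda>" "u \<in> Ar V" "Cod V u = vHom X x y" for l u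
  proof -
    have "?p l \<cdot> (t \<cdot> u) = (?p l \<cdot> t) \<cdot> u"
      using p[OF that(1)] t that by (subst Cmp_assoc) (auto simp: ahom_iff)
    then show ?thesis using t that(1) by simp
  qed
  have u: "\<forall>l \<in> \<Lambda>. FH (H l) x y \<cdot> h \<in> ahom V (Dom V h) (?D l)"
    using H gh by (auto simp: ahom_iff)
  have "t \<cdot> g = t \<cdot> h"
  proof -
    have "\<exists>!u. u \<in> ahom V (Dom V h) ?P \<and> (\<forall>l \<in> \<Lambda>. ?p l \<cdot> u = FH (H l) x y \<cdot> h)"
      using gh by (intro ex1 u) simp
    moreover have "t \<cdot> g \<in> ahom V (Dom V h) ?P" "t \<cdot> h \<in> ahom V (Dom V h) ?P"
      using t gh by (auto simp: ahom_iff)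
    moreover have "\<forall>l \<in> \<Lambda>. ?p l \<cdot> (t \<cdot> g) = FH (H l) x y \<cdot> h" "\<forall>l \<in> \<Lambda>. ?p l \<cdot> (t \<cdot> h) = FH (H l) x y \<cdot> h"
      using pt gh eq by auto
    ultimately show ?thesis by (metis (no_types, lifting))
  qed
  moreover have "monic V t"
    using jf x by (auto simp: jointly_faithful_def faithful_def vprod_induced_def t_def)
  ultimately show ?thesis
    using t gh unfolding monic_def by (auto simp: ahom_iff)
qed

context symmetric_monoidal_closed
begin

lemma truncate_simps [simp]:
  "vOb (vcat.truncate Y) = vOb Y" "vHom (vcat.truncate Y) = vHom Y" "vCmp (vcat.truncate Y) = vCmp Y"
  "vIde (vcat.truncate Y) = vIde Y"
  by (simp_all add: vcat.truncate_def)

text \<open>\<V> is \<open>self_enriched V\<close> extended by designated cotensors. These notions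
  see only the underlying enriched category, so facts about \<open>self_enriched V\<close> pass to
  \<V>.\<close>

lemma truncate_iff:
  "enriched_functor V X (vcat.truncate Y) F \<longleftrightarrow> enriched_functor V X Y F"
  "universal_counit (vcat.truncate Y) W x P k \<longleftrightarrow> universal_counit Y W x P k"
  "enriched_category V (vcat.truncate Y) \<longleftrightarrow> enriched_category V Y"
  by (simp_all add: enriched_functor_def universal_counit_def vc_def enriched_category_def)

end

theorem corollary12p5:
  fixes V V' :: "('o, 'a) smc"
    and \<J> :: "'o set"
    and \<V> :: "('o, 'o, 'a) cvcat"
    and \<C> :: "('c, 'o, 'a) cvcat"
    and \<G> :: "'c set"
  assumes "symmetric_monoidal_closed V"
    and "universe_enlargement TYPE('u) V V'"
    and "has_pullbacks V"
    and "system_of_arities V \<J>"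
    and "vcat.truncate \<V> = self_enriched V"
    and "designated_cotensors V \<J> \<V>"
    and "enriched_category V \<C>"
    and "small_in TYPE('u) (vOb \<C>)"
    and "admissible V \<J> \<C>"
    and "generating_class V V' \<C> \<G>"
  shows "jointly_reflects_commuting V V' \<J> \<C> \<G> (\<lambda>_. \<V>) (representable V \<C>) \<and>
    (\<forall>T A U B. algebra_pair V \<J> \<C> T A U B \<longrightarrow>
       (commutes V V' \<J> \<C> T A U B \<longleftrightarrow>
        (\<forall>X \<in> \<G>. commutes V V' \<J> \<V> T (vfun_comp V (representable V \<C> X) A)
                                         U (vfun_comp V (representable V \<C> X) B))))"
proof -
  interpret V: symmetric_monoidal_closed V by fact
  have enl: "symmetric_monoidal_closed V'" "full_smc_subcategory V V'" "has_small_limits TYPE('u) V'"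
    "infinite (UNIV :: 'u set)" "small_in TYPE('u) (Ob V)"
    using assms(2) by (auto simp: universe_enlargement_def)
  interpret V': symmetric_monoidal_closed V' by fact
  interpret smc_enlargement V V' using enl(2) by unfold_locales
  have \<J>: "\<J> \<subseteq> Ob V" "unit_ob V \<in> \<J>" using assms(4) by (auto simp: system_of_arities_def)
  have small_\<J>: "small_in TYPE('u) \<J>" using enl(5) \<J>(1) by (rule small_in_subset)
  have \<G>: "\<G> \<subseteq> vOb \<C>" and jf: "jointly_faithful V' \<C> \<G> (\<lambda>_. self_enriched V) (representable V \<C>)"
    using assms(10) by (auto simp: generating_class_def)
  have C: "vcategory V \<C>" using assms(1,7) by (simp add: vcategory_def)
  interpret C: vcategory V \<C> by (rule C)
  interpret C': vcategory V' \<C> by (rule vcategory_enlarge[OF C])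
  have Vcat: "vcategory V \<V>"
    using V.self_enriched_category assms(1,5) V.truncate_iff(3)[of \<V>] by (simp add: vcategory_def)
  interpret VV: vcategory V \<V> by (rule Vcat)
  interpret VV': vcategory V' \<V> by (rule vcategory_enlarge[OF Vcat])
  have \<V>_simps: "vOb \<V> = Ob V" "vHom \<V> = ihom V"
    using V.truncate_simps[of \<V>] assms(5) V.self_enriched_simps by simp_all
  let ?H = "representable V \<C>"
  have H: "enriched_functor V \<C> \<V> (?H X)" if "X \<in> \<G>" for X
    using C.representable_functor[of X] that \<G> V.truncate_iff(1)[of \<C> \<V>] assms(5) by auto
  have H_counit: "V.universal_counit \<V> W (FO (?H X) x) (FO (?H X) P) (Cmp V (FH (?H X) P x) k)"
    if "X \<in> \<G>" "V.universal_counit \<C> W x P k" for X W x P k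
    using C.representable_universal_counit[of X W x P k] that \<G> V.truncate_iff(2)[of \<V>] assms(5) by auto
  have H_pres: "preserves_cotensors V \<J> \<C> \<V> (?H X)" if "X \<in> \<G>" for X
    using H_counit[OF that]
    by (simp add: preserves_cotensors_def C.is_cotensor_iff_universal_counit VV.is_cotensor_iff_universal_counit)
  \<comment> \<open>Down to \<open>V\<close>, across by the representable, and up again. The first
    move needs \<open>W\<close> to be an object of \<open>V\<close>, which holds for
    arities.\<close>
  have H_counit': "V'.universal_counit \<V> W (FO (?H X) x) (FO (?H X) P) (Cmp V' (FH (?H X) P x) k)"
    if X: "X \<in> \<G>" and W: "W \<in> \<J>" and k: "V'.universal_counit \<C> W x P k" for X W x P k
  proof -
    have k0: "V.universal_counit \<C> W x P k"
      using universal_counit_restrict[OF C k] W \<J>(1) by auto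
    then have "Cmp V' (FH (?H X) P x) k = Cmp V (FH (?H X) P x) k"
      using V.universal_counitD[OF k0] X \<G> by auto
    then show ?thesis
      using universal_counit_enlarge[OF Vcat H_counit[OF X k0]] by simp
  qed
  have H': "vfunctor V' \<C> \<V> (?H X)" if "X \<in> \<G>" for X
    using enriched_functor_enlarge[OF H[OF that] C Vcat] by unfold_locales
  have faithful: "g = h"
    if xy: "x \<in> vOb \<C>" "y \<in> vOb \<C>" and gh: "g \<in> Ar V'" "h \<in> Ar V'" "Dom V' g = Dom V' h"
      "Cod V' g = vHom \<C> x y" "Cod V' h = vHom \<C> x y"
      and eq: "\<And>X. X \<in> \<G> \<Longrightarrow> Cmp V' (FH (?H X) x y) g = Cmp V' (FH (?H X) x y) h" for x y g h
  proof -
    \<comment> \<open>The generating class is a set of objects of \<C>, hence small relative to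
      \<open>V'\<close>.\<close>
    have "\<exists>Q r. is_product V' \<G> (\<lambda>X. vHom (self_enriched V) (FO (?H X) x) (FO (?H X) y)) Q r"
      using enl(3,4) small_in_subset[OF assms(8) \<G>] xy \<G>
      by (intro small_product[where 'u = 'u]) (auto intro: V'.ordinary_category_axioms)
    then obtain Q r where "is_product V' \<G> (\<lambda>X. vHom (self_enriched V) (FO (?H X) x) (FO (?H X) y)) Q r"
      by (elim exE)
    then show ?thesis
    proof (rule V'.jointly_faithful_eqI[OF _ jf xy C'.vcategory_axioms _ gh eq])
      fix X assume "X \<in> \<G>"
      then show "FH (?H X) x y \<in> ahom V' (vHom \<C> x y) (vHom (self_enriched V) (FO (?H X) x) (FO (?H X) y))"
        using xy \<G> by (auto simp: ahom_iff)
    qed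
  qed
  have main: "commutes V V' \<J> \<C> T A U B \<longleftrightarrow>
        (\<forall>X \<in> \<G>. commutes V V' \<J> \<V> T (vfun_comp V (?H X) A) U (vfun_comp V (?H X) B))"
    if pair: "algebra_pair V \<J> \<C> T A U B" for T A U B
  proof -
    have "designated_cotensors V \<J> \<C>" using assms(9) by (simp add: admissible_def)
    then interpret P: algebra_pair_over V' \<C> T U V \<J> A B
      by (intro algebra_pair_over_enlargement[OF assms(4) C _ enl(3,4) small_\<J> pair])
    let ?HA = "\<lambda>X. vfun_comp V (?H X) A" and ?HB = "\<lambda>X. vfun_comp V (?H X) B"
    have TU: "is_theory V \<J> T" "is_theory V \<J> U" "is_algebra V \<J> T \<C> A" "is_algebra V \<J> U \<C> B"
      "FO A (unit_ob V) = FO B (unit_ob V)"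
      using pair by (auto simp: algebra_pair_def)
    have pairH: "algebra_pair V \<J> \<V> T (?HA X) U (?HB X)" if "X \<in> \<G>" for X
      using TU V.algebra_comp[OF _ _ C Vcat H[OF that] H_pres[OF that]]
      by (simp add: algebra_pair_def) (simp add: vfun_comp_def)
    have PX: "algebra_pair_over V' \<V> T U \<J> (?HA X) (?HB X)" if "X \<in> \<G>" for X
      by (rule algebra_pair_over_enlargement[OF assms(4) Vcat assms(6) enl(3,4) small_\<J> pairH[OF that]])
    have A_in: "FO A K \<in> vOb \<C>" "FH A K L \<in> Ar V" "Dom V (FH A K L) = vHom T K L" "Cod V (FH A K L) = vHom \<C> (FO A K) (FO A L)"
      if "K \<in> \<J>" "L \<in> \<J>" for K L
      using TU that by (auto simp: is_algebra_def enriched_functor_def ahom_iff is_theory_def)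
    have B_in: "FO B K \<in> vOb \<C>" "FH B K L \<in> Ar V" "Dom V (FH B K L) = vHom U K L" "Cod V (FH B K L) = vHom \<C> (FO B K) (FO B L)"
      if "K \<in> \<J>" "L \<in> \<J>" for K L
      using TU that by (auto simp: is_algebra_def enriched_functor_def ahom_iff is_theory_def)
    have HA: "V'.composite_on T (?H X) A (?HA X)" and HB: "V'.composite_on U (?H X) B (?HB X)" if "X \<in> \<G>" for X
      using that \<G> by (auto simp: V'.composite_on_def vfun_comp_def A_in B_in subset_eq)
    \<comment> \<open>The images of [J, A] and its counit under \<C>(X, -). They form a cotensor of
      the composite algebra, in general different from the designated \<open>Q.P J\<close> that
      occurs in commutants in \<V>.\<close>
    let ?HP = "\<lambda>X J. vfun_comp V' (?H X) (P.P J)"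
    let ?Hk = "\<lambda>X J K. Cmp V' (FH (?H X) (FO (P.P J) K) (FO A K)) (P.k J K)"
    have HP: "V'.composite_on T (?H X) (P.P J) (?HP X J)" for X J
      by (simp add: V'.composite_on_def vfun_comp_def)
    have g: "V'.generic_op U J \<in> ahom V' J (vHom U J (unit_ob V'))" if "J \<in> \<J>" for J
      using that by (simp add: ahom_iff)
    have HPk: "V'.pointwise_cotensor T \<V> J (?HA X) (?HP X J) (?Hk X J)" if X: "X \<in> \<G>" and J: "J \<in> \<J>" for X J
    proof -
      interpret HX: vfunctor V' \<C> \<V> "?H X" by (rule H'[OF X])
      show ?thesis
        by (rule HX.pointwise_cotensor_composite[OF P.T.vcategory_axioms P.prefunctor_A HA[OF X] HP P.pointwise_cotensor_P[OF J]])
          (rule H_counit'[OF X J])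
    qed
    have carrier: "FO (?HA X) (unit_ob V') = FO (?HB X) (unit_ob V')" for X
      using P.carrier by (simp add: vfun_comp_def)
    show ?thesis
    proof
      assume comm: "commutes V V' \<J> \<C> T A U B"
      show "\<forall>X \<in> \<G>. commutes V V' \<J> \<V> T (?HA X) U (?HB X)"
      proof
        fix X assume X: "X \<in> \<G>"
        interpret HX: vfunctor V' \<C> \<V> "?H X" by (rule H'[OF X])
        interpret Q: algebra_pair_over V' \<V> T U V \<J> "?HA X" "?HB X" by (rule PX[OF X])
        show "commutes V V' \<J> \<V> T (?HA X) U (?HB X)"
          unfolding Q.commutes_iff
        proof
          fix J assume J: "J \<in> \<J>"
          have "V'.operations_extend T \<C> A U B J (V'.generic_op U J) (P.P J) (P.k J)"
            using comm J by (simp add: P.commutes_iff)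
          then have "V'.operations_extend T \<V> (?HA X) U (?HB X) J (V'.generic_op U J) (?HP X J) (?Hk X J)"
            using J \<J>(2) by (intro HX.operations_extend_composite[OF P.T.vcategory_axioms P.prefunctor_A P.prefunctor_B
                  P.prefunctor_P[OF J] HA[OF X] HB[OF X] HP g[OF J]] P.carrier) auto
          \<comment> \<open>Passage from the image of the designated cotensor in \<C> to the
            designated one in \<V>; the converse direction makes the opposite change.\<close>
          then show "V'.operations_extend T \<V> (?HA X) U (?HB X) J (V'.generic_op U J) (Q.P J) (Q.k J)"
            using J \<J>(2) by (intro VV'.operations_extend_independent[OF P.T.vcategory_axioms Q.prefunctor_A Q.prefunctor_B
                  HPk[OF X J] Q.pointwise_cotensor_P[OF J] g[OF J]] carrier) auto
        qed
      qed
    next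
      assume comm: "\<forall>X \<in> \<G>. commutes V V' \<J> \<V> T (?HA X) U (?HB X)"
      show "commutes V V' \<J> \<C> T A U B"
        unfolding P.commutes_iff
      proof
        fix J assume J: "J \<in> \<J>"
        have ex: "V'.operations_extend T \<V> (?HA X) U (?HB X) J (V'.generic_op U J) (?HP X J) (?Hk X J)" if X: "X \<in> \<G>" for X
        proof -
          interpret Q: algebra_pair_over V' \<V> T U V \<J> "?HA X" "?HB X" by (rule PX[OF X])
          have "V'.operations_extend T \<V> (?HA X) U (?HB X) J (V'.generic_op U J) (Q.P J) (Q.k J)"
            using bspec[OF comm X] J unfolding Q.commutes_iff by blast
          then show ?thesis
            using J \<J>(2) by (intro VV'.operations_extend_independent[OF P.T.vcategory_axioms Q.prefunctor_A Q.prefunctor_B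
                  Q.pointwise_cotensor_P[OF J] HPk[OF X J] g[OF J]] carrier) auto
        qed
        show "V'.operations_extend T \<C> A U B J (V'.generic_op U J) (P.P J) (P.k J)"
        \<comment> \<open>Preservation is asked for J and for the objects of \<open>T\<close>
          because the proof uses \<open>B J\<close> and the \<open>A L\<close> as cotensors of the
          carrier. All these are arities, so \<open>H_counit'\<close> applies.\<close>
        proof (rule C'.operations_extend_reflect[where Y = "\<lambda>_. \<V>" and H = ?H and \<Lambda> = \<G> and \<gamma> = "V'.generic_op T"
              and HA = ?HA and HB = ?HB and HD = "\<lambda>X. ?HP X J"])
          show "V'.universal_counit \<V> W (FO (?H X) x) (FO (?H X) Q) (Cmp V' (FH (?H X) Q x) k)"
            if "X \<in> \<G>" "W \<in> insert J (vOb T)" "V'.universal_counit \<C> W x Q k" for X x Q k W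
            using that J by (intro H_counit') auto
        qed (use J \<J>(2) P.generic_T P.A_counit P.B_counit P.carrier P.pointwise_cotensor_P P.A P.prefunctor_B
            P.T.vcategory_axioms P.U.vcategory_axioms H' faithful HA HB HP g ex in auto)
      qed
    qed
  qed
  then show ?thesis
    unfolding jointly_reflects_commuting_def using H H_pres by blast
qed

end
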